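(* Let $d\ge2$, $s\ge 1$, and let $\{E_r\}_{r>0}\subset\mathfrak{C}$ be such that $E_r\to E$ in $\mathfrak{C}$ as $r\to0^+$ for some $E\in\mathfrak{C}$. Then for every $x\in\partial E\cap\partial E_r$ for all $r>0$, $$\lim_{r\to0^+}\frac{\mathcal K^s_r(x,E_r)}{\sigma^s(r)}=\omega_{d-1}\mathcal K^1(x,E).$$
   Context: $\mathfrak{C}$ is the class of subsets of $\mathbb{R}^d$ which are closures of open sets with compact $C^2$ boundary; $E_r\to E$ in $\mathfrak{C}$ means there are diffeomorphisms $\Phi_r$ converging to the identity in $C^2$ with $\Phi_r(E)=E_r$. $k^s_r(t)=r^{-d-s}$ for $0\le t\le r$ and $k^s_r(t)=t^{-d-s}$ for $t>r$; $\mathcal K^s_r(x,E):=\int_{\mathbb{R}^d}(\chi_{\mathbb{R}^d\setminus E}(y)-\chi_E(y))k^s_r(|x-y|)\,dy$. $\sigma^s(r):=|\log r|$ if $s=1$, $\sigma^s(r):=\frac{d+s}{d+1}\frac{r^{1-s}}{s-1}$ if $s>1$. $\omega_{d-1}$ is the measure of the unit ball of $\mathbb{R}^{d-1}$. $\mathcal K^1(x,E)$ is the classical scalar mean curvature (sum of principal curvatures) of $\partial E$ at $x$, with the convention that if $E$ is locally $\{y_d\le f(y')\}$ with outer normal $e_d$ at $x$ and $Df(x')=0$, then $\mathcal K^1(x,E)=-\Delta f(x')$. *)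

theory Defs
  imports "HOL-Analysis.Analysis"
begin

definition C2_on_with ::
  "'a::euclidean_space set \<Rightarrow> ('a \<Rightarrow> real) \<Rightarrow> ('a \<Rightarrow> 'a \<Rightarrow>\<^sub>L real)
     \<Rightarrow> ('a \<Rightarrow> 'a \<Rightarrow>\<^sub>L ('a \<Rightarrow>\<^sub>L real)) \<Rightarrow> bool" where
  "C2_on_with U f f' f'' \<longleftrightarrow>
     (\<forall>y\<in>U. (f has_derivative blinfun_apply (f' y)) (at y)) \<and>
     (\<forall>y\<in>U. (f' has_derivative blinfun_apply (f'' y)) (at y)) \<and>
     continuous_on U f''"

text \<open>Local subgraph representation of E near x: in the ball B(x,rho), E coincides with
  the set of points y with (y - x).nu <= f(y), where nu is a unit vector (the outer normal
  direction, playing the role of e_d) and f is a C^2 function of the coordinates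
  orthogonal to nu (i.e. f is constant along the direction nu).\<close>
definition local_subgraph ::
  "'a::euclidean_space set \<Rightarrow> 'a \<Rightarrow> 'a \<Rightarrow> real \<Rightarrow> ('a \<Rightarrow> real) \<Rightarrow> ('a \<Rightarrow> 'a \<Rightarrow>\<^sub>L real)
     \<Rightarrow> ('a \<Rightarrow> 'a \<Rightarrow>\<^sub>L ('a \<Rightarrow>\<^sub>L real)) \<Rightarrow> bool" where
  "local_subgraph E x \<nu> \<rho> f f' f'' \<longleftrightarrow>
     norm \<nu> = 1 \<and> \<rho> > 0 \<and> C2_on_with (ball x \<rho>) f f' f'' \<and>
     (\<forall>y\<in>ball x \<rho>. \<forall>t. y + t *\<^sub>R \<nu> \<in> ball x \<rho> \<longrightarrow> f (y + t *\<^sub>R \<nu>) = f y) \<and>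
     (\<forall>y\<in>ball x \<rho>. y \<in> E \<longleftrightarrow> (y - x) \<bullet> \<nu> \<le> f y)"

definition classC :: "'a::euclidean_space set set" where
  "classC = {E. (\<exists>\<Omega>. open \<Omega> \<and> E = closure \<Omega>) \<and> compact (frontier E) \<and>
      (\<forall>x\<in>frontier E. \<exists>\<nu> \<rho> f f' f''. local_subgraph E x \<nu> \<rho> f f' f'')}"

definition C2_diffeo_with ::
  "('a::euclidean_space \<Rightarrow> 'a) \<Rightarrow> ('a \<Rightarrow> 'a \<Rightarrow>\<^sub>L 'a) \<Rightarrow> ('a \<Rightarrow> 'a \<Rightarrow>\<^sub>L ('a \<Rightarrow>\<^sub>L 'a)) \<Rightarrow> bool" where
  "C2_diffeo_with \<Phi> D D2 \<longleftrightarrow>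
     bij \<Phi> \<and>
     (\<forall>y. (\<Phi> has_derivative blinfun_apply (D y)) (at y)) \<and>
     (\<forall>y. (D has_derivative blinfun_apply (D2 y)) (at y)) \<and>
     continuous_on UNIV D2 \<and>
     (\<forall>y. bij (blinfun_apply (D y)))"

definition converges_C ::
  "(real \<Rightarrow> 'a::euclidean_space set) \<Rightarrow> 'a set \<Rightarrow> bool" where
  "converges_C Er E \<longleftrightarrow>
     (\<exists>\<Phi> D D2. (\<forall>r>0. C2_diffeo_with (\<Phi> r) (D r) (D2 r) \<and> \<Phi> r ` E = Er r) \<and>
        (\<forall>\<epsilon>>0. \<forall>\<^sub>F r in at_right 0. \<forall>y.
            norm (\<Phi> r y - y) \<le> \<epsilon> \<and> norm (D r y - id_blinfun) \<le> \<epsilon> \<and> norm (D2 r y) \<le> \<epsilon>))"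

definition kernel :: "nat \<Rightarrow> real \<Rightarrow> real \<Rightarrow> real \<Rightarrow> real" where
  "kernel d s r t = (if t \<le> r then r powr (- real d - s) else t powr (- real d - s))"

definition Ksr :: "real \<Rightarrow> real \<Rightarrow> 'a::euclidean_space \<Rightarrow> 'a set \<Rightarrow> real" where
  "Ksr s r x E = (LINT y|lborel.
      (indicator (UNIV - E) y - indicator E y) * kernel DIM('a) s r (norm (x - y)))"

definition sigma :: "nat \<Rightarrow> real \<Rightarrow> real \<Rightarrow> real" where
  "sigma d s r = (if s = 1 then \<bar>ln r\<bar>
      else (real d + s) / (real d + 1) * r powr (1 - s) / (s - 1))"

text \<open>Classical scalar mean curvature: if E is locally {(y-x).nu \<le> f(y)} with outer normal
  nu, f(x) = 0 and Df(x) = 0, then \<K>^1(x,E) = - (Laplacian of f at x).  Since f is constant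
  along nu, the full trace of the Hessian equals the (d-1)-dimensional Laplacian.\<close>
definition meanK :: "'a::euclidean_space \<Rightarrow> 'a set \<Rightarrow> real" where
  "meanK x E = (THE k. \<exists>\<nu> \<rho> f f' f''. local_subgraph E x \<nu> \<rho> f f' f'' \<and>
       f x = 0 \<and> f' x = 0 \<and>
       k = - (\<Sum>b\<in>Basis. blinfun_apply (blinfun_apply (f'' x) b) b))"

end

theory Submission
  imports Defs "HOL-Real_Asymp.Real_Asymp"
begin

text \<open>
  Writing the kernel as a superposition of indicator functions of balls gives
  \<open>Ksr s r x E = (\<integral>t\<ge>r. (d + s) * t powr (- d - s - 1) * sgvol E x t)\<close>, where \<open>sgvol E x t\<close> is the
  volume of the ball of radius \<open>t\<close> outside \<open>E\<close> minus the volume inside. So it suffices that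
  \<open>sgvol (Er r) x t \<sim> c * t ^ (d + 1)\<close> as \<open>r, t \<rightarrow> 0\<close> jointly, with \<open>c * (d + 1) = \<omega>\<^bsub>d-1\<^esub> * \<K>\<^sup>1\<close>:
  the part \<open>t \<ge> \<delta>\<close> stays bounded while \<open>sigma\<close> blows up. By \<open>C\<^sup>2\<close> convergence, \<open>Er r\<close> is near \<open>x\<close> the set
  \<open>{z \<bullet> n + A z z / 2 + o(|z|\<^sup>2) \<le> 0}\<close> with \<open>n \<rightarrow> \<nu>\<close> and \<open>A = - D\<^sup>2f(x)\<close>; after rescaling to the unit ball,
  integrating along the lines parallel to \<open>n\<close> reduces the signed volume to the integral of \<open>A w w\<close>
  over the unit disc orthogonal to \<open>n\<close>, a multiple of the trace of \<open>A\<close> on that hyperplane.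

  That \<open>meanK\<close> is well defined is a by-product: applied to the constant family, the limit
  shows that all normal graph representations have the same Laplacian.
\<close>

section \<open>Integration along lines of a given direction\<close>

text \<open>The maps in \<open>converges_C\<close> need not fix \<open>x\<close>. Near
  \<open>x\<close>, the boundary of \<open>Er r\<close> is the image of the boundary of
  \<open>E\<close> near another point \<open>a\<close>, so the normal \<open>n\<close> varies with
  \<open>r\<close>, and no rate ties its tilt to the scale \<open>t\<close>. Integrating over balls
  copes with this: every half-space through \<open>x\<close>, whatever its normal, has signed volume
  zero, so the tilt costs nothing at first order and only its effect on the quadratic term must be
  small. Hence the volume estimates are uniform in the normal, with thresholds that depend only on a
  bound for \<open>A\<close> and on the tolerance.

  The charts of \<open>classC\<close> may be graphs in any direction transversal to the boundary,
  whereas \<open>meanK\<close> asks for a graph over the tangent hyperplane; producing one is an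
  implicit function argument that has to keep C^2 regularity.

  The constants match as follows: a coordinate on the unit disc of dimension d - 1 has second moment
  \<omega> / (d + 1), with \<omega> the measure of the disc, and \<open>sigma\<close> is scaled so
  that (d + s) times the integral of \<open>t powr (- s)\<close> from r to \<delta> is asymptotic to
  (d + 1) times \<open>sigma\<close>.\<close>

definition perp :: "'a::euclidean_space \<Rightarrow> 'a \<Rightarrow> 'a" where
  "perp \<nu> v = v - (v \<bullet> \<nu>) *\<^sub>R \<nu>"

text \<open>
  Since \<open>cyl\<close> has height 1 along \<open>\<nu>\<close>, integrals over it of functions of \<open>perp \<nu> v\<close> play the role of
  \<open>(d - 1)\<close>-dimensional integrals over the unit disc of the hyperplane orthogonal to \<open>\<nu>\<close>.
\<close>
definition cyl :: "'a::euclidean_space \<Rightarrow> 'a set" where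
  "cyl \<nu> = {v. norm (perp \<nu> v) \<le> 1 \<and> 0 \<le> v \<bullet> \<nu> \<and> v \<bullet> \<nu> \<le> 1}"

lemma linear_perp: "linear (perp \<nu>)"
  by (auto simp: perp_def algebra_simps intro!: linearI)

lemma continuous_on_perp [continuous_intros]:
  "continuous_on S f \<Longrightarrow> continuous_on S (\<lambda>x. perp \<nu> (f x))"
  unfolding perp_def by (intro continuous_intros)

lemma borel_measurable_perp [measurable]: "perp \<nu> \<in> borel_measurable borel"
  by (intro borel_measurable_continuous_onI continuous_intros)

lemma perp_scaleR: "perp \<nu> (c *\<^sub>R v) = c *\<^sub>R perp \<nu> v"
  using linear_perp linear_scale by blast

lemma perp_inner [simp]: "norm \<nu> = 1 \<Longrightarrow> perp \<nu> v \<bullet> \<nu> = 0"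
  by (simp add: perp_def inner_diff_left norm_eq_1)

lemma perp_perp_add [simp]: "norm \<nu> = 1 \<Longrightarrow> perp \<nu> (perp \<nu> v + u *\<^sub>R \<nu>) = perp \<nu> v"
  by (simp add: perp_def algebra_simps inner_diff_left norm_eq_1)

lemma perp_add_inner: "perp \<nu> v + (v \<bullet> \<nu>) *\<^sub>R \<nu> = v"
  by (simp add: perp_def)

lemma perp_inner_add [simp]: "norm \<nu> = 1 \<Longrightarrow> (perp \<nu> v + u *\<^sub>R \<nu>) \<bullet> \<nu> = u"
  by (simp add: inner_add_left norm_eq_1)

lemma norm_perp_add:
  assumes "norm \<nu> = 1"
  shows "(norm (perp \<nu> v + u *\<^sub>R \<nu>))\<^sup>2 = (norm (perp \<nu> v))\<^sup>2 + u\<^sup>2"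
proof -
  have "(norm (perp \<nu> v + u *\<^sub>R \<nu>))\<^sup>2 = (norm (perp \<nu> v))\<^sup>2 + (norm (u *\<^sub>R \<nu>))\<^sup>2"
    by (rule norm_add_Pythagorean) (simp add: orthogonal_def assms)
  then show ?thesis using assms by simp
qed

lemma norm_perp_le: "norm \<nu> = 1 \<Longrightarrow> norm (perp \<nu> v) \<le> norm v"
  using norm_perp_add[of \<nu> v "v \<bullet> \<nu>"] power_mono_iff[of "norm (perp \<nu> v)" "norm v" 2]
  by (simp add: perp_add_inner)

lemma nn_integral_lborel_shift:
  fixes F :: "'a::euclidean_space \<Rightarrow> ennreal"
  assumes [measurable]: "F \<in> borel_measurable borel"
  shows "(\<integral>\<^sup>+ v. F (c + v) \<partial>lborel) = (\<integral>\<^sup>+ v. F v \<partial>lborel)"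
proof -
  have "(\<integral>\<^sup>+ v. F v \<partial>lborel) = (\<integral>\<^sup>+ v. F v \<partial>(distr lborel borel ((+) c)))"
    by (simp add: lborel_distr_plus)
  also have "\<dots> = (\<integral>\<^sup>+ v. F (c + v) \<partial>lborel)"
    by (subst nn_integral_distr) auto
  finally show ?thesis ..
qed

text \<open>
  Fubini in the direction \<open>\<nu>\<close> without choosing coordinates: shift the line parameter by \<open>v \<bullet> \<nu>\<close>,
  swap the integrals, and use translation invariance.
\<close>
lemma nn_integral_line_fibration:
  fixes F :: "'a::euclidean_space \<Rightarrow> ennreal"
  assumes [measurable]: "F \<in> borel_measurable borel" and \<nu>: "norm \<nu> = 1"
  shows "(\<integral>\<^sup>+ v. F v \<partial>lborel) =
    (\<integral>\<^sup>+ v. indicator {v. 0 \<le> v \<bullet> \<nu> \<and> v \<bullet> \<nu> \<le> 1} v * (\<integral>\<^sup>+ u. F (perp \<nu> v + u *\<^sub>R \<nu>) \<partial>lborel) \<partial>lborel)"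
    (is "_ = ?R")
proof -
  define I where "I v = (indicator {v::'a. 0 \<le> v \<bullet> \<nu> \<and> v \<bullet> \<nu> \<le> 1} v :: ennreal)" for v
  have [measurable]: "I \<in> borel_measurable borel"
    unfolding I_def by measurable
  have "(\<integral>\<^sup>+ u. F (perp \<nu> v + u *\<^sub>R \<nu>) \<partial>lborel) = (\<integral>\<^sup>+ u. F (v + u *\<^sub>R \<nu>) \<partial>lborel)" for v
  proof -
    have "(\<integral>\<^sup>+ u. F (perp \<nu> v + u *\<^sub>R \<nu>) \<partial>lborel) = (\<integral>\<^sup>+ u. F (perp \<nu> v + (v \<bullet> \<nu> + u) *\<^sub>R \<nu>) \<partial>lborel)"
      by (rule nn_integral_lborel_shift[symmetric]) measurable
    then show ?thesis by (simp add: perp_def algebra_simps)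
  qed
  then have "?R = (\<integral>\<^sup>+ v. I v * (\<integral>\<^sup>+ u. F (v + u *\<^sub>R \<nu>) \<partial>lborel) \<partial>lborel)"
    by (simp add: I_def)
  also have "\<dots> = (\<integral>\<^sup>+ v. (\<integral>\<^sup>+ u. I v * F (v + u *\<^sub>R \<nu>) \<partial>lborel) \<partial>lborel)"
    by (intro nn_integral_cong nn_integral_cmult[symmetric]) measurable
  also have "\<dots> = (\<integral>\<^sup>+ u. (\<integral>\<^sup>+ v. I v * F (v + u *\<^sub>R \<nu>) \<partial>lborel) \<partial>lborel)"
    by (rule lborel_pair.Fubini') measurable
  also have "\<dots> = (\<integral>\<^sup>+ u. (\<integral>\<^sup>+ v. I (v - u *\<^sub>R \<nu>) * F v \<partial>lborel) \<partial>lborel)"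
  proof (rule nn_integral_cong)
    fix u
    show "(\<integral>\<^sup>+ v. I v * F (v + u *\<^sub>R \<nu>) \<partial>lborel) = (\<integral>\<^sup>+ v. I (v - u *\<^sub>R \<nu>) * F v \<partial>lborel)"
      using nn_integral_lborel_shift[of "\<lambda>v. I (v - u *\<^sub>R \<nu>) * F v" "u *\<^sub>R \<nu>"]
      by (simp add: add.commute)
  qed
  also have "\<dots> = (\<integral>\<^sup>+ v. (\<integral>\<^sup>+ u. I (v - u *\<^sub>R \<nu>) * F v \<partial>lborel) \<partial>lborel)"
    by (rule lborel_pair.Fubini') measurable
  also have "\<dots> = (\<integral>\<^sup>+ v. F v \<partial>lborel)"
  proof (rule nn_integral_cong)
    fix v
    have "(\<integral>\<^sup>+ u. I (v - u *\<^sub>R \<nu>) * F v \<partial>lborel) = (\<integral>\<^sup>+ u. I (v - u *\<^sub>R \<nu>) \<partial>lborel) * F v"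
      by (rule nn_integral_multc) measurable
    \<comment> \<open>The parameters \<open>u\<close> that move \<open>v\<close> into the slab fill
      an interval of length one. This is why the slab has height one: its indicator integrates
      out.\<close>
    also have "(\<integral>\<^sup>+ u. I (v - u *\<^sub>R \<nu>) \<partial>lborel) = (\<integral>\<^sup>+ u. indicator {v \<bullet> \<nu> - 1..v \<bullet> \<nu>} u \<partial>lborel)"
      using \<nu> by (intro nn_integral_cong) (auto simp: I_def indicator_def inner_diff_left norm_eq_1)
    also have "\<dots> = 1" by simp
    finally show "(\<integral>\<^sup>+ u. I (v - u *\<^sub>R \<nu>) * F v \<partial>lborel) = F v" by simp
  qed
  finally show ?thesis ..
qed

section \<open>Reflections, dilations and the volume of the unit disc\<close>

lemma sets_cyl [measurable]: "cyl \<nu> \<in> sets borel"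
  unfolding cyl_def by measurable

text \<open>On each line in direction \<open>e\<close> the reflection keeps the base point
  \<open>perp e v\<close> and negates the parameter, so the fibration reduces the claim to the
  invariance of one-dimensional measure under sign change. It supplies the symmetry behind the
  second moments of the disc.\<close>

lemma distr_lborel_reflection:
  fixes e :: "'a::euclidean_space"
  assumes e: "norm e = 1"
  shows "distr lborel borel (\<lambda>v. v - (2 * (v \<bullet> e)) *\<^sub>R e) = lborel"
proof (rule measure_eqI)
  fix A assume "A \<in> sets (distr lborel borel (\<lambda>v::'a. v - (2 * (v \<bullet> e)) *\<^sub>R e))"
  then have [measurable]: "A \<in> sets borel" by simp
  let ?S = "indicator {v. 0 \<le> v \<bullet> e \<and> v \<bullet> e \<le> 1} :: 'a \<Rightarrow> ennreal"
  define R where "R v = v - (2 * (v \<bullet> e)) *\<^sub>R e" for v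
  have [measurable]: "R \<in> borel_measurable borel" unfolding R_def by measurable
  have R: "R (perp e v + u *\<^sub>R e) = perp e v + (- u) *\<^sub>R e" for v u
    unfolding R_def by (subst perp_inner_add[OF e]) (simp only: mult_2 scaleR_add_left, simp)
  have "emeasure (distr lborel borel R) A = (\<integral>\<^sup>+ v. indicator A v \<partial>(distr lborel borel R))"
    by simp
  also have "\<dots> = (\<integral>\<^sup>+ v. indicator A (R v) \<partial>lborel)"
    by (rule nn_integral_distr) auto
  also have "\<dots> = (\<integral>\<^sup>+ v. ?S v * (\<integral>\<^sup>+ u. indicator A (R (perp e v + u *\<^sub>R e)) \<partial>lborel) \<partial>lborel)"
    by (rule nn_integral_line_fibration[OF _ e]) measurable
  also have "\<dots> = (\<integral>\<^sup>+ v. ?S v * (\<integral>\<^sup>+ u. indicator A (perp e v + u *\<^sub>R e) \<partial>lborel) \<partial>lborel)"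
  proof -
    have "(\<integral>\<^sup>+ u. indicator A (R (perp e v + u *\<^sub>R e)) \<partial>lborel) = (\<integral>\<^sup>+ u. indicator A (perp e v + u *\<^sub>R e) \<partial>lborel)" for v
      by (subst nn_integral_real_affine[where c="-1" and t=0]) (auto simp: R)
    then show ?thesis by simp
  qed
  also have "\<dots> = (\<integral>\<^sup>+ v. indicator A v \<partial>lborel)"
    by (rule nn_integral_line_fibration[OF _ e, symmetric]) measurable
  finally show "emeasure (distr lborel borel (\<lambda>v::'a. v - (2 * (v \<bullet> e)) *\<^sub>R e)) A = emeasure lborel A"
    by (simp add: R_def[abs_def])
qed simp

lemma emeasure_lborel_scaleR_vimage:
  fixes A :: "'a::euclidean_space set"
  assumes [measurable]: "A \<in> sets borel" and c: "c > 0"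
  shows "emeasure lborel A = ennreal (c ^ DIM('a)) * emeasure lborel ((\<lambda>v. t + c *\<^sub>R v) -` A)"
proof -
  have "emeasure lborel A = emeasure (density (distr lborel borel (\<lambda>x. t + c *\<^sub>R x)) (\<lambda>_. \<bar>c\<bar>^DIM('a))) A"
    using lborel_affine[of c t] c by auto
  also have "\<dots> = ennreal (c ^ DIM('a)) * emeasure (distr lborel borel (\<lambda>x. t + c *\<^sub>R x)) A"
    using c by (subst emeasure_density) (auto simp: nn_integral_cmult_indicator)
  also have "emeasure (distr lborel borel (\<lambda>x. t + c *\<^sub>R x)) A = emeasure lborel ((\<lambda>v. t + c *\<^sub>R v) -` A)"
    by (subst emeasure_distr) auto
  finally show ?thesis .
qed

text \<open>Dilation by \<rho> turns the disc of radius \<rho> into the unit disc but changes the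
  height from 1 to 1/\<rho>. The fibration restores the height at the cost of one factor \<rho>,
  which leaves the exponent d - 1.\<close>

lemma emeasure_cyl_radius:
  fixes \<nu> :: "'a::euclidean_space"
  assumes \<nu>: "norm \<nu> = 1" and \<rho>: "\<rho> > 0"
  shows "emeasure lborel {v. norm (perp \<nu> v) \<le> \<rho> \<and> 0 \<le> v \<bullet> \<nu> \<and> v \<bullet> \<nu> \<le> 1} =
     ennreal (\<rho> ^ (DIM('a) - 1)) * emeasure lborel (cyl \<nu>)"
proof -
  let ?A = "{v. norm (perp \<nu> v) \<le> \<rho> \<and> 0 \<le> v \<bullet> \<nu> \<and> v \<bullet> \<nu> \<le> 1}"
  let ?B = "{v. norm (perp \<nu> v) \<le> 1 \<and> 0 \<le> v \<bullet> \<nu> \<and> v \<bullet> \<nu> \<le> 1/\<rho>}"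
  have "emeasure lborel ?A = ennreal (\<rho> ^ DIM('a)) * emeasure lborel ((\<lambda>v. 0 + \<rho> *\<^sub>R v) -` ?A)"
    by (rule emeasure_lborel_scaleR_vimage) (use \<rho> in measurable)
  also have "(\<lambda>v. 0 + \<rho> *\<^sub>R v) -` ?A = ?B"
    using \<rho> by (auto simp: perp_scaleR field_simps zero_le_mult_iff)
  also have "emeasure lborel ?B = (\<integral>\<^sup>+ v. indicator ?B v \<partial>lborel)"
    by (subst nn_integral_indicator) auto
  also have "\<dots> = (\<integral>\<^sup>+ v. indicator {v. 0 \<le> v \<bullet> \<nu> \<and> v \<bullet> \<nu> \<le> 1} v * (\<integral>\<^sup>+ u. indicator ?B (perp \<nu> v + u *\<^sub>R \<nu>) \<partial>lborel) \<partial>lborel)"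
    by (rule nn_integral_line_fibration[OF _ \<nu>]) measurable
  also have "\<dots> = (\<integral>\<^sup>+ v. ennreal (1/\<rho>) * indicator (cyl \<nu>) v \<partial>lborel)"
  proof (intro nn_integral_cong)
    fix v
    have "(\<integral>\<^sup>+ u. indicator ?B (perp \<nu> v + u *\<^sub>R \<nu>) \<partial>lborel) =
        (\<integral>\<^sup>+ u. indicator {v. norm (perp \<nu> v) \<le> 1} v * indicator {0..1/\<rho>} u \<partial>lborel)"
      using \<nu> by (intro nn_integral_cong) (auto simp: indicator_def)
    also have "\<dots> = indicator {v. norm (perp \<nu> v) \<le> 1} v * ennreal (1/\<rho>)"
      using \<rho> by (subst nn_integral_cmult) auto
    finally show "indicator {v. 0 \<le> v \<bullet> \<nu> \<and> v \<bullet> \<nu> \<le> 1} v * (\<integral>\<^sup>+ u. indicator ?B (perp \<nu> v + u *\<^sub>R \<nu>) \<partial>lborel) =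
       ennreal (1/\<rho>) * indicator (cyl \<nu>) v"
      by (auto simp: indicator_def cyl_def)
  qed
  also have "\<dots> = ennreal (1/\<rho>) * emeasure lborel (cyl \<nu>)"
    by (subst nn_integral_cmult_indicator) auto
  also have "ennreal (\<rho> ^ DIM('a)) * (ennreal (1/\<rho>) * emeasure lborel (cyl \<nu>)) = 
     ennreal (\<rho> ^ DIM('a) * (1/\<rho>)) * emeasure lborel (cyl \<nu>)"
    using \<rho> by (subst ennreal_mult) (auto simp: mult.assoc)
  also have "\<rho> ^ DIM('a) * (1/\<rho>) = \<rho> ^ (DIM('a) - 1)"
    using \<rho> by (simp add: power_diff)
  finally show ?thesis .
qed

text \<open>The recursion of slicing: the Beta value is the integral of (1 - u^2)^(n/2) over
  [-1, 1], the total weight of the slices of a ball of dimension n + 1.\<close>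

lemma unit_ball_vol_Suc:
  "unit_ball_vol (real (Suc n)) = unit_ball_vol (real n) * Beta (1/2) (real n / 2 + 1)"
  by (auto simp: unit_ball_vol_def Beta_def Gamma_eq_zero_iff field_simps
          Gamma_one_half_real powr_half_sqrt [symmetric] powr_add [symmetric])

text \<open>The hyperplane is never identified with a space of dimension d - 1. Instead the
  d-dimensional ball is cut orthogonally to \<nu>: its slices are discs of radius
  \<open>sqrt (1 - u\<^sup>2)\<close>, measured by the unknown \<open>a\<close> times a power of the
  radius. Comparing with the known volume of the ball and its recursion determines
  \<open>a\<close>.\<close>

lemma emeasure_cyl:
  fixes \<nu> :: "'a::euclidean_space"
  assumes \<nu>: "norm \<nu> = 1"
  shows "emeasure lborel (cyl \<nu>) = ennreal (unit_ball_vol (real (DIM('a) - 1)))"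
proof -
  define n where "n = DIM('a) - 1"
  let ?S = "indicator {v. 0 \<le> v \<bullet> \<nu> \<and> v \<bullet> \<nu> \<le> 1} :: 'a \<Rightarrow> ennreal"
  define a where "a = emeasure lborel (cyl \<nu>)"
  define C where "C = cball (0::'a) 1"
  have [measurable]: "C \<in> sets borel" by (simp add: C_def)
  have n: "Suc n = DIM('a)" by (simp add: n_def)
  have "ennreal (unit_ball_vol (real (Suc n))) = emeasure lborel C"
    unfolding C_def by (subst emeasure_cball) (simp_all flip: n)
  also have "\<dots> = (\<integral>\<^sup>+ v. indicator C v \<partial>lborel)"
    by simp
  also have "\<dots> = (\<integral>\<^sup>+ v. ?S v * (\<integral>\<^sup>+ u. indicator C (perp \<nu> v + u *\<^sub>R \<nu>) \<partial>lborel) \<partial>lborel)"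
    by (rule nn_integral_line_fibration[OF _ \<nu>]) measurable
  also have "\<dots> = (\<integral>\<^sup>+ v. (\<integral>\<^sup>+ u. ?S v * indicator C (perp \<nu> v + u *\<^sub>R \<nu>) \<partial>lborel) \<partial>lborel)"
    by (intro nn_integral_cong nn_integral_cmult[symmetric]) measurable
  also have "\<dots> = (\<integral>\<^sup>+ u. (\<integral>\<^sup>+ v. ?S v * indicator C (perp \<nu> v + u *\<^sub>R \<nu>) \<partial>lborel) \<partial>lborel)"
    by (rule lborel_pair.Fubini') measurable
  also have "\<dots> = (\<integral>\<^sup>+ u. a * (indicator {-1..1} u * ennreal (sqrt (1 - u\<^sup>2) ^ n)) \<partial>lborel)"
  proof (rule nn_integral_cong_AE)
    \<comment> \<open>At these two heights the slice has radius zero, which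
      \<open>emeasure_cyl_radius\<close> excludes.\<close>
    have "AE y in lborel. y \<notin> {-1,1::real}"
      by (intro AE_not_in countable_imp_null_set_lborel) auto
    then show "AE u in lborel. (\<integral>\<^sup>+ v. ?S v * indicator C (perp \<nu> v + u *\<^sub>R \<nu>) \<partial>lborel)
       = a * (indicator {-1..1} u * ennreal (sqrt (1 - u\<^sup>2) ^ n))"
    proof eventually_elim
      case (elim u)
      have mem: "(perp \<nu> v + u *\<^sub>R \<nu>) \<in> C \<longleftrightarrow> (norm (perp \<nu> v))\<^sup>2 + u\<^sup>2 \<le> 1" for v
        using norm_perp_add[OF \<nu>, of v u] 
          power_mono_iff[of "norm (perp \<nu> v + u *\<^sub>R \<nu>)" 1 2] by (simp add: C_def)
      show ?case
      proof (cases "u \<in> {-1<..<1}")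
        case True
        then have u: "0 < 1 - u\<^sup>2" by (simp add: abs_square_less_1 abs_less_iff)
        have "(norm (perp \<nu> v))\<^sup>2 + u\<^sup>2 \<le> 1 \<longleftrightarrow> norm (perp \<nu> v) \<le> sqrt (1 - u\<^sup>2)" for v
          using power_mono_iff[of "norm (perp \<nu> v)" "sqrt (1 - u\<^sup>2)" 2] u by (simp add: le_diff_eq)
        then have "(\<integral>\<^sup>+ v. ?S v * indicator C (perp \<nu> v + u *\<^sub>R \<nu>) \<partial>lborel) =
           (\<integral>\<^sup>+ v. indicator {v. norm (perp \<nu> v) \<le> sqrt (1 - u\<^sup>2) \<and> 0 \<le> v \<bullet> \<nu> \<and> v \<bullet> \<nu> \<le> 1} v \<partial>lborel)"
          unfolding indicator_def mem by (intro nn_integral_cong) auto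
        also have "\<dots> = emeasure lborel {v. norm (perp \<nu> v) \<le> sqrt (1 - u\<^sup>2) \<and> 0 \<le> v \<bullet> \<nu> \<and> v \<bullet> \<nu> \<le> 1}"
          by (subst nn_integral_indicator) auto
        also have "\<dots> = ennreal (sqrt (1 - u\<^sup>2) ^ n) * a"
          unfolding a_def n_def by (rule emeasure_cyl_radius[OF \<nu>]) (use u in simp)
        finally show ?thesis using True by (simp add: mult.commute)
      next
        case False
        with elim have u1: "u \<notin> {-1..1}" by auto
        then have "u\<^sup>2 > 1" using abs_square_le_1[of u] by (cases "u\<^sup>2 \<le> 1") (auto simp: abs_le_iff)
        then have "\<not> (norm (perp \<nu> v))\<^sup>2 + u\<^sup>2 \<le> 1" for v
          using zero_le_power2[of "norm (perp \<nu> v)"] by linarith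
        then show ?thesis using u1 mem by (simp add: indicator_def)
      qed
    qed
  qed
  also have "\<dots> = a * (\<integral>\<^sup>+ u. (indicator {-1..1} u * ennreal (sqrt (1 - u\<^sup>2) ^ n)) \<partial>lborel)"
    by (rule nn_integral_cmult) measurable
  also have "(\<integral>\<^sup>+ u. (indicator {-1..1} u * ennreal (sqrt (1 - u\<^sup>2) ^ n)) \<partial>lborel) = ennreal (Beta (1/2) (real n / 2 + 1))"
    by (subst emeasure_cball_aux_integral[symmetric]) (auto intro!: nn_integral_cong simp: indicator_def)
  finally have eq: "ennreal (unit_ball_vol (real n) * Beta (1/2) (real n / 2 + 1)) = a * ennreal (Beta (1/2) (real n / 2 + 1))"
    unfolding unit_ball_vol_Suc .
  have B: "Beta (1/2) (real n / 2 + 1) > 0"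
    unfolding Beta_def by (intro divide_pos_pos mult_pos_pos Gamma_real_pos) auto
  have "ennreal (unit_ball_vol (real n)) * ennreal (Beta (1/2) (real n / 2 + 1)) = a * ennreal (Beta (1/2) (real n / 2 + 1))"
    using eq B by (subst (asm) ennreal_mult) auto
  then have "a = ennreal (unit_ball_vol (real n))"
    using B ennreal_mult_cancel_left[of "ennreal (Beta (1/2) (real n / 2 + 1))" "ennreal (unit_ball_vol (real n))" a] by (auto simp: mult.commute)
  then show ?thesis by (simp add: a_def n_def)
qed

section \<open>Moments of the cylinder over a unit disc\<close>

lemma measure_cyl:
  fixes \<nu> :: "'a::euclidean_space"
  shows "norm \<nu> = 1 \<Longrightarrow> measure lborel (cyl \<nu>) = unit_ball_vol (real (DIM('a) - 1))"
  by (simp add: measure_def emeasure_cyl)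

lemma integrable_cyl:
  fixes f :: "'a::euclidean_space \<Rightarrow> real"
  assumes "norm \<nu> = 1" "f \<in> borel_measurable borel" "\<And>v. v \<in> cyl \<nu> \<Longrightarrow> \<bar>f v\<bar> \<le> B"
  shows "integrable lborel (\<lambda>v. indicator (cyl \<nu>) v * f v)"
  using integrableI_bounded_set_indicator[of "cyl \<nu>" lborel f B] assms
  by (auto simp: emeasure_cyl)

lemma perp_inner_le_cyl: "v \<in> cyl \<nu> \<Longrightarrow> \<bar>perp \<nu> v \<bullet> a\<bar> \<le> norm a"
  using Cauchy_Schwarz_ineq2[of "perp \<nu> v" a] mult_right_mono[of "norm (perp \<nu> v)" 1 "norm a"]
  by (simp add: cyl_def)

lemma integrable_cyl_inner:
  assumes "norm \<nu> = 1"
  shows "integrable lborel (\<lambda>v. indicator (cyl \<nu>) v * ((perp \<nu> v \<bullet> a) * (perp \<nu> v \<bullet> b)))"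
proof (rule integrable_cyl[OF assms, where B = "norm a * norm b"])
  fix v assume "v \<in> cyl \<nu>"
  then show "\<bar>(perp \<nu> v \<bullet> a) * (perp \<nu> v \<bullet> b)\<bar> \<le> norm a * norm b"
    unfolding abs_mult by (intro mult_mono perp_inner_le_cyl) auto
qed measurable

lemma norm_perp_sq: "norm \<nu> = 1 \<Longrightarrow> (norm (perp \<nu> v))\<^sup>2 = (norm v)\<^sup>2 - (v \<bullet> \<nu>)\<^sup>2"
  using norm_perp_add[of \<nu> v "v \<bullet> \<nu>"] by (simp add: perp_add_inner)

text \<open>As \<open>a\<close> and \<open>b\<close> have the same length, the reflection along
  \<open>a - b\<close> exchanges them; as both are orthogonal to \<nu>, it keeps the component along
  \<nu> and hence the cylinder.\<close>

lemma cyl_second_moment_eq: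
  fixes \<nu> :: "'a::euclidean_space"
  assumes \<nu>: "norm \<nu> = 1" and a: "a \<bullet> \<nu> = 0" and b: "b \<bullet> \<nu> = 0" and ab: "norm a = norm b"
  shows "(LINT v|lborel. indicator (cyl \<nu>) v * (perp \<nu> v \<bullet> a)\<^sup>2) =
    (LINT v|lborel. indicator (cyl \<nu>) v * (perp \<nu> v \<bullet> b)\<^sup>2)"
proof (cases "a = b")
  case False
  define e where "e = (1 / norm (a - b)) *\<^sub>R (a - b)"
  define R where "R v = v - (2 * (v \<bullet> e)) *\<^sub>R e" for v
  have nab: "norm (a - b) > 0" using False by simp
  have e: "norm e = 1" using False by (simp add: e_def)
  have [measurable]: "R \<in> borel_measurable borel" unfolding R_def by measurable
  have e\<nu>: "e \<bullet> \<nu> = 0" by (simp add: e_def inner_diff_left a b)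
  have R\<nu>: "R v \<bullet> \<nu> = v \<bullet> \<nu>" for v by (simp add: R_def inner_diff_left e\<nu>)
  have perp_a: "perp \<nu> v \<bullet> a = v \<bullet> a" for v
    by (simp add: perp_def inner_diff_left a inner_commute[of \<nu> a])
  have perp_b: "perp \<nu> v \<bullet> b = v \<bullet> b" for v
    by (simp add: perp_def inner_diff_left b inner_commute[of \<nu> b])
  have "(norm (R v))\<^sup>2 = (norm v)\<^sup>2" for v
    using e unfolding power2_norm_eq_inner R_def norm_eq_1
    by (simp add: inner_diff_left inner_diff_right algebra_simps inner_commute)
  then have "(norm (perp \<nu> (R v)))\<^sup>2 = (norm (perp \<nu> v))\<^sup>2" for v
    by (simp add: norm_perp_sq[OF \<nu>] R\<nu>)
  then have "norm (perp \<nu> (R v)) = norm (perp \<nu> v)" for v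
    by simp
  then have cyl: "indicator (cyl \<nu>) (R v) = (indicator (cyl \<nu>) v :: real)" for v
    by (simp add: cyl_def indicator_def R\<nu>)
  have "(norm (a - b))\<^sup>2 = 2 * ((a - b) \<bullet> a)"
    using ab unfolding norm_eq power2_norm_eq_inner
    by (simp add: inner_diff_left inner_diff_right algebra_simps inner_commute)
  then have "2 * (e \<bullet> a) = norm (a - b)"
    using nab unfolding e_def inner_scaleR_left by (simp add: field_simps power2_eq_square)
  then have "R v \<bullet> a = v \<bullet> a - (v \<bullet> e) * norm (a - b)" for v
    by (simp add: R_def inner_diff_left algebra_simps)
  then have Ra: "R v \<bullet> a = v \<bullet> b" for v
    using nab by (simp add: e_def inner_diff_right)
  have "(LINT v|lborel. indicator (cyl \<nu>) v * (perp \<nu> v \<bullet> a)\<^sup>2) =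
      (LINT v|distr lborel borel R. indicator (cyl \<nu>) v * (perp \<nu> v \<bullet> a)\<^sup>2)"
    unfolding R_def[abs_def] by (simp add: distr_lborel_reflection[OF e])
  also have "\<dots> = (LINT v|lborel. indicator (cyl \<nu>) (R v) * (perp \<nu> (R v) \<bullet> a)\<^sup>2)"
    by (subst integral_distr) auto
  also have "\<dots> = (LINT v|lborel. indicator (cyl \<nu>) v * (perp \<nu> v \<bullet> b)\<^sup>2)"
    unfolding perp_a perp_b Ra cyl ..
  finally show ?thesis .
qed simp

text \<open>For |w| \<le> 1 the number 1 - |w|^2 is the length of the set of \<open>u\<close> with
  |w|^2 \<le> u \<le> 1. Swapping the integrals, the moment of 1 - |w|^2 becomes the integral over
  [0, 1] of the measures of discs of radius \<open>sqrt u\<close>, that is \<omega> times the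
  integral of u^(n/2), with n = d - 1.\<close>

lemma cyl_moment_norm:
  fixes \<nu> :: "'a::euclidean_space"
  assumes \<nu>: "norm \<nu> = 1"
  shows "(LINT v|lborel. indicator (cyl \<nu>) v * (norm (perp \<nu> v))\<^sup>2) =
     unit_ball_vol (real (DIM('a) - 1)) * (real DIM('a) - 1) / (real DIM('a) + 1)"
proof -
  define n where "n = DIM('a) - 1"
  have n: "DIM('a) = Suc n" by (simp add: n_def)
  define \<omega> where "\<omega> = unit_ball_vol (real n)"
  have \<omega>: "\<omega> > 0" by (simp add: \<omega>_def)
  let ?S = "\<lambda>u. {v. norm (perp \<nu> v) \<le> sqrt u \<and> 0 \<le> v \<bullet> \<nu> \<and> v \<bullet> \<nu> \<le> 1}"
  have sq: "norm (perp \<nu> v) \<le> 1 \<Longrightarrow> (norm (perp \<nu> v))\<^sup>2 \<le> 1" for v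
    by (simp add: power_le_one)
  have "(\<integral>\<^sup>+ v. ennreal (indicator (cyl \<nu>) v * (1 - (norm (perp \<nu> v))\<^sup>2)) \<partial>lborel) =
    (\<integral>\<^sup>+ v. \<integral>\<^sup>+ u. indicator {u. 0 \<le> u \<and> u \<le> 1} u * indicator {v. norm (perp \<nu> v) \<le> sqrt u \<and> 0 \<le> v \<bullet> \<nu> \<and> v \<bullet> \<nu> \<le> 1} v \<partial>lborel \<partial>lborel)"
  proof (rule nn_integral_cong)
    fix v
    have "(\<integral>\<^sup>+ u. indicator {u. 0 \<le> u \<and> u \<le> 1} u * indicator (?S u) v \<partial>lborel) =
       (\<integral>\<^sup>+ u. indicator (cyl \<nu>) v * indicator {(norm (perp \<nu> v))\<^sup>2..1} u \<partial>lborel)"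
    proof (rule nn_integral_cong)
      fix u :: real
      have "0 \<le> u \<and> norm (perp \<nu> v) \<le> sqrt u \<longleftrightarrow> (norm (perp \<nu> v))\<^sup>2 \<le> u"
        by (metis norm_ge_zero real_le_rsqrt real_sqrt_le_iff' real_sqrt_pow2_iff power_mono
             order_trans zero_le_power2)
      moreover have "u \<le> 1 \<Longrightarrow> (norm (perp \<nu> v))\<^sup>2 \<le> u \<Longrightarrow> norm (perp \<nu> v) \<le> 1"
        using power_mono_iff[of "norm (perp \<nu> v)" 1 2] by simp
      ultimately show "indicator {u. 0 \<le> u \<and> u \<le> 1} u * indicator (?S u) v =
         (indicator (cyl \<nu>) v * indicator {(norm (perp \<nu> v))\<^sup>2..1} u :: ennreal)"
        by (auto simp: indicator_def cyl_def)
    qed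
    also have "\<dots> = indicator (cyl \<nu>) v * emeasure lborel {(norm (perp \<nu> v))\<^sup>2..1}"
      by (rule nn_integral_cmult_indicator) simp
    also have "\<dots> = ennreal (indicator (cyl \<nu>) v * (1 - (norm (perp \<nu> v))\<^sup>2))"
      using sq[of v] by (auto simp: indicator_def cyl_def)
    finally show "ennreal (indicator (cyl \<nu>) v * (1 - (norm (perp \<nu> v))\<^sup>2)) =
      (\<integral>\<^sup>+ u. indicator {u. 0 \<le> u \<and> u \<le> 1} u * indicator (?S u) v \<partial>lborel)" ..
  qed
  also have "\<dots> = (\<integral>\<^sup>+ u. \<integral>\<^sup>+ v. indicator {u. 0 \<le> u \<and> u \<le> 1} u * indicator {v. norm (perp \<nu> v) \<le> sqrt u \<and> 0 \<le> v \<bullet> \<nu> \<and> v \<bullet> \<nu> \<le> 1} v \<partial>lborel \<partial>lborel)"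
    by (rule lborel_pair.Fubini') measurable
  also have "\<dots> = (\<integral>\<^sup>+ u. ennreal (\<omega> * u powr (real n / 2)) * indicator {0..1} u \<partial>lborel)"
  proof (rule nn_integral_cong_AE)
    have "AE y in lborel. y \<notin> {0::real}"
      by (intro AE_not_in countable_imp_null_set_lborel) auto
    then show "AE u in lborel. (\<integral>\<^sup>+ v. indicator {u. 0 \<le> u \<and> u \<le> 1} u * indicator (?S u) v \<partial>lborel)
       = ennreal (\<omega> * u powr (real n / 2)) * indicator {0..1} u"
    proof eventually_elim
      case (elim u)
      show ?case
      proof (cases "0 < u \<and> u \<le> 1")
        case True
        have "(\<integral>\<^sup>+ v. indicator {u. 0 \<le> u \<and> u \<le> 1} u * indicator (?S u) v \<partial>lborel) = emeasure lborel (?S u)"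
          using True by (subst nn_integral_cmult_indicator) auto
        also have "\<dots> = ennreal (sqrt u ^ n) * emeasure lborel (cyl \<nu>)"
          unfolding n_def by (rule emeasure_cyl_radius[OF \<nu>]) (use True in simp)
        also have "\<dots> = ennreal (sqrt u ^ n * \<omega>)"
          using \<omega> True by (simp add: emeasure_cyl[OF \<nu>] \<omega>_def n_def ennreal_mult)
        also have "sqrt u ^ n = u powr (real n / 2)"
          using True by (simp add: powr_half_sqrt[symmetric] powr_power)
        finally show ?thesis using True by (simp add: mult.commute)
      qed (use elim in auto)
    qed
  qed
  also have "\<dots> = ennreal (\<omega> * 2 / (real n + 2))"
  proof -
    have "((\<lambda>u::real. u powr (real n / 2)) has_integral (1 powr (real n/2 + 1) / (real n/2 + 1))) {0..1}"
      by (rule has_integral_powr_from_0) auto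
    from has_integral_mult_right[OF this, of \<omega>]
    have "((\<lambda>u::real. \<omega> * u powr (real n / 2)) has_integral (\<omega> * 2 / (real n + 2))) {0..1}"
      by (simp add: field_simps)
    from nn_integral_has_integral_lebesgue[OF _ this] \<omega> show ?thesis
      by (simp add: mult.commute ennreal_mult' ennreal_indicator)
  qed
  finally have eq: "(\<integral>\<^sup>+ v. ennreal (indicator (cyl \<nu>) v * (1 - (norm (perp \<nu> v))\<^sup>2)) \<partial>lborel) = ennreal (\<omega> * 2 / (real n + 2))" .
  have int1: "(LINT v|lborel. indicator (cyl \<nu>) v * (1 - (norm (perp \<nu> v))\<^sup>2)) = \<omega> * 2 / (real n + 2)"
  proof (rule integral_eq_nn_integral[THEN trans])
    show "AE v in lborel. 0 \<le> indicator (cyl \<nu>) v * (1 - (norm (perp \<nu> v))\<^sup>2)"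
      using sq by (auto simp: indicator_def cyl_def)
    show "enn2real (\<integral>\<^sup>+ v. ennreal (indicator (cyl \<nu>) v * (1 - (norm (perp \<nu> v))\<^sup>2)) \<partial>lborel) = \<omega> * 2 / (real n + 2)"
      using \<omega> by (simp add: eq)
  qed measurable
  have i1: "integrable lborel (\<lambda>v. indicator (cyl \<nu>) v * (1::real))"
    by (rule integrable_cyl[OF \<nu>, where B=1]) auto
  have i2: "integrable lborel (\<lambda>v. indicator (cyl \<nu>) v * (norm (perp \<nu> v))\<^sup>2)"
    by (rule integrable_cyl[OF \<nu>, where B=1]) (measurable, use sq in \<open>auto simp: cyl_def\<close>)
  have "(LINT v|lborel. indicator (cyl \<nu>) v * (1 - (norm (perp \<nu> v))\<^sup>2)) = 
      (LINT v|lborel. indicator (cyl \<nu>) v * 1) - (LINT v|lborel. indicator (cyl \<nu>) v * (norm (perp \<nu> v))\<^sup>2)"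
    using Bochner_Integration.integral_diff[OF i1 i2] by (simp add: algebra_simps)
  also have "(LINT v|lborel. indicator (cyl \<nu>) v * (1::real)) = \<omega>"
    using \<nu> by (simp add: measure_cyl \<omega>_def n_def)
  finally have "(LINT v|lborel. indicator (cyl \<nu>) v * (norm (perp \<nu> v))\<^sup>2) = \<omega> - \<omega> * 2 / (real n + 2)"
    using int1 by linarith
  then show ?thesis unfolding n by (simp add: \<omega>_def field_simps)
qed

text \<open>By reflection symmetry the moment form is a multiple \<kappa> of the squared norm on the
  hyperplane, and polarization extends this to pairs. Summing over a basis compares \<kappa> (d - 1)
  with the total moment; d \<ge> 2 provides a unit vector orthogonal to \<nu> and allows the
  division by d - 1.\<close>

lemma cyl_second_moment:
  fixes \<nu> :: "'a::euclidean_space"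
  assumes \<nu>: "norm \<nu> = 1" and d: "DIM('a) \<ge> 2"
  shows "(LINT v|lborel. indicator (cyl \<nu>) v * ((perp \<nu> v \<bullet> a) * (perp \<nu> v \<bullet> b))) =
     unit_ball_vol (real (DIM('a) - 1)) / (real DIM('a) + 1) * (a \<bullet> b - (a \<bullet> \<nu>) * (b \<bullet> \<nu>))"
proof -
  define q where "q a = (LINT v|lborel. indicator (cyl \<nu>) v * (perp \<nu> v \<bullet> a)\<^sup>2)" for a
  obtain a0' where "a0' \<noteq> 0" "orthogonal \<nu> a0'"
    using orthogonal_to_vector_exists[OF d, of \<nu>] by blast
  then obtain a0 where a0: "norm a0 = 1" "a0 \<bullet> \<nu> = 0"
    by (intro that[of "(1 / norm a0') *\<^sub>R a0'"]) (auto simp: orthogonal_def inner_commute)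
  define \<kappa> where "\<kappa> = q a0"
  have q: "q a = \<kappa> * (a \<bullet> a)" if "a \<bullet> \<nu> = 0" for a
  proof -
    have "q a = q (norm a *\<^sub>R a0)"
      unfolding q_def by (rule cyl_second_moment_eq[OF \<nu>]) (use that a0 in auto)
    also have "\<dots> = (LINT v|lborel. (norm a)\<^sup>2 * (indicator (cyl \<nu>) v * (perp \<nu> v \<bullet> a0)\<^sup>2))"
      unfolding q_def by (simp add: power_mult_distrib mult_ac)
    also have "\<dots> = (norm a)\<^sup>2 * \<kappa>"
      unfolding \<kappa>_def q_def by simp
    finally show ?thesis by (simp add: power2_norm_eq_inner mult.commute)
  qed
  have perp_adj: "perp \<nu> v \<bullet> a = perp \<nu> v \<bullet> perp \<nu> a" for v a
    using \<nu> by (simp add: perp_def[of \<nu> a] inner_diff_right)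
  have perp2: "perp \<nu> a \<bullet> perp \<nu> b = a \<bullet> b - (a \<bullet> \<nu>) * (b \<bullet> \<nu>)" for a b
    using \<nu> by (simp add: perp_def inner_diff_right inner_diff_left norm_eq_1 inner_commute)
  have int: "integrable lborel (\<lambda>v. indicator (cyl \<nu>) v * (perp \<nu> v \<bullet> a)\<^sup>2)" for a
    using integrable_cyl_inner[OF \<nu>, of a a] by (simp add: power2_eq_square)
  have pol: "(LINT v|lborel. indicator (cyl \<nu>) v * ((perp \<nu> v \<bullet> a) * (perp \<nu> v \<bullet> b))) =
    \<kappa> * (a \<bullet> b - (a \<bullet> \<nu>) * (b \<bullet> \<nu>))" for a b
  proof -
    \<comment> \<open>Polarization runs over the projections, because \<open>q\<close> is known only
      on vectors orthogonal to \<nu>; the integrand does not see the difference.\<close>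
    let ?a = "perp \<nu> a" and ?b = "perp \<nu> b"
    have pw: "indicator (cyl \<nu>) v * ((perp \<nu> v \<bullet> a) * (perp \<nu> v \<bullet> b)) =
       (1/4) * (indicator (cyl \<nu>) v * (perp \<nu> v \<bullet> (?a + ?b))\<^sup>2 - indicator (cyl \<nu>) v * (perp \<nu> v \<bullet> (?a - ?b))\<^sup>2)" for v
      unfolding perp_adj[of v a] perp_adj[of v b]
      by (simp add: inner_add_right inner_diff_right power2_eq_square algebra_simps)
    have "(LINT v|lborel. indicator (cyl \<nu>) v * ((perp \<nu> v \<bullet> a) * (perp \<nu> v \<bullet> b))) = 1/4 * (q (?a + ?b) - q (?a - ?b))"
      by (simp only: pw integral_mult_right_zero Bochner_Integration.integral_diff[OF int int] q_def)
    also have "\<dots> = \<kappa> * (?a \<bullet> ?b)"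
    proof -
      have "q (?a + ?b) = \<kappa> * ((?a + ?b) \<bullet> (?a + ?b))" "q (?a - ?b) = \<kappa> * ((?a - ?b) \<bullet> (?a - ?b))"
        using \<nu> by (intro q; simp add: inner_add_left inner_diff_left)+
      then show ?thesis
        using inner_commute[of ?b ?a]
        by (simp add: inner_add_left inner_diff_left inner_add_right inner_diff_right algebra_simps)
    qed
    finally show ?thesis by (simp add: perp2)
  qed
  have "(\<Sum>i\<in>Basis. (perp \<nu> v \<bullet> i) * (perp \<nu> v \<bullet> i)) = (norm (perp \<nu> v))\<^sup>2" for v
    using euclidean_inner[of "perp \<nu> v" "perp \<nu> v"] by (simp add: power2_norm_eq_inner)
  then have "(LINT v|lborel. indicator (cyl \<nu>) v * (norm (perp \<nu> v))\<^sup>2) =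
    (LINT v|lborel. (\<Sum>i\<in>Basis. indicator (cyl \<nu>) v * ((perp \<nu> v \<bullet> i) * (perp \<nu> v \<bullet> i))))"
    by (simp add: sum_distrib_left[symmetric])
  also have "\<dots> = (\<Sum>i\<in>Basis. \<kappa> * (i \<bullet> i - (i \<bullet> \<nu>) * (i \<bullet> \<nu>)))"
    using integrable_cyl_inner[OF \<nu>] by (subst Bochner_Integration.integral_sum) (auto simp: pol)
  also have "\<dots> = \<kappa> * ((\<Sum>i\<in>Basis. i \<bullet> (i::'a)) - (\<Sum>i\<in>Basis. (\<nu> \<bullet> i) * (\<nu> \<bullet> i)))"
    by (simp add: sum_distrib_left[symmetric] sum_subtractf inner_commute)
  also have "(\<Sum>i\<in>Basis. (\<nu> \<bullet> i) * (\<nu> \<bullet> i)) = 1"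
    using \<nu> euclidean_inner[of \<nu> \<nu>] by (simp add: norm_eq_1)
  also have "(\<Sum>i\<in>Basis. i \<bullet> (i::'a)) = real DIM('a)"
    by simp
  finally have "\<kappa> * (real DIM('a) - 1) = unit_ball_vol (real (DIM('a) - 1)) / (real DIM('a) + 1) * (real DIM('a) - 1)"
    unfolding cyl_moment_norm[OF \<nu>] by simp
  then have "\<kappa> = unit_ball_vol (real (DIM('a) - 1)) / (real DIM('a) + 1)"
    using d by (subst (asm) mult_cancel_right) auto
  then show ?thesis unfolding pol by simp
qed

lemma bilinear_expand:
  fixes A :: "'a::euclidean_space \<Rightarrow>\<^sub>L 'a \<Rightarrow>\<^sub>L real"
  shows "A v w = (\<Sum>i\<in>Basis. \<Sum>j\<in>Basis. A i j * ((v \<bullet> i) * (w \<bullet> j)))"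
proof -
  have "A v w = A (\<Sum>i\<in>Basis. (v \<bullet> i) *\<^sub>R i) (\<Sum>j\<in>Basis. (w \<bullet> j) *\<^sub>R j)"
    by (simp add: euclidean_representation)
  also have "\<dots> = (\<Sum>i\<in>Basis. \<Sum>j\<in>Basis. A i j * ((v \<bullet> i) * (w \<bullet> j)))"
    by (simp add: blinfun.sum_right blinfun.sum_left blinfun.scaleR_right blinfun.scaleR_left sum_distrib_left mult_ac) (rule sum.swap)
  finally show ?thesis .
qed

text \<open>The bracket is the trace of \<open>A\<close> on the hyperplane orthogonal to \<nu>,
  written as full trace minus normal entry so that no basis adapted to \<nu> is needed.\<close>

lemma cyl_integral_bilinear:
  fixes \<nu> :: "'a::euclidean_space" and A :: "'a \<Rightarrow>\<^sub>L 'a \<Rightarrow>\<^sub>L real"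
  assumes \<nu>: "norm \<nu> = 1" and d: "DIM('a) \<ge> 2"
  shows "(LINT v|lborel. indicator (cyl \<nu>) v * A (perp \<nu> v) (perp \<nu> v)) =
     unit_ball_vol (real (DIM('a) - 1)) / (real DIM('a) + 1) * ((\<Sum>i\<in>Basis. A i i) - A \<nu> \<nu>)"
proof -
  let ?\<kappa> = "unit_ball_vol (real (DIM('a) - 1)) / (real DIM('a) + 1)"
  have "(LINT v|lborel. indicator (cyl \<nu>) v * A (perp \<nu> v) (perp \<nu> v)) =
    (LINT v|lborel. (\<Sum>i\<in>Basis. \<Sum>j\<in>Basis. A i j * (indicator (cyl \<nu>) v * ((perp \<nu> v \<bullet> i) * (perp \<nu> v \<bullet> j)))))"
    by (subst bilinear_expand) (simp add: sum_distrib_left mult_ac)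
  also have "\<dots> = (\<Sum>i\<in>Basis. \<Sum>j\<in>Basis. A i j * (?\<kappa> * (i \<bullet> j - (i \<bullet> \<nu>) * (j \<bullet> \<nu>))))"
    using integrable_cyl_inner[OF \<nu>]
    by (simp add: Bochner_Integration.integral_sum Bochner_Integration.integrable_sum cyl_second_moment[OF \<nu> d])
  also have "\<dots> = ?\<kappa> * ((\<Sum>i\<in>Basis. \<Sum>j\<in>Basis. A i j * (i \<bullet> j)) - (\<Sum>i\<in>Basis. \<Sum>j\<in>Basis. A i j * ((\<nu> \<bullet> i) * (\<nu> \<bullet> j))))"
    unfolding sum_subtractf[symmetric] sum_distrib_left
    by (intro sum.cong refl) (simp add: algebra_simps inner_commute diff_divide_distrib)
  also have "(\<Sum>i\<in>Basis. \<Sum>j\<in>Basis. A i j * (i \<bullet> j)) = (\<Sum>i\<in>Basis. A i i)"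
    by (intro sum.cong refl) (simp add: inner_Basis if_distrib sum.delta cong: if_cong)
  also have "(\<Sum>i\<in>Basis. \<Sum>j\<in>Basis. A i j * ((\<nu> \<bullet> i) * (\<nu> \<bullet> j))) = A \<nu> \<nu>"
    by (rule bilinear_expand[symmetric])
  finally show ?thesis .
qed

section \<open>Signed volume of a quadratic half-ball\<close>

text \<open>The line over \<open>w = perp \<nu> v\<close> meets the ball in [-l, l], and the points
  above height - g w take up the length l + g w as long as the graph stays inside the ball. The
  truncation of \<open>g\<close> to [-l, l] covers the lines on which it does not.\<close>

lemma emeasure_ball_above_graph:
  fixes \<nu> :: "'a::euclidean_space" and g :: "'a \<Rightarrow> real"
  assumes \<nu>: "norm \<nu> = 1" and [measurable]: "g \<in> borel_measurable borel"
  defines "l \<equiv> \<lambda>v. sqrt (1 - (norm (perp \<nu> v))\<^sup>2)"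
  shows "emeasure lborel {v. norm v \<le> 1 \<and> v \<bullet> \<nu> + g (perp \<nu> v) > 0} =
    (\<integral>\<^sup>+ v. ennreal (indicator (cyl \<nu>) v * (l v + max (- l v) (min (l v) (g (perp \<nu> v))))) \<partial>lborel)"
proof -
  define P where "P = {v. norm v \<le> 1 \<and> v \<bullet> \<nu> + g (perp \<nu> v) > 0}"
  have [measurable]: "P \<in> sets borel" unfolding P_def by measurable
  have "emeasure lborel P = (\<integral>\<^sup>+ v. indicator P v \<partial>lborel)"
    by simp
  also have "\<dots> = (\<integral>\<^sup>+ v. indicator {v. 0 \<le> v \<bullet> \<nu> \<and> v \<bullet> \<nu> \<le> 1} v * (\<integral>\<^sup>+ u. indicator P (perp \<nu> v + u *\<^sub>R \<nu>) \<partial>lborel) \<partial>lborel)"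
    by (rule nn_integral_line_fibration[OF _ \<nu>]) measurable
  also have "\<dots> = (\<integral>\<^sup>+ v. ennreal (indicator (cyl \<nu>) v * (l v + max (- l v) (min (l v) (g (perp \<nu> v))))) \<partial>lborel)"
  proof (rule nn_integral_cong)
    fix v
    let ?w = "perp \<nu> v"
    have mem: "?w + u *\<^sub>R \<nu> \<in> P \<longleftrightarrow> (norm ?w)\<^sup>2 + u\<^sup>2 \<le> 1 \<and> u + g ?w > 0" for u
      using norm_perp_add[OF \<nu>, of v u] power_mono_iff[of "norm (perp \<nu> v + u *\<^sub>R \<nu>)" 1 2] \<nu>
      by (simp add: P_def)
    have "(\<integral>\<^sup>+ u. indicator P (?w + u *\<^sub>R \<nu>) \<partial>lborel) =
       ennreal (indicator {v. norm (perp \<nu> v) \<le> 1} v * (l v + max (- l v) (min (l v) (g ?w))))"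
    proof (cases "norm ?w \<le> 1")
      case True
      then have l: "0 \<le> 1 - (norm ?w)\<^sup>2" by (simp add: power_le_one)
      have lv: "(norm ?w)\<^sup>2 + u\<^sup>2 \<le> 1 \<longleftrightarrow> \<bar>u\<bar> \<le> l v" for u
        using power_mono_iff[of "\<bar>u\<bar>" "l v" 2] l by (auto simp: l_def)
      have mem': "?w + u *\<^sub>R \<nu> \<in> P \<longleftrightarrow> u \<in> {- l v..l v} \<and> - g ?w < u" for u
        unfolding mem lv by auto
      have l0: "0 \<le> l v" using l by (simp add: l_def)
      consider "l v < g ?w" | "- l v \<le> g ?w" "g ?w \<le> l v" | "g ?w < - l v" by linarith
      then show ?thesis
      proof cases
        case 1
        have "(\<integral>\<^sup>+ u. indicator P (?w + u *\<^sub>R \<nu>) \<partial>lborel) = (\<integral>\<^sup>+ u. indicator {- l v..l v} u \<partial>lborel)"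
          using 1 by (intro nn_integral_cong) (auto simp: indicator_def mem')
        then show ?thesis using l0 1 True by simp
      next
        case 2
        have "(\<integral>\<^sup>+ u. indicator P (?w + u *\<^sub>R \<nu>) \<partial>lborel) = (\<integral>\<^sup>+ u. indicator {- g ?w<..l v} u \<partial>lborel)"
          using 2 by (intro nn_integral_cong) (auto simp: indicator_def mem')
        then show ?thesis using l0 2 True by simp
      next
        case 3
        have "(\<integral>\<^sup>+ u. indicator P (?w + u *\<^sub>R \<nu>) \<partial>lborel) = (\<integral>\<^sup>+ u. 0 \<partial>(lborel::real measure))"
          using 3 by (intro nn_integral_cong) (auto simp: indicator_def mem')
        then show ?thesis using l0 3 True by simp
      qed
    next
      case False
      then have "1 < (norm ?w)\<^sup>2" by (simp add: one_less_power)
      then have "\<not> (norm ?w)\<^sup>2 + u\<^sup>2 \<le> 1" for u :: real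
        using zero_le_power2[of u] by linarith
      then show ?thesis using False mem by (simp add: indicator_def)
    qed
    then show "indicator {v. 0 \<le> v \<bullet> \<nu> \<and> v \<bullet> \<nu> \<le> 1} v * (\<integral>\<^sup>+ u. indicator P (perp \<nu> v + u *\<^sub>R \<nu>) \<partial>lborel) =
      ennreal (indicator (cyl \<nu>) v * (l v + max (- l v) (min (l v) (g (perp \<nu> v)))))"
      by (auto simp: indicator_def cyl_def)
  qed
  finally show ?thesis unfolding P_def .
qed

text \<open>Subtracting half the ball cancels \<open>l\<close>, so the signed volume is exactly
  twice the integral of the truncated graph function. Truncation matters only where l < \<tau> C, in
  a thin ring at the rim of the disc, and changes the integrand there by at most \<tau> C. The bound
  is therefore \<tau> times a quantity that vanishes with \<tau>.\<close>

lemma ball_above_graph_volume: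
  fixes \<nu> :: "'a::euclidean_space" and g :: "'a \<Rightarrow> real"
  assumes \<nu>: "norm \<nu> = 1" and [measurable]: "g \<in> borel_measurable borel"
    and g: "\<And>w. norm w \<le> 1 \<Longrightarrow> \<bar>g w\<bar> \<le> C" and C: "C > 0" and \<tau>: "0 < \<tau>" "\<tau> * C < 1"
  shows "\<bar>(2 * measure lborel {v. norm v \<le> 1 \<and> v \<bullet> \<nu> + \<tau> * g (perp \<nu> v) > 0} - measure lborel (cball (0::'a) 1))
     - 2 * \<tau> * (LINT v|lborel. indicator (cyl \<nu>) v * g (perp \<nu> v))\<bar>
    \<le> 2 * \<tau> * C * (unit_ball_vol (real (DIM('a) - 1)) * (1 - sqrt (1 - (\<tau> * C)\<^sup>2) ^ (DIM('a) - 1)))"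
proof -
  define l where "l v = sqrt (1 - (norm (perp \<nu> v))\<^sup>2)" for v
  define \<omega> where "\<omega> = unit_ball_vol (real (DIM('a) - 1))"
  define cl where "cl h v = max (- l v) (min (l v) (h v))" for h and v :: 'a
  have [measurable]: "l \<in> borel_measurable borel" unfolding l_def by measurable
  have lb: "0 \<le> l v" "l v \<le> 1" if "v \<in> cyl \<nu>" for v
    using that by (auto simp: l_def cyl_def power_le_one)
  have int_l: "integrable lborel (\<lambda>v. indicator (cyl \<nu>) v * l v)"
    by (rule integrable_cyl[OF \<nu>, where B=1]) (use lb in auto)
  have int_cl: "integrable lborel (\<lambda>v. indicator (cyl \<nu>) v * cl h v)" if [measurable]: "h \<in> borel_measurable borel" for h
  proof (rule integrable_cyl[OF \<nu>, where B=1])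
    show "\<bar>cl h v\<bar> \<le> 1" if "v \<in> cyl \<nu>" for v
      using lb[OF that] unfolding cl_def by linarith
  qed (unfold cl_def, measurable)
  have vol: "measure lborel {v. norm v \<le> 1 \<and> v \<bullet> \<nu> + h (perp \<nu> v) > 0} =
      (LINT v|lborel. indicator (cyl \<nu>) v * l v) + (LINT v|lborel. indicator (cyl \<nu>) v * cl (\<lambda>v. h (perp \<nu> v)) v)"
    if [measurable]: "h \<in> borel_measurable borel" for h
  proof -
    have "measure lborel {v. norm v \<le> 1 \<and> v \<bullet> \<nu> + h (perp \<nu> v) > 0} =
      enn2real (\<integral>\<^sup>+ v. ennreal (indicator (cyl \<nu>) v * (l v + cl (\<lambda>v. h (perp \<nu> v)) v)) \<partial>lborel)"
      unfolding measure_def emeasure_ball_above_graph[OF \<nu> that] l_def cl_def ..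
    also have "\<dots> = (LINT v|lborel. indicator (cyl \<nu>) v * (l v + cl (\<lambda>v. h (perp \<nu> v)) v))"
    proof (rule integral_eq_nn_integral[symmetric])
      show "AE v in lborel. 0 \<le> indicator (cyl \<nu>) v * (l v + cl (\<lambda>v. h (perp \<nu> v)) v)"
        using lb by (intro AE_I2) (auto simp: indicator_def cl_def)
    qed (simp add: cl_def)
    also have "\<dots> = (LINT v|lborel. indicator (cyl \<nu>) v * l v) + (LINT v|lborel. indicator (cyl \<nu>) v * cl (\<lambda>v. h (perp \<nu> v)) v)"
      unfolding distrib_left by (rule Bochner_Integration.integral_add[OF int_l int_cl]) measurable
    finally show ?thesis .
  qed
  \<comment> \<open>The full ball arises from the constant graph function 2, which is truncated to
    \<open>l\<close>; the volume formula then gives twice the integral of \<open>l\<close>.\<close>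
  have norm_le: "{v. norm v \<le> 1 \<and> v \<bullet> \<nu> + 2 > 0} = cball 0 1"
  proof (intro set_eqI)
    fix v show "v \<in> {v. norm v \<le> 1 \<and> v \<bullet> \<nu> + 2 > 0} \<longleftrightarrow> v \<in> cball 0 1"
      using Cauchy_Schwarz_ineq2[of v \<nu>] \<nu> by auto
  qed
  have "measure lborel (cball (0::'a) 1) = 
     (LINT v|lborel. indicator (cyl \<nu>) v * l v) + (LINT v|lborel. indicator (cyl \<nu>) v * cl (\<lambda>v. 2) v)"
    using vol[of "\<lambda>_. 2"] unfolding norm_le by simp
  also have "(LINT v|lborel. indicator (cyl \<nu>) v * cl (\<lambda>v. 2) v) = (LINT v|lborel. indicator (cyl \<nu>) v * l v)"
  proof (rule Bochner_Integration.integral_cong[OF refl])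
    fix v show "indicator (cyl \<nu>) v * cl (\<lambda>v. 2) v = indicator (cyl \<nu>) v * l v"
      using lb[of v] by (auto simp: indicator_def cl_def)
  qed
  finally have ball: "measure lborel (cball (0::'a) 1) = 2 * (LINT v|lborel. indicator (cyl \<nu>) v * l v)"
    by simp
  define h where "h v = \<tau> * g (perp \<nu> v)" for v
  have [measurable]: "h \<in> borel_measurable borel" unfolding h_def by measurable
  have hb: "\<bar>h v\<bar> \<le> \<tau> * C" if "v \<in> cyl \<nu>" for v
    using that g[of "perp \<nu> v"] \<tau> by (simp add: h_def cyl_def abs_mult)
  have int_h: "integrable lborel (\<lambda>v. indicator (cyl \<nu>) v * h v)"
    by (rule integrable_cyl[OF \<nu> _ hb]) auto
  have eq: "2 * measure lborel {v. norm v \<le> 1 \<and> v \<bullet> \<nu> + \<tau> * g (perp \<nu> v) > 0} - measure lborel (cball (0::'a) 1)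
     = 2 * (LINT v|lborel. indicator (cyl \<nu>) v * cl h v)"
    unfolding ball h_def using vol[of "\<lambda>w. \<tau> * g w"] by simp
  \<comment> \<open>The radius up to which the half-height \<open>l\<close> is at least \<tau> C, so
    that the truncation is inactive on the disc of radius \<open>t\<close>.\<close>
  define t where "t = sqrt (1 - (\<tau> * C)\<^sup>2)"
  have "(\<tau> * C)\<^sup>2 < 1"
    using \<tau> C by (simp add: abs_square_less_1)
  then have t: "0 < t" "t \<le> 1" and t2: "t\<^sup>2 = 1 - (\<tau> * C)\<^sup>2"
    by (auto simp: t_def)
  let ?S = "{v. norm (perp \<nu> v) \<le> t \<and> 0 \<le> v \<bullet> \<nu> \<and> v \<bullet> \<nu> \<le> 1}"
  have S: "measure lborel ?S = t ^ (DIM('a) - 1) * \<omega>"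
    using t by (simp add: measure_def emeasure_cyl_radius[OF \<nu> t(1)] emeasure_cyl[OF \<nu>] \<omega>_def enn2real_mult)
  have [measurable]: "?S \<in> sets borel" by measurable
  have Ssub: "?S \<subseteq> cyl \<nu>" using t by (auto simp: cyl_def)
  have fin: "emeasure lborel (cyl \<nu>) \<noteq> \<infinity>" by (simp add: emeasure_cyl[OF \<nu>])
  have meas: "measure lborel (cyl \<nu> - ?S) = \<omega> * (1 - t ^ (DIM('a) - 1))"
    using measure_Diff[OF fin _ _ Ssub] S \<nu> by (simp add: measure_cyl \<omega>_def algebra_simps)
  have int_S: "integrable lborel (\<lambda>v. (\<tau> * C) * indicator (cyl \<nu> - ?S) v)"
  proof -
    have "emeasure lborel (cyl \<nu> - ?S) < \<infinity>"
      by (rule le_less_trans[OF emeasure_mono[of _ "cyl \<nu>"]]) (auto simp: emeasure_cyl[OF \<nu>])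
    then show ?thesis by (intro integrable_mult_right integrable_real_indicator) auto
  qed
  have pt: "\<bar>indicator (cyl \<nu>) v * cl h v - indicator (cyl \<nu>) v * h v\<bar> \<le> (\<tau> * C) * indicator (cyl \<nu> - ?S) v" for v
  proof (cases "v \<in> cyl \<nu>")
    case v: True
    show ?thesis
    proof (cases "v \<in> ?S")
      case True
      then have "(norm (perp \<nu> v))\<^sup>2 \<le> t\<^sup>2" using t by (intro power_mono) auto
      then have "(\<tau> * C)\<^sup>2 \<le> 1 - (norm (perp \<nu> v))\<^sup>2" by (simp add: t2)
      then have "\<tau> * C \<le> l v" unfolding l_def by (rule real_le_rsqrt)
      then have "cl h v = h v" using hb[OF v] by (auto simp: cl_def)
      then show ?thesis using True by simp
    next
      case False
      have "\<bar>cl h v - h v\<bar> \<le> \<tau> * C" using hb[OF v] lb[OF v] by (auto simp: cl_def)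
      then show ?thesis using False v by simp
    qed
  qed simp
  have "\<bar>(LINT v|lborel. indicator (cyl \<nu>) v * cl h v) - (LINT v|lborel. indicator (cyl \<nu>) v * h v)\<bar> =
     \<bar>LINT v|lborel. indicator (cyl \<nu>) v * cl h v - indicator (cyl \<nu>) v * h v\<bar>"
    by (subst Bochner_Integration.integral_diff[OF int_cl int_h]) auto
  also have "\<dots> \<le> (LINT v|lborel. (\<tau> * C) * indicator (cyl \<nu> - ?S) v)"
  proof -
    have "norm (LINT v|lborel. indicator (cyl \<nu>) v * cl h v - indicator (cyl \<nu>) v * h v) \<le> (LINT v|lborel. (\<tau> * C) * indicator (cyl \<nu> - ?S) v)"
      by (rule Bochner_Integration.integral_norm_bound_integral) (use int_cl int_h int_S pt in auto)
    then show ?thesis by simp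
  qed
  also have "\<dots> = \<tau> * C * (\<omega> * (1 - t ^ (DIM('a) - 1)))"
    by (simp add: meas)
  finally have "\<bar>(LINT v|lborel. indicator (cyl \<nu>) v * cl h v) - (LINT v|lborel. indicator (cyl \<nu>) v * h v)\<bar> \<le> \<tau> * C * (\<omega> * (1 - t ^ (DIM('a) - 1)))" .
  moreover have "(LINT v|lborel. indicator (cyl \<nu>) v * h v) = \<tau> * (LINT v|lborel. indicator (cyl \<nu>) v * g (perp \<nu> v))"
    unfolding h_def by (subst integral_mult_right_zero[symmetric]) (simp add: mult_ac)
  ultimately show ?thesis unfolding eq \<omega>_def[symmetric] t_def[symmetric] by (simp add: algebra_simps)
qed

section \<open>Perturbed quadratic half-balls, uniformly in the normal\<close>

lemma bilinear_bound:
  fixes A :: "'a::euclidean_space \<Rightarrow>\<^sub>L 'a \<Rightarrow>\<^sub>L real"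
  assumes "norm A \<le> C"
  shows "\<bar>A v w\<bar> \<le> C * norm v * norm w"
proof -
  have "\<bar>A v w\<bar> \<le> norm (A v) * norm w" using norm_blinfun[of "A v" w] by simp
  also have "\<dots> \<le> norm A * norm v * norm w" by (intro mult_right_mono norm_blinfun) auto
  also have "\<dots> \<le> C * norm v * norm w" using assms by (intro mult_right_mono) auto
  finally show ?thesis .
qed

text \<open>Here \<open>q\<close> depends on all of \<open>v\<close> and is no graph function over
  the hyperplane, so the set is caught between the two graphs of
  \<open>Q (perp \<nu> v) + \<theta>\<close> with \<theta> = \<eta>' and \<theta> = -\<eta>'. In the
  slab |v \<bullet> \<nu>| \<le> C' \<tau>, replacing \<open>v\<close> by its projection costs at
  most 2 C C' \<tau>; outside the slab neither perturbation can change the sign of v \<bullet>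
  \<nu>, so membership agrees. The thresholds precede the choice of \<nu>, \<open>A\<close> and
  \<open>q\<close>, since the normal will vary with the set.\<close>

lemma signed_volume_quadratic:
  fixes C \<epsilon> :: real
  assumes d: "DIM('a::euclidean_space) \<ge> 2" and C: "C > 0" and \<epsilon>: "\<epsilon> > 0"
  obtains \<tau>0 \<eta> where "\<tau>0 > 0" "\<eta> > 0"
    "\<And>(\<nu>::'a) A q \<tau> F. norm \<nu> = 1 \<Longrightarrow> norm A \<le> C \<Longrightarrow> 0 < \<tau> \<Longrightarrow> \<tau> < \<tau>0 \<Longrightarrow> F \<in> sets borel \<Longrightarrow>
      (\<And>v. norm v \<le> 1 \<Longrightarrow> \<bar>q v - blinfun_apply (blinfun_apply A v) v / 2\<bar> \<le> \<eta>) \<Longrightarrow>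
      (\<And>v. norm v \<le> 1 \<Longrightarrow> v \<in> F \<longleftrightarrow> v \<bullet> \<nu> + \<tau> * q v \<le> 0) \<Longrightarrow>
      \<bar>(measure lborel (cball 0 1 - F) - measure lborel (cball 0 1 \<inter> F)) -
        \<tau> * (unit_ball_vol (real (DIM('a) - 1)) / (real DIM('a) + 1) * ((\<Sum>i\<in>Basis. A i i) - A \<nu> \<nu>))\<bar> \<le> \<epsilon> * \<tau>"
proof -
  define n where "n = DIM('a) - 1"
  define \<omega> where "\<omega> = unit_ball_vol (real n)"
  have \<omega>: "\<omega> > 0" by (simp add: \<omega>_def)
  \<comment> \<open>A common bound for \<open>q\<close> and for \<open>Q\<close> shifted by at most
    1/2 on the unit ball: \<open>Q\<close> is bounded by C/2 there, and \<eta> is at most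
    1/4.\<close>
  define C' where "C' = C + 1"
  have C': "C' > 1" using C by (simp add: C'_def)
  \<comment> \<open>The shift \<eta>' will be at most 2 \<eta>, and it moves the signed volume by 2
    \<tau> \<eta>' \<omega>; the bound by \<epsilon> / (8 \<omega>) makes this at most \<tau>
    \<epsilon> / 2. The other half of the tolerance goes to the rim of the disc.\<close>
  define \<eta> where "\<eta> = min (1/4) (\<epsilon> / (8 * \<omega>))"
  have \<eta>: "\<eta> > 0" "\<eta> \<le> 1/4" "\<eta> * \<omega> \<le> \<epsilon> / 8"
  proof -
    have "\<eta> \<le> \<epsilon> / (8 * \<omega>)" by (simp add: \<eta>_def)
    then show "\<eta> * \<omega> \<le> \<epsilon> / 8" using \<omega> by (simp add: field_simps)
  qed (use \<epsilon> \<omega> in \<open>auto simp: \<eta>_def\<close>)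
  have "((\<lambda>t. 2 * C' * (\<omega> * (1 - sqrt (1 - (t * C')\<^sup>2) ^ n))) \<longlongrightarrow> 2 * C' * (\<omega> * (1 - sqrt (1 - (0 * C')\<^sup>2) ^ n))) (at_right 0)"
    by (intro tendsto_intros)
  then have "((\<lambda>t. 2 * C' * (\<omega> * (1 - sqrt (1 - (t * C')\<^sup>2) ^ n))) \<longlongrightarrow> 0) (at_right 0)"
    by simp
  then have "\<forall>\<^sub>F t in at_right 0. 2 * C' * (\<omega> * (1 - sqrt (1 - (t * C')\<^sup>2) ^ n)) < \<epsilon> / 2"
    using \<epsilon> by (intro order_tendstoD) auto
  then obtain \<tau>1 where \<tau>1: "\<tau>1 > 0" "\<And>t. 0 < t \<Longrightarrow> t < \<tau>1 \<Longrightarrow> 2 * C' * (\<omega> * (1 - sqrt (1 - (t * C')\<^sup>2) ^ n)) < \<epsilon> / 2"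
    unfolding eventually_at_right_field by auto
  \<comment> \<open>In this order: the rim error falls below \<epsilon> / 2, the product \<tau> C'
    stays below 1, and the cost 2 C C' \<tau> of projecting stays below \<eta>.\<close>
  define \<tau>0 where "\<tau>0 = min \<tau>1 (min (1/C') (\<eta> / (2 * C * C')))"
  show thesis
  proof (rule that[of \<tau>0 \<eta>])
    show "\<tau>0 > 0" using \<tau>1 C C' \<eta> by (simp add: \<tau>0_def)
    show "\<eta> > 0" by fact
    fix \<nu> :: 'a and A :: "'a \<Rightarrow>\<^sub>L 'a \<Rightarrow>\<^sub>L real" and q :: "'a \<Rightarrow> real" and \<tau> :: real and F :: "'a set"
    assume \<nu>: "norm \<nu> = 1" and A: "norm A \<le> C" and \<tau>: "0 < \<tau>" "\<tau> < \<tau>0" and [measurable]: "F \<in> sets borel"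
      and q: "\<And>v. norm v \<le> 1 \<Longrightarrow> \<bar>q v - A v v / 2\<bar> \<le> \<eta>"
      and F: "\<And>v. norm v \<le> 1 \<Longrightarrow> v \<in> F \<longleftrightarrow> v \<bullet> \<nu> + \<tau> * q v \<le> 0"
    \<comment> \<open>The deviation of \<open>q v\<close> from \<open>Q (perp \<nu> v)\<close> in
      the slab: \<eta> from the hypothesis on \<open>q\<close>, the rest from moving
      \<open>v\<close> to its projection.\<close>
    define \<eta>' where "\<eta>' = \<eta> + 2 * C * (C' * \<tau>)"
    have "\<tau> < \<eta> / (2 * C * C')" using \<tau> by (simp add: \<tau>0_def)
    then have "2 * C * (C' * \<tau>) \<le> \<eta>" using C C' by (simp add: field_simps)
    then have \<eta>': "0 < \<eta>'" "\<eta>' \<le> 1/2" "\<eta>' * \<omega> \<le> \<epsilon> / 4"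
    proof -
      assume *: "2 * C * (C' * \<tau>) \<le> \<eta>"
      show "\<eta>' \<le> 1/2" using * \<eta> by (simp add: \<eta>'_def)
      show "0 < \<eta>'" using \<eta> C C' \<tau> by (simp add: \<eta>'_def add_pos_nonneg)
      have "\<eta>' * \<omega> \<le> 2 * \<eta> * \<omega>" using * \<omega> by (intro mult_right_mono) (auto simp: \<eta>'_def)
      then show "\<eta>' * \<omega> \<le> \<epsilon> / 4" using \<eta> by simp
    qed
    have \<tau>C: "\<tau> * C' < 1" using \<tau> C' by (simp add: \<tau>0_def field_simps)
    define Q where "Q v = A v v / 2" for v
    have Qb: "\<bar>Q v\<bar> \<le> C / 2" if "norm v \<le> 1" for v
    proof -
      have "C * norm v * norm v \<le> C * 1 * 1" using that C by (intro mult_mono) auto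
      then show ?thesis using bilinear_bound[OF A, of v v] by (simp add: Q_def)
    qed
    have [measurable]: "Q \<in> borel_measurable borel"
      unfolding Q_def by (intro borel_measurable_continuous_onI continuous_intros) simp
    have Qdiff: "\<bar>Q v - Q (perp \<nu> v)\<bar> \<le> 2 * C * \<bar>v \<bullet> \<nu>\<bar>" if v: "norm v \<le> 1" for v
    proof -
      let ?w = "perp \<nu> v" and ?t = "v \<bullet> \<nu>"
      have w: "norm ?w \<le> 1" using norm_perp_le[OF \<nu>, of v] v by simp
      have t: "\<bar>?t\<bar> \<le> 1" using Cauchy_Schwarz_ineq2[of v \<nu>] \<nu> v by simp
      have "A v v = A (?w + ?t *\<^sub>R \<nu>) (?w + ?t *\<^sub>R \<nu>)" by (simp add: perp_add_inner)
      also have "\<dots> = A ?w ?w + ?t * (A ?w \<nu> + A \<nu> ?w + ?t * A \<nu> \<nu>)"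
        by (simp add: blinfun.add_left blinfun.add_right blinfun.scaleR_left blinfun.scaleR_right algebra_simps)
      finally have eq: "A v v - A ?w ?w = ?t * (A ?w \<nu> + A \<nu> ?w + ?t * A \<nu> \<nu>)" by simp
      have wC: "C * norm ?w \<le> C" using w C by simp
      have b1: "\<bar>A ?w \<nu>\<bar> \<le> C" "\<bar>A \<nu> ?w\<bar> \<le> C" "\<bar>A \<nu> \<nu>\<bar> \<le> C"
        using bilinear_bound[OF A, of ?w \<nu>] bilinear_bound[OF A, of \<nu> ?w] bilinear_bound[OF A, of \<nu> \<nu>] \<nu>
        by (auto intro: order_trans[OF _ wC])
      have "\<bar>?t * A \<nu> \<nu>\<bar> \<le> 1 * C" unfolding abs_mult using t b1 by (intro mult_mono) auto
      then have "\<bar>A ?w \<nu> + A \<nu> ?w + ?t * A \<nu> \<nu>\<bar> \<le> 4 * C" using b1 C by linarith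
      then have "\<bar>A v v - A ?w ?w\<bar> \<le> \<bar>?t\<bar> * (4 * C)" unfolding eq abs_mult by (intro mult_left_mono) auto
      then show ?thesis by (simp add: Q_def field_simps abs_le_iff)
    qed
    define P where "P \<theta> = {v. norm v \<le> 1 \<and> v \<bullet> \<nu> + \<tau> * (Q (perp \<nu> v) + \<theta>) > 0}" for \<theta>
    have [measurable]: "P \<theta> \<in> sets borel" for \<theta> unfolding P_def by measurable
    have mono_\<tau>: "\<tau> * a \<le> \<tau> * b" if "a \<le> b" for a b using that \<tau> by simp
    have sub1: "cball 0 1 - F \<subseteq> P \<eta>'"
    proof
      fix v assume "v \<in> cball 0 1 - F"
      then have v: "norm v \<le> 1" and pos: "v \<bullet> \<nu> + \<tau> * q v > 0" using F[of v] by auto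
      have w: "norm (perp \<nu> v) \<le> 1" using norm_perp_le[OF \<nu>, of v] v by simp
      have "v \<bullet> \<nu> + \<tau> * (Q (perp \<nu> v) + \<eta>') > 0"
      proof (cases "\<bar>v \<bullet> \<nu>\<bar> \<le> C' * \<tau>")
        case True
        have "2 * C * \<bar>v \<bullet> \<nu>\<bar> \<le> 2 * C * (C' * \<tau>)" using True C by (intro mult_left_mono) auto
        then have "q v \<le> Q (perp \<nu> v) + \<eta>'" using q[OF v] Qdiff[OF v] unfolding \<eta>'_def Q_def by linarith
        from mono_\<tau>[OF this] pos show ?thesis by linarith
      next
        case False
        have "q v \<le> C'" using q[OF v] Qb[OF v] \<eta> C unfolding C'_def Q_def by linarith
        from mono_\<tau>[OF this] False pos have "v \<bullet> \<nu> > C' * \<tau>" by (simp add: mult.commute)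
        moreover have "- C' \<le> Q (perp \<nu> v) + \<eta>'" using Qb[OF w] \<eta>' C unfolding C'_def by linarith
        ultimately show ?thesis using mono_\<tau>[of "- C'"] by (fastforce simp: mult.commute)
      qed
      then show "v \<in> P \<eta>'" using v by (simp add: P_def)
    qed
    have sub2: "P (- \<eta>') \<subseteq> cball 0 1 - F"
    proof
      fix v assume "v \<in> P (- \<eta>')"
      then have v: "norm v \<le> 1" and pos: "v \<bullet> \<nu> + \<tau> * (Q (perp \<nu> v) + - \<eta>') > 0" by (auto simp: P_def)
      have w: "norm (perp \<nu> v) \<le> 1" using norm_perp_le[OF \<nu>, of v] v by simp
      have "v \<bullet> \<nu> + \<tau> * q v > 0"
      proof (cases "\<bar>v \<bullet> \<nu>\<bar> \<le> C' * \<tau>")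
        case True
        have "2 * C * \<bar>v \<bullet> \<nu>\<bar> \<le> 2 * C * (C' * \<tau>)" using True C by (intro mult_left_mono) auto
        then have "Q (perp \<nu> v) + - \<eta>' \<le> q v" using q[OF v] Qdiff[OF v] unfolding \<eta>'_def Q_def by linarith
        from mono_\<tau>[OF this] pos show ?thesis by linarith
      next
        case False
        have "Q (perp \<nu> v) + - \<eta>' \<le> C'" using Qb[OF w] \<eta>' C unfolding C'_def by linarith
        from mono_\<tau>[OF this] False pos have "v \<bullet> \<nu> > C' * \<tau>" by (simp add: mult.commute)
        moreover have "- C' \<le> q v" using q[OF v] Qb[OF v] \<eta> C unfolding C'_def Q_def by linarith
        ultimately show ?thesis using mono_\<tau>[of "- C'"] by (fastforce simp: mult.commute)
      qed
      then show "v \<in> cball 0 1 - F" using v F[OF v] by auto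
    qed
    let ?I = "LINT v|lborel. indicator (cyl \<nu>) v * Q (perp \<nu> v)"
    have I: "2 * ?I = \<omega> / (real DIM('a) + 1) * ((\<Sum>i\<in>Basis. A i i) - A \<nu> \<nu>)"
    proof -
      have "?I = (LINT v|lborel. indicator (cyl \<nu>) v * A (perp \<nu> v) (perp \<nu> v)) / 2"
        by (simp add: Q_def)
      then show ?thesis
        using cyl_integral_bilinear[OF \<nu> d, of A] unfolding \<omega>_def n_def by linarith
    qed
    have intQ: "integrable lborel (\<lambda>v. indicator (cyl \<nu>) v * Q (perp \<nu> v))"
      by (rule integrable_cyl[OF \<nu>, where B="C/2"]) (use Qb in \<open>auto simp: cyl_def\<close>)
    have int1: "integrable lborel (\<lambda>v. indicator (cyl \<nu>) v * \<theta>)" for \<theta> :: real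
      by (rule integrable_cyl[OF \<nu>, where B="\<bar>\<theta>\<bar>"]) auto
    have est: "\<bar>2 * measure lborel (P \<theta>) - measure lborel (cball (0::'a) 1) - 2 * \<tau> * (?I + \<theta> * \<omega>)\<bar> \<le> \<tau> * (\<epsilon> / 2)" if "\<bar>\<theta>\<bar> \<le> 1/2" for \<theta>
    proof -
      have I\<theta>: "(LINT v|lborel. indicator (cyl \<nu>) v * (Q (perp \<nu> v) + \<theta>)) = ?I + \<theta> * \<omega>"
        unfolding distrib_left using \<nu>
        by (subst Bochner_Integration.integral_add[OF intQ int1]) (simp add: measure_cyl \<omega>_def n_def)
      have "\<bar>2 * measure lborel (P \<theta>) - measure lborel (cball (0::'a) 1) - 2 * \<tau> * (LINT v|lborel. indicator (cyl \<nu>) v * (Q (perp \<nu> v) + \<theta>))\<bar>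
         \<le> 2 * \<tau> * C' * (\<omega> * (1 - sqrt (1 - (\<tau> * C')\<^sup>2) ^ n))"
        unfolding P_def \<omega>_def n_def
      proof (rule ball_above_graph_volume[OF \<nu>])
        show "\<bar>Q w + \<theta>\<bar> \<le> C'" if "norm w \<le> 1" for w
          using Qb[OF that] \<open>\<bar>\<theta>\<bar> \<le> 1/2\<close> C unfolding C'_def by linarith
      qed (use C' \<tau> \<tau>C in auto)
      also have "\<dots> = \<tau> * (2 * C' * (\<omega> * (1 - sqrt (1 - (\<tau> * C')\<^sup>2) ^ n)))"
        by (simp only: mult_ac)
      also have "\<dots> \<le> \<tau> * (\<epsilon> / 2)"
        using \<tau>1(2)[of \<tau>] \<tau> by (intro mult_left_mono) (auto simp: \<tau>0_def)
      finally show ?thesis unfolding I\<theta> .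
    qed
    have fin: "emeasure lborel (cball (0::'a) 1) < \<infinity>" by (simp add: emeasure_cball)
    have finB: "cball (0::'a) 1 \<in> fmeasurable lborel" using fin by (intro fmeasurableI) auto
    have finS: "S \<in> fmeasurable lborel" if "S \<subseteq> cball (0::'a) 1" "S \<in> sets borel" for S
      by (rule fmeasurableI2[OF finB that(1)]) (use that(2) in simp)
    have Pball: "P \<theta> \<subseteq> cball 0 1" for \<theta> by (auto simp: P_def)
    have up: "measure lborel (cball 0 1 - F) \<le> measure lborel (P \<eta>')"
      by (rule measure_mono_fmeasurable[OF sub1 _ finS[OF Pball]]) auto
    have low: "measure lborel (P (- \<eta>')) \<le> measure lborel (cball 0 1 - F)"
      by (rule measure_mono_fmeasurable[OF sub2 _ finS]) auto
    have "measure lborel (cball 0 1 - cball 0 1 \<inter> F) = measure lborel (cball (0::'a) 1) - measure lborel (cball 0 1 \<inter> F)"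
      using fin by (intro measure_Diff) auto
    moreover have "cball 0 1 - cball 0 1 \<inter> F = cball 0 1 - F" by blast
    ultimately have "measure lborel (cball (0::'a) 1) = measure lborel (cball 0 1 - F) + measure lborel (cball 0 1 \<inter> F)"
      by simp
    then have sg: "measure lborel (cball 0 1 - F) - measure lborel (cball 0 1 \<inter> F) = 2 * measure lborel (cball 0 1 - F) - measure lborel (cball (0::'a) 1)"
      by simp
    have e1: "2 * \<tau> * (\<eta>' * \<omega>) \<le> 2 * \<tau> * (\<epsilon> / 4)"
      using \<eta>' \<tau> by (intro mult_left_mono) auto
    have eq: "2 * \<tau> * (?I + \<theta> * \<omega>) = \<tau> * (2 * ?I) + 2 * \<tau> * (\<theta> * \<omega>)" for \<theta> by (simp add: algebra_simps)
    have "\<bar>(2 * measure lborel (cball 0 1 - F) - measure lborel (cball (0::'a) 1)) - \<tau> * (2 * ?I)\<bar> \<le> \<tau> * (\<epsilon> / 2) + 2 * \<tau> * (\<epsilon> / 4)"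
    proof -
      have "\<bar>\<eta>'\<bar> \<le> 1/2" "\<bar>- \<eta>'\<bar> \<le> 1/2" using \<eta>' by auto
      from est[OF this(1)] est[OF this(2)] up low e1 show ?thesis
        unfolding eq unfolding mult_minus_left mult_minus_right by linarith
    qed
    then show "\<bar>(measure lborel (cball 0 1 - F) - measure lborel (cball 0 1 \<inter> F)) -
        \<tau> * (unit_ball_vol (real (DIM('a) - 1)) / (real DIM('a) + 1) * ((\<Sum>i\<in>Basis. A i i) - A \<nu> \<nu>))\<bar> \<le> \<epsilon> * \<tau>"
      unfolding sg I \<omega>_def n_def by (simp add: algebra_simps)
  qed
qed

section \<open>Layer cake formula and asymptotics\<close>

definition sgvol :: "'a::euclidean_space set \<Rightarrow> 'a \<Rightarrow> real \<Rightarrow> real" where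
  "sgvol E x t = measure lborel (cball x t - E) - measure lborel (cball x t \<inter> E)"

lemma measure_lborel_scaleR_vimage:
  fixes A :: "'a::euclidean_space set"
  assumes "A \<in> sets borel" and c: "c > 0"
  shows "measure lborel A = c ^ DIM('a) * measure lborel ((\<lambda>v. t + c *\<^sub>R v) -` A)"
  using c by (simp add: measure_def emeasure_lborel_scaleR_vimage[OF assms, of t] enn2real_mult)

lemma sgvol_scale:
  fixes E :: "'a::euclidean_space set"
  assumes [measurable]: "E \<in> sets borel" and t: "t > 0"
  shows "sgvol E x t = t ^ DIM('a) * sgvol ((\<lambda>v. x + t *\<^sub>R v) -` E) 0 1"
proof -
  have "(\<lambda>v. x + t *\<^sub>R v) -` (cball x t - E) = cball 0 1 - (\<lambda>v. x + t *\<^sub>R v) -` E"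
    "(\<lambda>v. x + t *\<^sub>R v) -` (cball x t \<inter> E) = cball 0 1 \<inter> (\<lambda>v. x + t *\<^sub>R v) -` E"
    using t by (auto simp: dist_norm)
  then show ?thesis
    using t measure_lborel_scaleR_vimage[of "cball x t - E" t x] measure_lborel_scaleR_vimage[of "cball x t \<inter> E" t x]
    by (simp add: sgvol_def algebra_simps)
qed

lemma fmeasurable_cball_subset:
  fixes x :: "'a::euclidean_space"
  assumes "S \<subseteq> cball x t" "S \<in> sets borel"
  shows "S \<in> fmeasurable lborel"
proof (rule fmeasurableI2[OF _ assms(1)])
  have "emeasure lborel (cball x t) < \<infinity>"
    using emeasure_bounded_finite[of "cball x t"] by simp
  then show "cball x t \<in> fmeasurable lborel" by (intro fmeasurableI) auto
qed (use assms in simp)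

lemma abs_sgvol_le:
  fixes E :: "'a::euclidean_space set"
  assumes [measurable]: "E \<in> sets borel" and t: "t \<ge> 0"
  shows "\<bar>sgvol E x t\<bar> \<le> unit_ball_vol (real DIM('a)) * t ^ DIM('a)"
proof -
  have "measure lborel (cball x t - E) \<le> measure lborel (cball x t)"
    "measure lborel (cball x t \<inter> E) \<le> measure lborel (cball x t)"
    by (intro measure_mono_fmeasurable fmeasurable_cball_subset[of _ x t]; auto)+
  then show ?thesis unfolding sgvol_def content_cball[OF t, of x]
    by (simp add: abs_le_iff) (smt (verit) measure_nonneg)
qed

lemma sgvol_eq_integral:
  fixes E :: "'a::euclidean_space set"
  assumes [measurable]: "E \<in> sets borel"
  shows "sgvol E x t = (LINT y|lborel. (indicator (UNIV - E) y - indicator E y) * indicator {y. norm (x - y) \<le> t} y)"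
proof -
  have eq: "(indicator (UNIV - E) y - indicator E y) * indicator {y. norm (x - y) \<le> t} y =
    indicator (cball x t - E) y - (indicator (cball x t \<inter> E) y :: real)" for y
    by (auto simp: indicator_def dist_norm)
  have "integrable lborel (indicator (cball x t - E) :: _ \<Rightarrow> real)" "integrable lborel (indicator (cball x t \<inter> E) :: _ \<Rightarrow> real)"
    using fmeasurable_cball_subset[of "cball x t - E" x t] fmeasurable_cball_subset[of "cball x t \<inter> E" x t]
    by (auto simp: fmeasurable_def)
  then show ?thesis unfolding eq sgvol_def
    by (subst Bochner_Integration.integral_diff) auto
qed

lemma powr_tail_integral:
  fixes a e :: real
  assumes "e < -1" "a > 0"
  shows "has_bochner_integral lborel (\<lambda>x. indicator {a..} x * x powr e) (- (a powr (e+1)) / (e+1))"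
proof (rule has_bochner_integral_nn_integral)
  have eq: "(\<lambda>x. indicator {a..} x * x powr e) = (\<lambda>x. if x \<in> {a..} then x powr e else 0)"
    by (auto simp: indicator_def)
  have "((\<lambda>x. indicator {a..} x * x powr e) has_integral (- (a powr (e+1)) / (e+1))) UNIV"
    unfolding eq has_integral_restrict_UNIV by (rule has_integral_powr_to_inf[OF assms])
  then show "(\<integral>\<^sup>+ x. ennreal (indicator {a..} x * x powr e) \<partial>lborel) = ennreal (- (a powr (e+1)) / (e+1))"
    by (intro nn_integral_has_integral_lborel) auto
qed (use assms in \<open>auto simp: divide_nonneg_neg\<close>)

text \<open>The kernel at distance |x - y| is the integral of (d + s) t^(-d-s-1) over t \<ge> max r
  |x - y|, so its truncation at \<open>r\<close> turns into the lower limit of the outer integral.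
  Fubini applies because the ball of radius \<open>t\<close> contributes a multiple of t^(-s-1) in
  absolute value, which is integrable on [r, \<infinity>) for s > 0.\<close>

lemma Ksr_layer_cake:
  fixes E :: "'a::euclidean_space set"
  assumes [measurable]: "E \<in> sets borel" and r: "r > 0" and s: "s > 0"
  defines "w \<equiv> \<lambda>t. indicator {r..} t * ((real DIM('a) + s) * t powr (- real DIM('a) - s - 1))"
  shows "integrable lborel (\<lambda>t. w t * sgvol E x t)"
    and "Ksr s r x E = (LINT t|lborel. w t * sgvol E x t)"
proof -
  define sg where "sg y = (indicator (UNIV - E) y - indicator E y :: real)" for y
  have [measurable]: "sg \<in> borel_measurable borel" unfolding sg_def by measurable
  have [measurable]: "w \<in> borel_measurable borel" unfolding w_def by measurable
  have w0: "w t \<ge> 0" for t using s by (simp add: w_def)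
  have abs_sg: "\<bar>sg y\<bar> = 1" for y by (simp add: sg_def indicator_def)
  define f where "f t y = w t * (sg y * indicator {y. norm (x - y) \<le> t} y)" for t y
  have [measurable]: "case_prod f \<in> borel_measurable (lborel \<Otimes>\<^sub>M lborel)"
    unfolding f_def indicator_def by measurable
  have Iy: "(LINT y|lborel. f t y) = w t * sgvol E x t" for t
    unfolding f_def sgvol_eq_integral[OF assms(1)] sg_def by simp
  have ball: "indicator {y. norm (x - y) \<le> t} = (indicator (cball x t) :: 'a \<Rightarrow> real)" for t
    by (auto simp: indicator_def dist_norm fun_eq_iff)
  have intball: "integrable lborel (indicator {y. norm (x - y) \<le> t} :: 'a \<Rightarrow> real)" for t
    unfolding ball using fmeasurable_cball_subset[of "cball x t" x t] by (auto simp: fmeasurable_def)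
  have intf: "integrable lborel (f t)" for t
    unfolding f_def
  proof (rule integrable_mult_right, rule Bochner_Integration.integrable_bound[OF intball[of t]])
    show "AE y in lborel. norm (sg y * indicator {y. norm (x - y) \<le> t} y) \<le> norm (indicator {y. norm (x - y) \<le> t} y :: real)"
      by (auto simp: abs_mult abs_sg)
  qed (unfold indicator_def, measurable)
  define \<omega> where "\<omega> = unit_ball_vol (real DIM('a))"
  have "(LINT y|lborel. norm (f t y)) = (real DIM('a) + s) * \<omega> * (indicator {r..} t * t powr (- s - 1))" for t
  proof -
    have "(LINT y|lborel. norm (f t y)) = (LINT y|lborel. w t * indicator {y. norm (x - y) \<le> t} y)"
      using w0[of t] by (simp add: f_def abs_mult abs_sg)
    also have "\<dots> = w t * measure lborel (cball x t)" unfolding ball by simp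
    also have "\<dots> = (real DIM('a) + s) * \<omega> * (indicator {r..} t * t powr (- s - 1))"
    proof (cases "t \<ge> r")
      case True
      then have "t powr (- real DIM('a) - s - 1) * t ^ DIM('a) = t powr (- s - 1)"
        using r by (simp add: powr_realpow[symmetric] powr_add[symmetric])
      then show ?thesis using True r by (simp add: w_def content_cball \<omega>_def)
    qed (simp add: w_def)
    finally show ?thesis .
  qed
  moreover have "integrable lborel (\<lambda>t. (real DIM('a) + s) * \<omega> * (indicator {r..} t * t powr (- s - 1)))"
    using powr_tail_integral[of "- s - 1" r] s r by (intro integrable_mult_right) (auto simp: has_bochner_integral_iff)
  ultimately have "integrable lborel (\<lambda>t. LINT y|lborel. norm (f t y))" by simp
  then have int: "integrable (lborel \<Otimes>\<^sub>M lborel) (case_prod f)"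
    using intf by (intro lborel_pair.Fubini_integrable) auto
  show "integrable lborel (\<lambda>t. w t * sgvol E x t)"
    using lborel_pair.integrable_fst'[OF int] by (simp add: Iy)
  have Kt: "(LINT t|lborel. f t y) = sg y * kernel DIM('a) s r (norm (x - y))" for y
  proof -
    let ?m = "max r (norm (x - y))"
    have "(LINT t|lborel. f t y) = (LINT t|lborel. (sg y * (real DIM('a) + s)) * (indicator {?m..} t * t powr (- real DIM('a) - s - 1)))"
      by (intro Bochner_Integration.integral_cong) (auto simp: f_def w_def indicator_def)
    also have "\<dots> = sg y * (real DIM('a) + s) * (?m powr (- real DIM('a) - s) / (real DIM('a) + s))"
    proof -
      have e: "- (a / (- real DIM('a) - s)) = a / (real DIM('a) + s)" for a
        by (metis minus_add_distrib minus_divide_right uminus_add_conv_diff add.commute minus_minus)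
      have "(LINT t|lborel. indicator {?m..} t * t powr (- real DIM('a) - s - 1)) = ?m powr (- real DIM('a) - s) / (real DIM('a) + s)"
        using has_bochner_integral_integral_eq[OF powr_tail_integral[of "- real DIM('a) - s - 1" ?m]] s r
        by (simp add: e less_max_iff_disj)
      then show ?thesis by simp
    qed
    also have "\<dots> = sg y * ?m powr (- real DIM('a) - s)" using s by simp
    also have "?m powr (- real DIM('a) - s) = kernel DIM('a) s r (norm (x - y))"
      by (simp add: kernel_def max_def)
    finally show ?thesis .
  qed
  have "Ksr s r x E = (LINT y|lborel. (LINT t|lborel. f t y))"
    unfolding Ksr_def Kt sg_def ..
  also have "\<dots> = (LINT t|lborel. w t * sgvol E x t)"
    unfolding Iy[symmetric] by (rule lborel_pair.Fubini_integral[OF int])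
  finally show "Ksr s r x E = (LINT t|lborel. w t * sgvol E x t)" .
qed


section \<open>Growth of \<open>sigma\<close> and passage from signed volumes to the kernel\<close>

lemma sigma_at_top:
  assumes "s \<ge> 1"
  shows "filterlim (sigma d s) at_top (at_right 0)"
proof (cases "s = 1")
  case True
  have "filterlim (\<lambda>r::real. \<bar>ln r\<bar>) at_top (at_right 0)" by real_asymp
  then show ?thesis using True by (simp add: sigma_def[abs_def])
next
  case False
  with assms have s: "s > 1" by simp
  have "filterlim (\<lambda>r::real. r powr (1 - s)) at_top (at_right 0)" using s by real_asymp
  then have "filterlim (\<lambda>r. ((real d + s) / (real d + 1) / (s - 1)) * r powr (1 - s)) at_top (at_right 0)"
    using s by (intro filterlim_tendsto_pos_mult_at_top[OF tendsto_const]) auto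
  then show ?thesis using False by (simp add: sigma_def[abs_def])
qed

lemma powr_integral_Icc:
  fixes s :: real
  assumes s: "s \<ge> 1" and r: "0 < r" "r \<le> \<delta>"
  shows "has_bochner_integral lborel (\<lambda>t. t powr (- s) * indicator {r..\<delta>} t)
     (if s = 1 then ln \<delta> - ln r else (r powr (1 - s) - \<delta> powr (1 - s)) / (s - 1))"
proof (cases "s = 1")
  case True
  have "has_bochner_integral lborel (\<lambda>t. t powr (- s) * indicator {r..\<delta>} t) (ln \<delta> - ln r)"
    using r by (intro has_bochner_integral_FTC_Icc_real)
      (auto simp: True powr_minus divide_inverse intro!: derivative_eq_intros continuous_intros)
  then show ?thesis using True by simp
next
  case False
  have "has_bochner_integral lborel (\<lambda>t. t powr (- s) * indicator {r..\<delta>} t)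
     (\<delta> powr (1 - s) / (1 - s) - r powr (1 - s) / (1 - s))"
  proof (rule has_bochner_integral_FTC_Icc_real)
    fix t assume "r \<le> t" "t \<le> \<delta>"
    then have t: "t > 0" using r by simp
    show "((\<lambda>t. t powr (1 - s) / (1 - s)) has_real_derivative t powr (- s)) (at t)"
      using DERIV_cdivide[OF has_real_derivative_powr[OF t, of "1 - s"], of "1 - s"] False by simp
    show "isCont (\<lambda>t. t powr (- s)) t"
      using t by (auto intro!: continuous_intros)
  qed (use r in auto)
  also have "\<delta> powr (1 - s) / (1 - s) - r powr (1 - s) / (1 - s) = (r powr (1 - s) - \<delta> powr (1 - s)) / (s - 1)"
    using False by (simp add: divide_simps) (simp add: algebra_simps)
  finally show ?thesis using False by simp
qed

text \<open>This is where the normalisation of \<open>sigma\<close> comes from. For s = 1 the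
  integral is ln \<delta> - ln r and the factor d + s equals d + 1; for s > 1 the quotient (d + s) /
  (d + 1) inside \<open>sigma\<close> exchanges one factor for the other. The endpoint \<delta>
  contributes a bounded term only.\<close>

lemma truncated_powr_integral_asymp:
  fixes s \<delta> :: real
  assumes s: "s \<ge> 1" and \<delta>: "\<delta> > 0"
  shows "((\<lambda>r. (LINT t|lborel. t powr (- s) * indicator {r..\<delta>} t) * (real d + s) / sigma d s r)
     \<longlongrightarrow> real d + 1) (at_right 0)"
proof -
  have ev: "\<forall>\<^sub>F r in at_right 0. 0 < r \<and> r < min \<delta> 1"
    using \<delta> by (auto simp: eventually_at_right_field intro!: exI[of _ "min \<delta> 1"])
  show ?thesis
  proof (cases "s = 1")
    case True
    have lim: "((\<lambda>r. (ln \<delta> - ln r) / \<bar>ln r\<bar> * (real d + 1)) \<longlongrightarrow> 1 * (real d + 1)) (at_right 0)"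
      by (intro tendsto_mult tendsto_const) real_asymp
    show ?thesis
    proof (rule Lim_transform_eventually[OF _ eventually_mono[OF ev]])
      fix r assume "0 < r \<and> r < min \<delta> 1"
      then show "(ln \<delta> - ln r) / \<bar>ln r\<bar> * (real d + 1) =
          (LINT t|lborel. t powr (- s) * indicator {r..\<delta>} t) * (real d + s) / sigma d s r"
        using has_bochner_integral_integral_eq[OF powr_integral_Icc[OF s, of r \<delta>]] True
        by (simp add: sigma_def)
    qed (use lim in simp)
  next
    case False
    with s have s1: "s > 1" by simp
    have "((\<lambda>r. r powr (s - 1)) \<longlongrightarrow> 0) (at_right 0)" using s1 by real_asymp
    then have "((\<lambda>r. (real d + 1) * (1 - \<delta> powr (1 - s) * r powr (s - 1))) \<longlongrightarrow> (real d + 1) * (1 - \<delta> powr (1 - s) * 0)) (at_right 0)"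
      by (intro tendsto_intros)
    then have lim: "((\<lambda>r. (real d + 1) * (1 - \<delta> powr (1 - s) * r powr (s - 1))) \<longlongrightarrow> (real d + 1)) (at_right 0)"
      by simp
    show ?thesis
    proof (rule Lim_transform_eventually[OF lim eventually_mono[OF ev]])
      fix r assume r: "0 < r \<and> r < min \<delta> 1"
      have "r powr (1 - s) * r powr (s - 1) = 1" using r by (simp add: powr_add[symmetric])
      then have e: "r powr (s - 1) = 1 / r powr (1 - s)" using r by (simp add: field_simps)
      show "(real d + 1) * (1 - \<delta> powr (1 - s) * r powr (s - 1)) =
          (LINT t|lborel. t powr (- s) * indicator {r..\<delta>} t) * (real d + s) / sigma d s r"
      proof -
        have I: "(LINT t|lborel. t powr (- s) * indicator {r..\<delta>} t) = (r powr (1 - s) - \<delta> powr (1 - s)) / (s - 1)"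
          using has_bochner_integral_integral_eq[OF powr_integral_Icc[OF s, of r \<delta>]] False r by simp
        have "(a + 1) * (1 - D * (1 / X)) = (X - D) / m * (a + s) / ((a + s) / (a + 1) * X / m)"
          if "X > 0" "m > 0" "a \<ge> 0" for X D m a :: real
          using that s1 by (simp add: divide_simps)
        from this[of "r powr (1 - s)" "s - 1" "real d" "\<delta> powr (1 - s)"] show ?thesis
          unfolding I e sigma_def using False r s1 by simp
      qed
    qed
  qed
qed

text \<open>Multiplying t^(d+1) by the layer cake weight gives (d + s) t^(-s), so the scales between
  \<open>r\<close> and \<delta> yield \<open>c\<close> times the truncated power integral. Larger
  scales are bounded through the volume of the ball by a constant \<open>T\<close> that does not
  depend on \<open>r\<close>. In the hypothesis \<delta> is fixed before \<open>r\<close>, since for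
  each small \<open>r\<close> all scales up to \<delta> enter.\<close>

lemma Ksr_asymp_of_sgvol:
  fixes Er :: "real \<Rightarrow> 'a::euclidean_space set"
  assumes s: "s \<ge> 1" and meas: "\<And>r. r > 0 \<Longrightarrow> Er r \<in> sets borel"
    and vol: "\<And>\<epsilon>. \<epsilon> > 0 \<Longrightarrow> \<exists>\<delta>>0. \<forall>\<^sub>F r in at_right 0. \<forall>t. 0 < t \<longrightarrow> t \<le> \<delta> \<longrightarrow>
       \<bar>sgvol (Er r) x t - c * t ^ (DIM('a) + 1)\<bar> \<le> \<epsilon> * t ^ (DIM('a) + 1)"
  shows "((\<lambda>r. Ksr s r x (Er r) / sigma DIM('a) s r) \<longlongrightarrow> c * (real DIM('a) + 1)) (at_right 0)"
proof (rule tendstoI)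
  fix e :: real assume e: "e > 0"
  let ?d = "DIM('a)"
  \<comment> \<open>Since \<open>L r / sigma\<close> is eventually below d + 2, the relative error
    \<epsilon> costs at most e/4. The limit of \<open>c * (L r / sigma)\<close> and the tail
    \<open>T / sigma\<close> cost a further e/4 each.\<close>
  define \<epsilon> where "\<epsilon> = e / (4 * (real ?d + 2))"
  have \<epsilon>: "\<epsilon> > 0" using e by (simp add: \<epsilon>_def)
  obtain \<delta> where \<delta>: "\<delta> > 0" and ev1: "\<forall>\<^sub>F r in at_right 0. \<forall>t. 0 < t \<longrightarrow> t \<le> \<delta> \<longrightarrow>
       \<bar>sgvol (Er r) x t - c * t ^ (?d + 1)\<bar> \<le> \<epsilon> * t ^ (?d + 1)"
    using vol[OF \<epsilon>] by blast
  define L where "L r = (LINT t|lborel. t powr (- s) * indicator {r..\<delta>} t) * (real ?d + s)" for r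
  define \<omega> where "\<omega> = unit_ball_vol (real ?d)"
  define T where "T = (real ?d + s) * \<omega> * (LINT t|lborel. indicator {\<delta>..} t * t powr (- s - 1))"
  have \<omega>: "\<omega> > 0" by (simp add: \<omega>_def)
  have limL: "((\<lambda>r. L r / sigma ?d s r) \<longlongrightarrow> real ?d + 1) (at_right 0)"
    unfolding L_def by (rule truncated_powr_integral_asymp[OF s \<delta>])
  have top: "filterlim (sigma ?d s) at_top (at_right 0)" by (rule sigma_at_top[OF s])
  have limT: "((\<lambda>r. T / sigma ?d s r) \<longlongrightarrow> 0) (at_right 0)"
    by (rule real_tendsto_divide_at_top[OF tendsto_const top])
  have limc: "((\<lambda>r. c * (L r / sigma ?d s r)) \<longlongrightarrow> c * (real ?d + 1)) (at_right 0)"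
    by (intro tendsto_intros limL)
  have ev2: "\<forall>\<^sub>F r in at_right 0. dist (c * (L r / sigma ?d s r)) (c * (real ?d + 1)) < e / 4"
    by (rule tendstoD[OF limc]) (use e in simp)
  have ev3: "\<forall>\<^sub>F r in at_right 0. dist (T / sigma ?d s r) 0 < e / 4"
    by (rule tendstoD[OF limT]) (use e in simp)
  have ev4: "\<forall>\<^sub>F r in at_right 0. L r / sigma ?d s r < real ?d + 2"
    by (rule order_tendstoD(2)[OF limL]) simp
  have ev5: "\<forall>\<^sub>F r in at_right 0. 0 < sigma ?d s r"
    using top by (simp add: filterlim_at_top_dense)
  have ev6: "\<forall>\<^sub>F r in at_right 0. 0 < r \<and> r < \<delta>"
    using \<delta> by (auto simp: eventually_at_right_field)
  show "\<forall>\<^sub>F r in at_right 0. dist (Ksr s r x (Er r) / sigma ?d s r) (c * (real ?d + 1)) < e"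
    using ev1 ev2 ev3 ev4 ev5 ev6
  proof eventually_elim
    case (elim r)
    have r: "0 < r" "r < \<delta>" and sig: "0 < sigma ?d s r" using elim by auto
    note [measurable] = meas[OF r(1)]
    define w where "w t = indicator {r..} t * ((real ?d + s) * t powr (- real ?d - s - 1))" for t
    have s0: "s > 0" using s by simp
    have intK: "integrable lborel (\<lambda>t. w t * sgvol (Er r) x t)"
      and K: "Ksr s r x (Er r) = (LINT t|lborel. w t * sgvol (Er r) x t)"
      unfolding w_def by (rule Ksr_layer_cake[OF meas[OF r(1)] r(1) s0])+
    define u where "u t = (real ?d + s) * (t powr (- s) * indicator {r..\<delta>} t)" for t
    have intu: "integrable lborel u"
      unfolding u_def using powr_integral_Icc[OF s r(1), of \<delta>] r
      by (intro integrable_mult_right) (auto simp: has_bochner_integral_iff)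
    have Lu: "(LINT t|lborel. u t) = L r" by (simp add: u_def L_def)
    define v where "v t = (real ?d + s) * \<omega> * (indicator {\<delta>..} t * t powr (- s - 1))" for t
    have intv: "integrable lborel v"
      unfolding v_def using powr_tail_integral[of "- s - 1" \<delta>] s \<delta>
      by (intro integrable_mult_right) (auto simp: has_bochner_integral_iff)
    have Tv: "(LINT t|lborel. v t) = T" by (simp add: v_def T_def)
    have pt: "\<bar>w t * sgvol (Er r) x t - c * u t\<bar> \<le> \<epsilon> * u t + v t" for t
    proof -
      consider "t < r" | "r \<le> t" "t \<le> \<delta>" | "\<delta> < t" by linarith
      then show ?thesis
      proof cases
        case 1 then show ?thesis using r \<delta> by (simp add: w_def u_def v_def)
      next
        case 2
        then have t: "t > 0" using r by simp
        have "t powr (- real ?d - s - 1) * t ^ (?d + 1) = t powr (- s)"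
          using t by (simp add: powr_realpow[symmetric] powr_add[symmetric] del: power_Suc)
        then have uw: "u t = w t * t ^ (?d + 1)" using 2 by (simp add: u_def w_def del: power_Suc)
        have w0: "w t \<ge> 0" using s by (simp add: w_def)
        have "\<bar>w t * sgvol (Er r) x t - c * u t\<bar> = w t * \<bar>sgvol (Er r) x t - c * t ^ (?d + 1)\<bar>"
        proof -
          have "w t * sgvol (Er r) x t - c * u t = w t * (sgvol (Er r) x t - c * t ^ (?d + 1))"
            unfolding uw by (simp only: right_diff_distrib mult_ac)
          then show ?thesis using w0 by (simp add: abs_mult)
        qed
        also have "\<dots> \<le> w t * (\<epsilon> * t ^ (?d + 1))"
          using elim t 2 w0 by (intro mult_left_mono) auto
        also have "\<dots> = \<epsilon> * u t" unfolding uw by simp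
        also have "\<dots> \<le> \<epsilon> * u t + v t" using s \<omega> by (simp add: v_def)
        finally show ?thesis .
      next
        case 3
        then have t: "t > 0" using \<delta> by simp
        have "t powr (- real ?d - s - 1) * t ^ ?d = t powr (- s - 1)"
          using t by (simp add: powr_realpow[symmetric] powr_add[symmetric])
        then have vw: "v t = w t * (\<omega> * t ^ ?d)" using 3 r by (simp add: v_def w_def)
        have w0: "w t \<ge> 0" using s by (simp add: w_def)
        have u: "u t = 0" using 3 by (simp add: u_def)
        have "w t * \<bar>sgvol (Er r) x t\<bar> \<le> w t * (\<omega> * t ^ ?d)"
          unfolding \<omega>_def using abs_sgvol_le[OF meas[OF r(1)], of t x] t w0 by (intro mult_left_mono) auto
        then show ?thesis unfolding u vw using w0 by (simp add: abs_mult)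
      qed
    qed
    have "\<bar>Ksr s r x (Er r) - c * L r\<bar> = \<bar>LINT t|lborel. w t * sgvol (Er r) x t - c * u t\<bar>"
      unfolding K Lu[symmetric] using intK intu by simp
    also have "\<dots> \<le> (LINT t|lborel. \<epsilon> * u t + v t)"
      using pt intK intu intv by (intro Bochner_Integration.integral_abs_bound_integral) auto
    also have "\<dots> = \<epsilon> * L r + T"
      unfolding Lu[symmetric] Tv[symmetric] using intu intv by simp
    finally have "\<bar>Ksr s r x (Er r) - c * L r\<bar> / sigma ?d s r \<le> (\<epsilon> * L r + T) / sigma ?d s r"
      using sig by (intro divide_right_mono) auto
    moreover have "\<bar>Ksr s r x (Er r) - c * L r\<bar> / sigma ?d s r = \<bar>Ksr s r x (Er r) / sigma ?d s r - c * (L r / sigma ?d s r)\<bar>"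
      using sig by (simp add: diff_divide_distrib[symmetric])
    moreover have "(\<epsilon> * L r + T) / sigma ?d s r = \<epsilon> * (L r / sigma ?d s r) + T / sigma ?d s r"
      by (simp add: add_divide_distrib)
    moreover have "\<epsilon> * (L r / sigma ?d s r) \<le> \<epsilon> * (real ?d + 2)"
      using elim \<epsilon> by (intro mult_left_mono) auto
    moreover have "\<epsilon> * (real ?d + 2) = e / 4" by (simp add: \<epsilon>_def field_simps)
    moreover have "\<bar>c * (L r / sigma ?d s r) - c * (real ?d + 1)\<bar> < e / 4" "\<bar>T / sigma ?d s r - 0\<bar> < e / 4"
      using elim by (simp_all only: dist_real_def)
    ultimately show ?case unfolding dist_real_def using e by linarith
  qed
qed

section \<open>Second-order expansion of the perturbed sets\<close>

text \<open>The base point \<open>a\<close> moves while the Hessian stays frozen at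
  \<open>x\<close>: the expansion is later used at the preimage of \<open>x\<close>, which changes
  with \<open>r\<close>. By continuity of \<open>f''\<close>, the map f' - f'' x is \<eta>-Lipschitz
  near \<open>x\<close>; a mean value estimate along the segment from \<open>a\<close> to
  \<open>y\<close> gives the second order.\<close>

lemma C2_taylor:
  fixes f :: "'a::euclidean_space \<Rightarrow> real"
  assumes C2: "C2_on_with (ball x \<rho>) f f' f''" and \<rho>: "\<rho> > 0" and \<eta>: "\<eta> > 0"
  obtains \<delta> where "0 < \<delta>" "\<delta> \<le> \<rho>"
    "\<And>a y. a \<in> ball x \<delta> \<Longrightarrow> y \<in> ball x \<delta> \<Longrightarrow>
      \<bar>f y - f a - f' a (y - a) - f'' x (y - a) (y - a) / 2\<bar> \<le> \<eta> * (norm (y - a))\<^sup>2"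
proof -
  have df: "\<And>y. y \<in> ball x \<rho> \<Longrightarrow> (f has_derivative blinfun_apply (f' y)) (at y)"
    and df': "\<And>y. y \<in> ball x \<rho> \<Longrightarrow> (f' has_derivative blinfun_apply (f'' y)) (at y)"
    and cont: "continuous_on (ball x \<rho>) f''"
    using C2 by (auto simp: C2_on_with_def)
  obtain \<delta>0 where \<delta>0: "\<delta>0 > 0" "\<And>y. y \<in> ball x \<rho> \<Longrightarrow> dist y x < \<delta>0 \<Longrightarrow> dist (f'' y) (f'' x) < \<eta>"
    using continuous_onE[OF cont, of x \<eta>] \<rho> \<eta> by (metis centre_in_ball less_imp_le)
  define \<delta> where "\<delta> = min \<delta>0 \<rho>"
  have \<delta>: "0 < \<delta>" "\<delta> \<le> \<rho>" using \<delta>0 \<rho> by (auto simp: \<delta>_def)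
  have sub: "y \<in> ball x \<rho>" if "y \<in> ball x \<delta>" for y using that by (auto simp: \<delta>_def)
  have f'': "norm (f'' y - f'' x) \<le> \<eta>" if "y \<in> ball x \<delta>" for y
    using \<delta>0(2)[of y] that by (auto simp: \<delta>_def dist_norm norm_minus_commute[of x])
  have lin: "norm (f' y - f' a - f'' x (y - a)) \<le> \<eta> * norm (y - a)" if a: "a \<in> ball x \<delta>" and y: "y \<in> ball x \<delta>" for a y
  proof -
    have "norm ((f' y - f'' x y) - (f' a - f'' x a)) \<le> \<eta> * norm (y - a)"
    proof (rule differentiable_bound[of "ball x \<delta>" "\<lambda>y. f' y - f'' x y" "\<lambda>y. blinfun_apply (f'' y - f'' x)"])
      fix z assume z: "z \<in> ball x \<delta>"
      show "((\<lambda>y. f' y - f'' x y) has_derivative blinfun_apply (f'' z - f'' x)) (at z within ball x \<delta>)"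
        by (rule has_derivative_at_withinI)
          (auto intro!: derivative_eq_intros df'[OF sub[OF z]] simp: blinfun.diff_left)
      show "onorm (blinfun_apply (f'' z - f'' x)) \<le> \<eta>"
        using f''[OF z] by (simp add: norm_blinfun.rep_eq)
    qed (use a y in auto)
    then show ?thesis by (simp add: blinfun.diff_right algebra_simps)
  qed
  show thesis
  proof (rule that[OF \<delta>])
    fix a y assume a: "a \<in> ball x \<delta>" and y: "y \<in> ball x \<delta>"
    define z where "z = y - a"
    have seg: "a + t *\<^sub>R z \<in> ball x \<delta>" if "t \<in> {0..1}" for t
    proof -
      have "(1 - t) *\<^sub>R a + t *\<^sub>R y \<in> ball x \<delta>"
        using that a y by (intro convexD_alt[OF convex_ball]) auto
      then show ?thesis by (simp add: z_def algebra_simps)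
    qed
    define \<phi> where "\<phi> t = f (a + t *\<^sub>R z) - t * f' a z - t\<^sup>2 / 2 * f'' x z z" for t
    have "norm (\<phi> 1 - \<phi> 0) \<le> \<eta> * (norm z)\<^sup>2 * norm (1 - 0 :: real)"
    proof (rule differentiable_bound[of "{0..1}" \<phi> "\<lambda>t h. h * (f' (a + t *\<^sub>R z) z - f' a z - t * f'' x z z)"])
      fix t :: real assume t: "t \<in> {0..1}"
      have "((\<lambda>t. f (a + t *\<^sub>R z)) has_derivative (\<lambda>h. f' (a + t *\<^sub>R z) (h *\<^sub>R z))) (at t)"
        by (rule has_derivative_compose[of "\<lambda>t. a + t *\<^sub>R z" _ t _ f, OF _ df[OF sub[OF seg[OF t]]]])
          (auto intro!: derivative_eq_intros)
      then have "(\<phi> has_derivative (\<lambda>h. h * (f' (a + t *\<^sub>R z) z - f' a z - t * f'' x z z))) (at t)"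
        unfolding \<phi>_def[abs_def]
        by (auto intro!: derivative_eq_intros simp: blinfun.scaleR_right algebra_simps power2_eq_square)
      then show "(\<phi> has_derivative (\<lambda>h. h * (f' (a + t *\<^sub>R z) z - f' a z - t * f'' x z z))) (at t within {0..1})"
        by (rule has_derivative_at_withinI)
      have "\<bar>f' (a + t *\<^sub>R z) z - f' a z - t * f'' x z z\<bar> = \<bar>(f' (a + t *\<^sub>R z) - f' a - f'' x (t *\<^sub>R z)) z\<bar>"
        by (simp add: blinfun.diff_left blinfun.scaleR_right blinfun.scaleR_left)
      also have "\<dots> \<le> norm (f' (a + t *\<^sub>R z) - f' a - f'' x (t *\<^sub>R z)) * norm z"
        using norm_blinfun[of "f' (a + t *\<^sub>R z) - f' a - f'' x (t *\<^sub>R z)" z] by simp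
      also have "\<dots> \<le> \<eta> * norm (t *\<^sub>R z) * norm z"
        using lin[OF a seg[OF t]] by (intro mult_right_mono) auto
      also have "\<dots> = t * (\<eta> * (norm z)\<^sup>2)" using t by (simp add: power2_eq_square)
      also have "\<dots> \<le> 1 * (\<eta> * (norm z)\<^sup>2)" using t \<eta> by (intro mult_right_mono) auto
      finally have *: "\<bar>f' (a + t *\<^sub>R z) z - f' a z - t * f'' x z z\<bar> \<le> \<eta> * (norm z)\<^sup>2" by simp
      show "onorm (\<lambda>h. h * (f' (a + t *\<^sub>R z) z - f' a z - t * f'' x z z)) \<le> \<eta> * (norm z)\<^sup>2"
      proof (rule onorm_bound)
        fix h :: real
        show "norm (h * (f' (a + t *\<^sub>R z) z - f' a z - t * f'' x z z)) \<le> \<eta> * (norm z)\<^sup>2 * norm h"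
          using mult_left_mono[OF *, of "\<bar>h\<bar>"] by (simp add: abs_mult mult_ac)
      qed (use \<eta> in simp)
    qed auto
    then show "\<bar>f y - f a - f' a (y - a) - f'' x (y - a) (y - a) / 2\<bar> \<le> \<eta> * (norm (y - a))\<^sup>2"
      by (simp add: \<phi>_def z_def algebra_simps)
  qed
qed

text \<open>Mean value estimates for \<Phi> - id and for \<Phi> minus its linearisation at
  \<open>a\<close>; for the second, the bound on \<open>D2\<close> makes \<open>D\<close> Lipschitz
  with constant \<epsilon>. The quadratic error carries the small factor \<epsilon>, so the
  diffeomorphisms leave no trace in the limiting curvature.\<close>

lemma near_identity_estimates:
  fixes \<Phi> :: "'a::euclidean_space \<Rightarrow> 'a"
  assumes diffeo: "C2_diffeo_with \<Phi> D D2"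
    and D: "\<And>y. norm (D y - id_blinfun) \<le> \<epsilon>" and D2: "\<And>y. norm (D2 y) \<le> \<epsilon>"
  shows "norm (\<Phi> y - \<Phi> a - (y - a)) \<le> \<epsilon> * norm (y - a)"
    and "norm (\<Phi> y - \<Phi> a - D a (y - a)) \<le> \<epsilon> * (norm (y - a))\<^sup>2"
proof -
  have d\<Phi>: "\<And>y. (\<Phi> has_derivative blinfun_apply (D y)) (at y)"
    and dD: "\<And>y. (D has_derivative blinfun_apply (D2 y)) (at y)"
    using diffeo by (auto simp: C2_diffeo_with_def)
  have "norm ((\<Phi> y - y) - (\<Phi> a - a)) \<le> \<epsilon> * norm (y - a)"
  proof (rule differentiable_bound[of UNIV "\<lambda>y. \<Phi> y - y" "\<lambda>y. blinfun_apply (D y - id_blinfun)"])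
    fix z
    show "((\<lambda>y. \<Phi> y - y) has_derivative blinfun_apply (D z - id_blinfun)) (at z within UNIV)"
      by (auto intro!: derivative_eq_intros d\<Phi> simp: blinfun.diff_left)
    show "onorm (blinfun_apply (D z - id_blinfun)) \<le> \<epsilon>"
      using D[of z] by (simp add: norm_blinfun.rep_eq)
  qed auto
  then show "norm (\<Phi> y - \<Phi> a - (y - a)) \<le> \<epsilon> * norm (y - a)" by (simp add: algebra_simps)
  have \<epsilon>0: "\<epsilon> \<ge> 0" using D2 norm_ge_zero order_trans by blast
  have DL: "norm (D z - D a) \<le> \<epsilon> * norm (z - a)" for z
    by (rule differentiable_bound[of UNIV D "\<lambda>y. blinfun_apply (D2 y)"])
      (use dD D2 in \<open>auto simp: norm_blinfun.rep_eq[symmetric]\<close>)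
  have "norm ((\<Phi> y - D a y) - (\<Phi> a - D a a)) \<le> (\<epsilon> * norm (y - a)) * norm (y - a)"
  proof (rule differentiable_bound[of "closed_segment a y" "\<lambda>y. \<Phi> y - D a y" "\<lambda>y. blinfun_apply (D y - D a)"])
    fix z assume z: "z \<in> closed_segment a y"
    show "((\<lambda>y. \<Phi> y - D a y) has_derivative blinfun_apply (D z - D a)) (at z within closed_segment a y)"
      by (rule has_derivative_at_withinI) (auto intro!: derivative_eq_intros d\<Phi> simp: blinfun.diff_left)
    have "norm (z - a) \<le> norm (y - a)" using segment_bound1[OF z] by (simp add: norm_minus_commute)
    then have "\<epsilon> * norm (z - a) \<le> \<epsilon> * norm (y - a)" using \<epsilon>0 by (intro mult_left_mono)
    then show "onorm (blinfun_apply (D z - D a)) \<le> \<epsilon> * norm (y - a)"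
      using DL[of z] by (simp add: norm_blinfun.rep_eq)
  qed auto
  then show "norm (\<Phi> y - \<Phi> a - D a (y - a)) \<le> \<epsilon> * (norm (y - a))\<^sup>2"
    by (simp add: blinfun.diff_right algebra_simps power2_eq_square)
qed

section \<open>Charts at boundary points and their transport by the diffeomorphisms\<close>

lemma linear_functional_inner:
  fixes l :: "'a::euclidean_space \<Rightarrow> real"
  assumes "linear l"
  obtains p where "\<And>v. l v = p \<bullet> v"
proof
  fix v
  have "l v = l (\<Sum>b\<in>Basis. (v \<bullet> b) *\<^sub>R b)" by (simp add: euclidean_representation)
  also have "\<dots> = (\<Sum>b\<in>Basis. l b *\<^sub>R b) \<bullet> v"
    using assms by (simp add: linear_sum linear_cmul inner_sum_left inner_commute[of v] mult.commute)
  finally show "l v = (\<Sum>b\<in>Basis. l b *\<^sub>R b) \<bullet> v" .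
qed

text \<open>A point strictly below the graph has a neighbourhood below the graph, hence in
  \<open>E\<close>. The boundary point is given by membership and non-interiority, the two
  properties that are carried from \<open>x\<close> to its preimage.\<close>

lemma local_subgraph_zero:
  assumes loc: "local_subgraph E x \<nu> \<rho> f f' f''"
    and a: "a \<in> ball x \<rho>" and E: "a \<in> E" and nint: "a \<notin> interior E"
  shows "(a - x) \<bullet> \<nu> = f a"
proof -
  have mem: "\<And>y. y \<in> ball x \<rho> \<Longrightarrow> y \<in> E \<longleftrightarrow> (y - x) \<bullet> \<nu> \<le> f y"
    and df: "\<And>y. y \<in> ball x \<rho> \<Longrightarrow> (f has_derivative blinfun_apply (f' y)) (at y)"
    using loc by (auto simp: local_subgraph_def C2_on_with_def)
  have contf: "continuous_on (ball x \<rho>) f"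
    by (meson continuous_at_imp_continuous_on df has_derivative_continuous)
  have "\<not> (a - x) \<bullet> \<nu> < f a"
  proof
    assume "(a - x) \<bullet> \<nu> < f a"
    have "open {y \<in> ball x \<rho>. (y - x) \<bullet> \<nu> - f y < 0}"
    proof -
      have "continuous_on (ball x \<rho>) (\<lambda>y. (y - x) \<bullet> \<nu> - f y)"
        by (intro continuous_intros contf)
      then have "open (ball x \<rho> \<inter> (\<lambda>y. (y - x) \<bullet> \<nu> - f y) -` {..<0})"
        by (rule continuous_open_preimage) auto
      moreover have "ball x \<rho> \<inter> (\<lambda>y. (y - x) \<bullet> \<nu> - f y) -` {..<0} = {y \<in> ball x \<rho>. (y - x) \<bullet> \<nu> - f y < 0}"
        by auto
      ultimately show ?thesis by simp
    qed
    moreover have "{y \<in> ball x \<rho>. (y - x) \<bullet> \<nu> - f y < 0} \<subseteq> E"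
      using mem by fastforce
    moreover have "a \<in> {y \<in> ball x \<rho>. (y - x) \<bullet> \<nu> - f y < 0}"
      using a \<open>(a - x) \<bullet> \<nu> < f a\<close> by simp
    ultimately show False using nint by (meson interiorI)
  qed
  then show ?thesis using mem[OF a] E by simp
qed

text \<open>Constancy of \<open>f\<close> on short segments along \<nu>. It yields a nonzero
  gradient of (y - x) \<bullet> \<nu> - f y, and, differentiated once more, a Hessian that vanishes
  in the direction \<nu>.\<close>

lemma local_subgraph_deriv_normal:
  assumes loc: "local_subgraph E x \<nu> \<rho> f f' f''" and y: "y \<in> ball x \<rho>"
  shows "f' y \<nu> = 0"
proof -
  have \<nu>: "norm \<nu> = 1"
    and const: "\<And>y t. y \<in> ball x \<rho> \<Longrightarrow> y + t *\<^sub>R \<nu> \<in> ball x \<rho> \<Longrightarrow> f (y + t *\<^sub>R \<nu>) = f y"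
    and df: "\<And>y. y \<in> ball x \<rho> \<Longrightarrow> (f has_derivative blinfun_apply (f' y)) (at y)"
    using loc by (auto simp: local_subgraph_def C2_on_with_def)
  obtain e where e: "e > 0" "ball y e \<subseteq> ball x \<rho>"
    using open_contains_ball[of "ball x \<rho>"] y by (meson open_ball)
  have "((\<lambda>t::real. f (y + t *\<^sub>R \<nu>)) has_derivative (\<lambda>t. f' y (t *\<^sub>R \<nu>))) (at 0)"
    by (rule has_derivative_compose[of "\<lambda>t. y + t *\<^sub>R \<nu>" "\<lambda>t. t *\<^sub>R \<nu>" 0 UNIV f])
      (use df[OF y] in \<open>auto intro!: derivative_eq_intros\<close>)
  moreover have "((\<lambda>t::real. f (y + t *\<^sub>R \<nu>)) has_derivative (\<lambda>t. 0)) (at 0)"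
  proof (rule has_derivative_transform_within_open[of "\<lambda>_. f y" _ _ _ "ball 0 e"])
    show "f y = f (y + t *\<^sub>R \<nu>)" if "t \<in> ball 0 e" for t
      using that e \<nu> y by (intro const[symmetric] subsetD[OF e(2)]) (auto simp: dist_norm)
  qed (use e in auto)
  ultimately have "(\<lambda>t::real. f' y (t *\<^sub>R \<nu>)) = (\<lambda>t. 0)" by (rule has_derivative_unique)
  then have "f' y (1 *\<^sub>R \<nu>) = 0" by metis
  then show ?thesis by simp
qed

text \<open>Let \<Psi> be the inverse of the diffeomorphism and a = \<Psi> x, a boundary point of
  \<open>E\<close> near \<open>x\<close>. In the shifted variable \<open>z\<close> the set is the
  sublevel set of \<open>G\<close>, the defining function of \<open>E\<close> composed with \<Psi>,
  and \<open>G\<close> vanishes at 0. Its gradient \<open>p\<close> there is close to \<nu>, its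
  quadratic part close to that of - f, and division by |p| makes the normal a unit vector. The
  radius \<delta> depends on the chart and on \<eta> but not on \<open>r\<close>.\<close>

lemma local_quadratic_form:
  fixes E :: "'a::euclidean_space set" and Er :: "real \<Rightarrow> 'a set"
  assumes loc: "local_subgraph E x \<nu> \<rho> f f' f''" and f'x: "f' x = 0"
    and conv: "converges_C Er E"
    and closed: "\<And>r. r > 0 \<Longrightarrow> closed (Er r)"
    and front: "\<And>r. r > 0 \<Longrightarrow> x \<in> frontier (Er r)"
    and \<eta>: "\<eta> > 0"
  shows "\<exists>\<delta>>0. \<forall>\<^sub>F r in at_right 0. \<exists>n h. norm n = 1 \<and> norm (n - \<nu>) \<le> \<eta> \<and>
    (\<forall>z. norm z \<le> \<delta> \<longrightarrow> (x + z \<in> Er r \<longleftrightarrow> z \<bullet> n + h z \<le> 0) \<and> \<bar>h z + f'' x z z / 2\<bar> \<le> \<eta> * (norm z)\<^sup>2)"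
proof -
  have \<nu>: "norm \<nu> = 1" and \<rho>: "\<rho> > 0" and C2: "C2_on_with (ball x \<rho>) f f' f''"
    and mem: "\<And>y. y \<in> ball x \<rho> \<Longrightarrow> y \<in> E \<longleftrightarrow> (y - x) \<bullet> \<nu> \<le> f y"
    using loc by (auto simp: local_subgraph_def)
  define C where "C = norm (f'' x)"
  have C: "C \<ge> 0" by (simp add: C_def)
  \<comment> \<open>The final estimate collects (20 + 5 C) \<mu>, and dividing by |p| \<ge> 1/2
    doubles it. The bound 1/8 guarantees |p| \<ge> 1/2, since |p| differs from 1 by at most 4
    \<mu>.\<close>
  define \<mu> where "\<mu> = min (1/8) (\<eta> / (40 + 10 * C))"
  have \<mu>: "\<mu> > 0" "\<mu> \<le> 1/8" "\<mu> * (40 + 10 * C) \<le> \<eta>"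
  proof -
    have "\<mu> \<le> \<eta> / (40 + 10 * C)" by (simp add: \<mu>_def)
    then show "\<mu> * (40 + 10 * C) \<le> \<eta>" using C by (subst (asm) pos_le_divide_eq) auto
    show "\<mu> \<le> 1/8" unfolding \<mu>_def by (rule min.cobounded1)
  qed (use \<eta> C in \<open>auto simp: \<mu>_def\<close>)
  obtain \<delta>1 where \<delta>1: "0 < \<delta>1" "\<delta>1 \<le> \<rho>" and taylor: "\<And>a y. a \<in> ball x \<delta>1 \<Longrightarrow> y \<in> ball x \<delta>1 \<Longrightarrow>
      \<bar>f y - f a - f' a (y - a) - f'' x (y - a) (y - a) / 2\<bar> \<le> \<mu> * (norm (y - a))\<^sup>2"
    using C2_taylor[OF C2 \<rho> \<mu>(1)] by blast
  have "continuous (at x) f'"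
    using C2 \<rho> by (auto simp: C2_on_with_def intro: has_derivative_continuous)
  then obtain \<delta>2 where "\<delta>2 > 0" "\<forall>y. dist y x < \<delta>2 \<longrightarrow> dist (f' y) (f' x) < \<mu>"
    using \<mu>(1) unfolding continuous_at_eps_delta by blast
  then have \<delta>2: "\<delta>2 > 0" "\<And>y. dist y x < \<delta>2 \<Longrightarrow> norm (f' y) < \<mu>"
    by (auto simp: f'x)
  define \<delta> where "\<delta> = \<delta>1 / 2"
  obtain \<Phi> D D2 where "(\<forall>r>0. C2_diffeo_with (\<Phi> r) (D r) (D2 r) \<and> \<Phi> r ` E = Er r) \<and>
        (\<forall>\<epsilon>>0. \<forall>\<^sub>F r in at_right 0. \<forall>y. norm (\<Phi> r y - y) \<le> \<epsilon> \<and>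
          norm (D r y - id_blinfun) \<le> \<epsilon> \<and> norm (D2 r y) \<le> \<epsilon>)"
    using conv unfolding converges_C_def by (elim exE) (rule that)
  then have diffeo: "\<And>r. r > 0 \<Longrightarrow> C2_diffeo_with (\<Phi> r) (D r) (D2 r) \<and> \<Phi> r ` E = Er r"
    and small: "\<And>\<epsilon>. \<epsilon> > 0 \<Longrightarrow> \<forall>\<^sub>F r in at_right 0. \<forall>y. norm (\<Phi> r y - y) \<le> \<epsilon> \<and>
         norm (D r y - id_blinfun) \<le> \<epsilon> \<and> norm (D2 r y) \<le> \<epsilon>"
    by auto
  \<comment> \<open>The three bounds make the diffeomorphism errors at most \<mu>, keep the
    preimages of points at distance up to \<delta>1 / 2 inside the Taylor ball, and keep
    \<open>a\<close> where \<open>f'\<close> is small.\<close>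
  define \<epsilon> where "\<epsilon> = min \<mu> (min (\<delta>1 / 4) (\<delta>2 / 2))"
  have \<epsilon>: "\<epsilon> > 0" "\<epsilon> \<le> \<mu>" "\<epsilon> < \<delta>1 / 2" "\<epsilon> < \<delta>2" "\<epsilon> \<le> 1/8"
    using \<mu> \<delta>1 \<delta>2 by (auto simp: \<epsilon>_def)
  have ev0: "\<forall>\<^sub>F r in at_right (0::real). 0 < r"
    by (simp add: eventually_at_right_less)
  have "\<forall>\<^sub>F r in at_right 0. \<exists>n h. norm n = 1 \<and> norm (n - \<nu>) \<le> \<eta> \<and>
    (\<forall>z. norm z \<le> \<delta> \<longrightarrow> (x + z \<in> Er r \<longleftrightarrow> z \<bullet> n + h z \<le> 0) \<and> \<bar>h z + f'' x z z / 2\<bar> \<le> \<eta> * (norm z)\<^sup>2)"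
    using small[OF \<epsilon>(1)] ev0
  proof eventually_elim
    case (elim r)
    have dif: "C2_diffeo_with (\<Phi> r) (D r) (D2 r)" and img: "\<Phi> r ` E = Er r"
      using diffeo[of r] elim by auto
    have bij: "bij (\<Phi> r)" and bijD: "\<And>y. bij (blinfun_apply (D r y))"
      using dif by (auto simp: C2_diffeo_with_def)
    define \<Psi> where "\<Psi> = inv (\<Phi> r)"
    have \<Phi>\<Psi>: "\<Phi> r (\<Psi> y) = y" for y using bij by (simp add: \<Psi>_def bij_is_surj surj_f_inv_f)
    have memEr: "y \<in> Er r \<longleftrightarrow> \<Psi> y \<in> E" for y
      using bij \<Phi>\<Psi> unfolding img[symmetric] by (metis \<Psi>_def bij_inv_eq_iff image_iff)
    have near: "norm (\<Psi> y - y) \<le> \<epsilon>" for y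
      using elim \<Phi>\<Psi>[of y] by (metis norm_minus_commute)
    note est = near_identity_estimates[OF dif, of \<epsilon>]
    have est1: "norm (\<Phi> r y - \<Phi> r b - (y - b)) \<le> \<epsilon> * norm (y - b)" for y b
      by (rule est(1)) (use elim in auto)
    have est2: "norm (\<Phi> r y - \<Phi> r b - D r b (y - b)) \<le> \<epsilon> * (norm (y - b))\<^sup>2" for y b
      by (rule est(2)) (use elim in auto)
    define a where "a = \<Psi> x"
    \<comment> \<open>The displacement of the preimage from \<open>a\<close>. It differs from
      \<open>z\<close> by at most \<epsilon> |\<zeta>|; absorbing this error gives |\<zeta>| \<le> 2
      |z|.\<close>
    define \<zeta> where "\<zeta> z = \<Psi> (x + z) - a" for z
    have z\<zeta>: "norm (z - \<zeta> z) \<le> \<epsilon> * norm (\<zeta> z)" for z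
      using est1[of "\<Psi> (x + z)" a] by (simp add: \<Phi>\<Psi> a_def \<zeta>_def)
    have \<zeta>2: "norm (\<zeta> z) \<le> 2 * norm z" for z
    proof -
      have "norm (\<zeta> z) \<le> norm z + norm (z - \<zeta> z)" using norm_triangle_ineq4[of z "z - \<zeta> z"] by simp
      moreover have "\<epsilon> * norm (\<zeta> z) \<le> (1/8) * norm (\<zeta> z)" using \<epsilon> by (intro mult_right_mono) auto
      ultimately show ?thesis using z\<zeta>[of z] norm_ge_zero[of z] by linarith
    qed
    have \<zeta>z: "norm (\<zeta> z - z) \<le> 2 * \<epsilon> * norm z" for z
    proof -
      have "\<epsilon> * norm (\<zeta> z) \<le> \<epsilon> * (2 * norm z)" using \<epsilon> \<zeta>2 by (intro mult_left_mono) auto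
      then show ?thesis using z\<zeta>[of z] by (simp add: norm_minus_commute)
    qed
    have ax: "norm (a - x) \<le> \<epsilon>" unfolding a_def by (rule near)
    have a1: "a \<in> ball x \<delta>1" using ax \<epsilon> \<delta>1 by (simp add: dist_norm norm_minus_commute)
    then have a\<rho>: "a \<in> ball x \<rho>" using \<delta>1 by simp
    have f'a: "norm (f' a) \<le> \<mu>" using \<delta>2(2)[of a] ax \<epsilon> by (simp add: dist_norm)
    have Ga: "(a - x) \<bullet> \<nu> = f a"
    proof (rule local_subgraph_zero[OF loc a\<rho>])
      have xr: "x \<in> Er r" using front[of r] closed[of r] elim by (simp add: frontier_def)
      then show "a \<in> E" using memEr[of x] by (simp add: a_def)
      show "a \<notin> interior E"
      proof
        assume "a \<in> interior E"
        then obtain e where e: "e > 0" "ball a e \<subseteq> E" by (meson mem_interior)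
        \<comment> \<open>Half the radius suffices because \<Psi> at most doubles distances to
          \<open>x\<close>.\<close>
        have "ball x (e/2) \<subseteq> Er r"
        proof
          fix y assume "y \<in> ball x (e/2)"
          then have "norm (y - x) < e / 2" by (simp add: dist_norm norm_minus_commute)
          moreover have "norm (\<Psi> y - a) \<le> 2 * norm (y - x)" using \<zeta>2[of "y - x"] by (simp add: \<zeta>_def)
          ultimately have "\<Psi> y \<in> ball a e" by (simp add: dist_norm norm_minus_commute)
          then show "y \<in> Er r" using e memEr by auto
        qed
        then have "x \<in> interior (Er r)" using e by (meson mem_interior half_gt_zero)
        then show False using front[of r] elim by (simp add: frontier_def)
      qed
    qed
    \<comment> \<open>\<open>Li\<close> is the derivative of \<Psi> at \<open>x\<close>, and
      \<open>l\<close> below is the derivative of the defining function at \<open>a\<close>; hence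
      \<open>l \<circ> Li\<close> is the derivative of \<open>G\<close> at 0, represented by the
      vector \<open>p\<close>.\<close>
    define Li where "Li = inv (blinfun_apply (D r a))"
    have DLi: "D r a (Li v) = v" for v using bijD[of a] by (simp add: Li_def bij_is_surj surj_f_inv_f)
    have LiD: "Li (D r a v) = v" for v using bijD[of a] by (simp add: Li_def bij_is_inj)
    have linLi: "linear Li"
    proof (rule linearI)
      fix u v and c :: real
      have "D r a (Li u + Li v) = u + v" by (simp add: blinfun.add_right DLi)
      then show "Li (u + v) = Li u + Li v" by (metis LiD)
      have "D r a (c *\<^sub>R Li u) = c *\<^sub>R u" by (simp add: blinfun.scaleR_right DLi)
      then show "Li (c *\<^sub>R u) = c *\<^sub>R Li u" by (metis LiD)
    qed
    have Liv: "norm (v - Li v) \<le> \<epsilon> * norm (Li v)" for v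
    proof -
      have "norm ((D r a - id_blinfun) (Li v)) \<le> norm (D r a - id_blinfun) * norm (Li v)" by (rule norm_blinfun)
      also have "\<dots> \<le> \<epsilon> * norm (Li v)" using elim by (intro mult_right_mono) auto
      finally show ?thesis by (simp add: blinfun.diff_left DLi)
    qed
    have Li2: "norm (Li v) \<le> 2 * norm v" for v
    proof -
      have "norm (Li v) \<le> norm v + norm (v - Li v)" using norm_triangle_ineq4[of v "v - Li v"] by simp
      moreover have "\<epsilon> * norm (Li v) \<le> (1/8) * norm (Li v)" using \<epsilon> by (intro mult_right_mono) auto
      ultimately show ?thesis using Liv[of v] norm_ge_zero[of v] by linarith
    qed
    have LivV: "norm (Li v - v) \<le> 2 * \<epsilon> * norm v" for v
    proof -
      have "\<epsilon> * norm (Li v) \<le> \<epsilon> * (2 * norm v)" using \<epsilon> Li2 by (intro mult_left_mono) auto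
      then show ?thesis using Liv[of v] by (simp add: norm_minus_commute)
    qed
    define l where "l v = v \<bullet> \<nu> - f' a v" for v
    have linl: "linear l" unfolding l_def
      by (intro linearI) (auto simp: inner_add_left blinfun.add_right blinfun.scaleR_right algebra_simps)
    have f'ab: "\<bar>f' a v\<bar> \<le> \<mu> * norm v" for v
      using norm_blinfun[of "f' a" v] mult_right_mono[OF f'a, of "norm v"] by simp
    have lb: "\<bar>l v\<bar> \<le> 2 * norm v" for v
    proof -
      have "\<bar>v \<bullet> \<nu>\<bar> \<le> norm v" using Cauchy_Schwarz_ineq2[of v \<nu>] \<nu> by simp
      moreover have "\<mu> * norm v \<le> 1 * norm v" using \<mu> by (intro mult_right_mono) auto
      ultimately show ?thesis using f'ab[of v] unfolding l_def by linarith
    qed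
    obtain p where p: "\<And>v. l (Li v) = p \<bullet> v"
      using linear_functional_inner[of "l \<circ> Li"] linear_compose[OF linLi linl] by auto
    have p\<nu>: "norm (p - \<nu>) \<le> 4 * \<mu>"
    proof -
      let ?v = "p - \<nu>"
      have "(norm ?v)\<^sup>2 = l (Li ?v) - \<nu> \<bullet> ?v" unfolding p by (simp add: power2_norm_eq_inner inner_diff_left)
      also have "\<dots> = (Li ?v - ?v) \<bullet> \<nu> - f' a (Li ?v)" by (simp add: l_def inner_diff_left inner_diff_right inner_commute)
      also have "\<dots> \<le> norm (Li ?v - ?v) + \<mu> * norm (Li ?v)"
        using Cauchy_Schwarz_ineq2[of "Li ?v - ?v" \<nu>] f'ab[of "Li ?v"] \<nu> by (simp add: abs_le_iff)
      also have "\<dots> \<le> 2 * \<mu> * norm ?v + \<mu> * (2 * norm ?v)"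
      proof (rule add_mono)
        have "2 * \<epsilon> * norm ?v \<le> 2 * \<mu> * norm ?v" using \<epsilon> by (intro mult_right_mono) auto
        then show "norm (Li ?v - ?v) \<le> 2 * \<mu> * norm ?v" using LivV[of ?v] by linarith
        show "\<mu> * norm (Li ?v) \<le> \<mu> * (2 * norm ?v)" using Li2 \<mu> by (intro mult_left_mono) auto
      qed
      finally have "norm ?v * norm ?v \<le> (4 * \<mu>) * norm ?v" by (simp add: power2_eq_square algebra_simps)
      then show ?thesis using \<mu> by (cases "norm ?v = 0") (auto simp: mult_le_cancel_right)
    qed
    have np: "\<bar>norm p - 1\<bar> \<le> 4 * \<mu>" using norm_triangle_ineq3[of p \<nu>] p\<nu> \<nu> by simp
    then have np2: "norm p \<ge> 1/2" using \<mu> by linarith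
    define n where "n = (1 / norm p) *\<^sub>R p"
    have n: "norm n = 1" using np2 by (auto simp: n_def)
    have pn: "p = norm p *\<^sub>R n" using np2 by (auto simp: n_def)
    have "norm (n - p) = \<bar>norm p - 1\<bar>"
    proof -
      have "n - p = (1 - norm p) *\<^sub>R n" using pn by (metis scaleR_left_diff_distrib scaleR_one)
      then show ?thesis using n by (simp add: abs_minus_commute)
    qed
    then have "norm (n - \<nu>) \<le> 8 * \<mu>" using norm_triangle_ineq[of "n - p" "p - \<nu>"] np p\<nu> by simp
    also have "\<dots> \<le> \<mu> * (40 + 10 * C)" using mult_nonneg_nonneg[of \<mu> C] \<mu> C by (simp add: algebra_simps)
    also have "\<dots> \<le> \<eta>" by (rule \<mu>(3))
    finally have n\<nu>: "norm (n - \<nu>) \<le> \<eta>" .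
    define G where "G z = (\<Psi> (x + z) - x) \<bullet> \<nu> - f (\<Psi> (x + z))" for z
    \<comment> \<open>Everything in \<open>G\<close> beyond its linear part, rescaled. Only the size
      of \<open>h\<close> against the quadratic form is used, so no second derivative of \<Psi> is
      computed.\<close>
    define h where "h z = (G z - p \<bullet> z) / norm p" for z
    have main: "(x + z \<in> Er r \<longleftrightarrow> z \<bullet> n + h z \<le> 0) \<and> \<bar>h z + f'' x z z / 2\<bar> \<le> \<eta> * (norm z)\<^sup>2" if z: "norm z \<le> \<delta>" for z
    proof
      have "norm (\<Psi> (x + z) - x) \<le> \<epsilon> + norm z"
        using norm_triangle_ineq[of "\<Psi> (x + z) - (x + z)" z] near[of "x + z"] by simp
      then have Y: "\<Psi> (x + z) \<in> ball x \<delta>1"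
        using z \<epsilon> by (simp add: \<delta>_def dist_norm norm_minus_commute)
      have "z \<bullet> n + h z = G z / norm p"
        by (simp add: h_def n_def inner_commute add_divide_distrib[symmetric])
      then have "z \<bullet> n + h z \<le> 0 \<longleftrightarrow> G z \<le> 0"
        using np2 by (auto simp: divide_le_0_iff)
      moreover have "x + z \<in> Er r \<longleftrightarrow> G z \<le> 0"
        using memEr mem[of "\<Psi> (x + z)"] Y \<delta>1 by (simp add: G_def)
      ultimately show "x + z \<in> Er r \<longleftrightarrow> z \<bullet> n + h z \<le> 0" by simp
      let ?\<zeta> = "\<zeta> z" and ?N = "(norm z)\<^sup>2"
      define e1 where "e1 = f (\<Psi> (x + z)) - f a - f' a ?\<zeta> - f'' x ?\<zeta> ?\<zeta> / 2"
      have \<zeta>sq: "(norm ?\<zeta>)\<^sup>2 \<le> 4 * ?N"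
        using power_mono[OF \<zeta>2[of z], of 2] by (simp add: power_mult_distrib)
      have "\<bar>e1\<bar> \<le> \<mu> * (norm ?\<zeta>)\<^sup>2" using taylor[OF a1 Y] by (simp add: e1_def \<zeta>_def)
      also have "\<dots> \<le> \<mu> * (4 * ?N)" using \<zeta>sq \<mu> by (intro mult_left_mono) auto
      finally have e1: "\<bar>e1\<bar> \<le> 4 * \<mu> * ?N" by simp
      have G: "G z = l ?\<zeta> - f'' x ?\<zeta> ?\<zeta> / 2 - e1"
        using Ga unfolding G_def e1_def l_def \<zeta>_def by (simp add: inner_diff_left)
      \<comment> \<open>The error of linearising \<Psi> at \<open>x\<close> is obtained from that of
        the forward map at \<open>a\<close>, by applying \<open>Li\<close>.\<close>
      have "norm (?\<zeta> - Li z) = norm (Li (D r a ?\<zeta> - z))"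
        by (simp add: linear_diff[OF linLi] LiD)
      also have "\<dots> \<le> 2 * norm (z - D r a ?\<zeta>)" using Li2[of "D r a ?\<zeta> - z"] by (simp add: norm_minus_commute)
      also have "\<dots> \<le> 2 * (\<epsilon> * (norm ?\<zeta>)\<^sup>2)"
        using est2[of "\<Psi> (x + z)" a] by (simp add: \<Phi>\<Psi> a_def \<zeta>_def)
      also have "\<dots> \<le> 2 * (\<mu> * (4 * ?N))" using \<zeta>sq \<mu> \<epsilon> by (intro mult_left_mono mult_mono) auto
      finally have e2: "\<bar>l (?\<zeta> - Li z)\<bar> \<le> 16 * \<mu> * ?N" using lb[of "?\<zeta> - Li z"] by simp
      have bil: "\<bar>f'' x u v\<bar> \<le> C * norm u * norm v" for u v
        by (rule bilinear_bound) (simp add: C_def)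
      have "f'' x ?\<zeta> ?\<zeta> - f'' x z z = f'' x (?\<zeta> - z) ?\<zeta> + f'' x z (?\<zeta> - z)"
        by (simp add: blinfun.diff_left blinfun.diff_right)
      also have "\<bar>\<dots>\<bar> \<le> C * norm (?\<zeta> - z) * norm ?\<zeta> + C * norm z * norm (?\<zeta> - z)"
        using bil[of "?\<zeta> - z" ?\<zeta>] bil[of z "?\<zeta> - z"] by linarith
      also have "\<dots> \<le> C * (2 * \<mu> * norm z) * (2 * norm z) + C * norm z * (2 * \<mu> * norm z)"
      proof -
        have "2 * \<epsilon> * norm z \<le> 2 * \<mu> * norm z" using \<epsilon> by (intro mult_right_mono) auto
        then have k: "norm (?\<zeta> - z) \<le> 2 * \<mu> * norm z" using \<zeta>z[of z] by linarith
        show ?thesis using k \<zeta>2[of z] C \<mu> by (intro add_mono mult_mono) auto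
      qed
      also have "\<dots> = 6 * C * \<mu> * ?N" by (simp add: power2_eq_square algebra_simps)
      finally have e3: "\<bar>f'' x ?\<zeta> ?\<zeta> - f'' x z z\<bar> \<le> 6 * C * \<mu> * ?N" .
      have "G z - p \<bullet> z + f'' x z z / 2 = l (?\<zeta> - Li z) - (f'' x ?\<zeta> ?\<zeta> - f'' x z z) / 2 - e1"
        unfolding G p[symmetric] by (simp add: linear_diff[OF linl] diff_divide_distrib)
      then have e4: "\<bar>G z - p \<bullet> z + f'' x z z / 2\<bar> \<le> 16 * \<mu> * ?N + 3 * C * \<mu> * ?N + 4 * \<mu> * ?N"
      proof -
        have arith: "\<bar>u\<bar> \<le> 16 * k + 3 * j + 4 * k"
          if "u = v - w / 2 - e" "\<bar>e\<bar> \<le> 4 * k" "\<bar>v\<bar> \<le> 16 * k" "\<bar>w\<bar> \<le> 6 * j" for u v w e k j :: real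
          using that by linarith
        assume "G z - p \<bullet> z + f'' x z z / 2 = l (?\<zeta> - Li z) - (f'' x ?\<zeta> ?\<zeta> - f'' x z z) / 2 - e1"
        from arith[OF this, of "\<mu> * ?N" "C * \<mu> * ?N"] e1 e2 e3 show ?thesis
          by (simp add: mult.assoc)
      qed
      have "norm p * (h z + f'' x z z / 2) = (G z - p \<bullet> z + f'' x z z / 2) + (norm p - 1) * (f'' x z z / 2)"
      proof -
        have "norm p * h z = G z - p \<bullet> z" using np2 by (auto simp: h_def)
        then show ?thesis unfolding distrib_left left_diff_distrib by simp
      qed
      then have "norm p * \<bar>h z + f'' x z z / 2\<bar> = \<bar>(G z - p \<bullet> z + f'' x z z / 2) + (norm p - 1) * (f'' x z z / 2)\<bar>"
        by (metis abs_mult abs_norm_cancel)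
      also have "\<dots> \<le> \<bar>G z - p \<bullet> z + f'' x z z / 2\<bar> + \<bar>norm p - 1\<bar> * \<bar>f'' x z z / 2\<bar>"
        using abs_triangle_ineq abs_mult by metis
      also have "\<bar>norm p - 1\<bar> * \<bar>f'' x z z / 2\<bar> \<le> 4 * \<mu> * (C * norm z * norm z / 2)"
        using np bil[of z z] \<mu> by (intro mult_mono) auto
      finally have "norm p * \<bar>h z + f'' x z z / 2\<bar> \<le> 16 * \<mu> * ?N + 3 * C * \<mu> * ?N + 4 * \<mu> * ?N + 4 * \<mu> * (C * norm z * norm z / 2)"
        using e4 by linarith
      also have "\<dots> = \<mu> * (40 + 10 * C) / 2 * ?N" by (simp add: power2_eq_square algebra_simps)
      also have "\<dots> \<le> \<eta> / 2 * ?N" using \<mu> by (intro mult_right_mono) auto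
      finally have "norm p * \<bar>h z + f'' x z z / 2\<bar> \<le> \<eta> / 2 * ?N" .
      moreover have "1/2 * \<bar>h z + f'' x z z / 2\<bar> \<le> norm p * \<bar>h z + f'' x z z / 2\<bar>"
        using np2 by (intro mult_right_mono) auto
      ultimately have "1/2 * \<bar>h z + f'' x z z / 2\<bar> \<le> \<eta> / 2 * ?N" by (rule order_trans[rotated])
      then show "\<bar>h z + f'' x z z / 2\<bar> \<le> \<eta> * ?N" by simp
    qed
    show ?case using n n\<nu> main by blast
  qed
  then show ?thesis using \<delta>1 by (intro exI[of _ \<delta>]) (auto simp: \<delta>_def)
qed

section \<open>Graph representation over the tangent hyperplane\<close>

text \<open>The given \<nu> may be tilted against the true normal \<open>n\<close>, the normalised
  gradient of G y = (y - x) \<bullet> \<nu> - f y at \<open>x\<close>. The inverse function theorem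
  for a map that straightens the level sets of \<open>G\<close> finds, on each line parallel to
  \<open>n\<close>, the boundary point \<open>P y\<close>, whose height is the new graph function
  \<open>F\<close>. Second derivatives come from differentiating the formula of implicit
  differentiation.\<close>

lemma normal_graph_exists:
  fixes E :: "'a::euclidean_space set"
  assumes loc: "local_subgraph E x \<nu> \<rho> f f' f''" and fx: "f x = 0"
  shows "\<exists>\<nu>' \<rho>' F F' F''. local_subgraph E x \<nu>' \<rho>' F F' F'' \<and> F x = 0 \<and> F' x = 0"
proof -
  have \<nu>: "norm \<nu> = 1" and \<rho>: "\<rho> > 0"
    and mem: "\<And>y. y \<in> ball x \<rho> \<Longrightarrow> y \<in> E \<longleftrightarrow> (y - x) \<bullet> \<nu> \<le> f y"
    and df: "\<And>y. y \<in> ball x \<rho> \<Longrightarrow> (f has_derivative blinfun_apply (f' y)) (at y)"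
    and df': "\<And>y. y \<in> ball x \<rho> \<Longrightarrow> (f' has_derivative blinfun_apply (f'' y)) (at y)"
    and cf'': "continuous_on (ball x \<rho>) f''"
    using loc by (auto simp: local_subgraph_def C2_on_with_def)
  define U where "U = ball x \<rho>"
  have U: "open U" "x \<in> U" using \<rho> by (auto simp: U_def)
  define G where "G y = (y - x) \<bullet> \<nu> - f y" for y
  define G' where "G' y = blinfun_inner_left \<nu> - f' y" for y
  define G'' where "G'' y = - f'' y" for y
  have dG: "(G has_derivative blinfun_apply (G' y)) (at y)" if "y \<in> U" for y
    unfolding G_def[abs_def] G'_def
    by (auto intro!: derivative_eq_intros df[OF that[unfolded U_def]] simp: blinfun.diff_left inner_commute)
  have dG': "(G' has_derivative blinfun_apply (G'' y)) (at y)" if "y \<in> U" for y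
    unfolding G'_def[abs_def] G''_def
    by (auto intro!: derivative_eq_intros df'[OF that[unfolded U_def]] simp: blinfun.minus_left)
  have cG'': "continuous_on U G''" unfolding G''_def U_def by (intro continuous_intros cf'')
  have cG': "continuous_on U G'"
    by (meson continuous_at_imp_continuous_on dG' has_derivative_continuous)
  have Gx: "G x = 0" by (simp add: G_def fx)
  have f'\<nu>: "f' x \<nu> = 0"
    using local_subgraph_deriv_normal[OF loc] \<rho> by simp
  obtain m where m: "\<And>v. G' x v = m \<bullet> v"
    using linear_functional_inner[of "blinfun_apply (G' x)"] blinfun.bounded_linear_right bounded_linear.linear by blast
  have "G' x \<nu> = 1" using \<nu> f'\<nu> by (simp add: G'_def blinfun.diff_left norm_eq_1)
  then have m0: "m \<noteq> 0" using m[of \<nu>] by auto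
  define k where "k = norm m"
  define n where "n = (1 / k) *\<^sub>R m"
  have k: "k > 0" using m0 by (simp add: k_def)
  have n: "norm n = 1" using m0 by (simp add: n_def k_def)
  have G'x: "G' x v = k * (v \<bullet> n)" for v using k by (simp add: m n_def inner_commute)
  define W where "W = Blinfun (perp n)"
  have W: "blinfun_apply W = perp n"
    unfolding W_def by (rule bounded_linear_Blinfun_apply) (simp add: linear_perp linear_conv_bounded_linear[symmetric])
  have Wn: "perp n n = 0" using n by (simp add: perp_def norm_eq_1)
  \<comment> \<open>Keeps the coordinates orthogonal to \<open>n\<close> and uses \<open>G\<close>
    as the coordinate along \<open>n\<close>, so the zero set of \<open>G\<close> becomes
    flat.\<close>
  define T where "T z = x + perp n (z - x) + G z *\<^sub>R n" for z
  define T' where "T' z = W + (blinfun_scaleR_left n o\<^sub>L G' z)" for z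
  have T': "blinfun_apply (T' z) v = perp n v + G' z v *\<^sub>R n" for z v
    by (simp add: T'_def W blinfun.add_left)
  have dperp: "(perp n has_derivative perp n) F" for F
    by (metis W bounded_linear_imp_has_derivative blinfun.bounded_linear_right)
  have dT: "(T has_derivative blinfun_apply (T' z)) (at z)" if "z \<in> U" for z
  proof -
    have "((\<lambda>z. perp n (z - x)) has_derivative perp n) (at z)"
      by (rule has_derivative_compose[of "\<lambda>z. z - x" "\<lambda>h. h" z UNIV "perp n", OF _ dperp])
        (auto intro!: derivative_eq_intros)
    then show ?thesis unfolding T_def[abs_def] 
      by (auto intro!: derivative_eq_intros dG[OF that] simp: T')
  qed
  have cT': "continuous_on U T'" unfolding T'_def by (intro continuous_intros cG')
  \<comment> \<open>At \<open>x\<close> the derivative of \<open>T\<close> is the identity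
    orthogonally to \<open>n\<close> and multiplication by \<open>k\<close> along \<open>n\<close>;
    this is its inverse.\<close>
  define Ti where "Ti = W + (1/k) *\<^sub>R (blinfun_scaleR_left n o\<^sub>L blinfun_inner_left n)"
  have "Ti (T' x v) = v" for v
  proof -
    have "perp n (perp n v + c *\<^sub>R n) = perp n v" "(perp n v + c *\<^sub>R n) \<bullet> n = c" for c using n by simp_all
    then show ?thesis
      using k by (simp add: Ti_def W blinfun.add_left blinfun.scaleR_left T' G'x inner_commute[of n] perp_add_inner)
  qed
  then have inv: "Ti o\<^sub>L T' x = id_blinfun" by (intro blinfun_eqI) simp
  have Tx: "T x = x" by (simp add: T_def Gx perp_def)
  obtain U' V S S' where U': "open U'" "U' \<subseteq> U" "x \<in> U'" and V: "open V" "T x \<in> V"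
    and hom: "homeomorphism U' V T S" and dS: "\<And>y. y \<in> V \<Longrightarrow> (S has_derivative S' y) (at y)"
    using inverse_function_theorem[OF U(1) dT cT' U(2) inv] by metis
  have xV: "x \<in> V" using V Tx by simp
  have TS: "T (S y) = y" "S y \<in> U'" if "y \<in> V" for y
    using hom that by (auto simp: homeomorphism_def)
  have Sx: "S x = x" using hom U'(3) Tx by (metis homeomorphism_apply1)
  define \<pi> where "\<pi> y = x + perp n (y - x)" for y
  define P where "P y = S (\<pi> y)" for y
  define F where "F y = (P y - x) \<bullet> n" for y
  have \<pi>x: "\<pi> x = x" by (simp add: \<pi>_def perp_def)
  have d\<pi>: "(\<pi> has_derivative perp n) (at y)" for y
  proof -
    have "((\<lambda>z. perp n (z - x)) has_derivative perp n) (at y)"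
      by (rule has_derivative_compose[of "\<lambda>z. z - x" "\<lambda>h. h" y UNIV "perp n", OF _ dperp])
        (auto intro!: derivative_eq_intros)
    then show ?thesis unfolding \<pi>_def[abs_def] by (auto intro!: derivative_eq_intros)
  qed
  have c\<pi>: "continuous_on UNIV \<pi>" unfolding \<pi>_def by (intro continuous_intros)
  \<comment> \<open>\<open>T (P y)\<close> equals \<open>\<pi> y\<close>, which has no component
    along \<open>n\<close> relative to \<open>x\<close>. Hence \<open>G\<close> vanishes at
    \<open>P y\<close>, and \<open>P y\<close> lies on the line through \<open>y\<close>.\<close>
  have GP: "G (P y) = 0" and Pperp: "perp n (P y - x) = perp n (y - x)" if "\<pi> y \<in> V" for y
  proof -
    have eq: "perp n (P y - x) + G (P y) *\<^sub>R n = perp n (y - x)"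
      using TS(1)[OF that] by (simp add: P_def T_def \<pi>_def)
    from arg_cong[OF this, of "\<lambda>v. v \<bullet> n"] show "G (P y) = 0" using n by simp
    with eq show "perp n (P y - x) = perp n (y - x)" by simp
  qed
  have P: "P y = x + perp n (y - x) + F y *\<^sub>R n" if "\<pi> y \<in> V" for y
    using Pperp[OF that] perp_add_inner[of n "P y - x"] by (simp add: F_def algebra_simps)
  have "continuous (at x) (\<lambda>z. G' z n)"
    using cG' U by (intro continuous_intros) (simp add: continuous_on_eq_continuous_at)
  then have "\<forall>\<^sub>F z in at x. G' z n > 0"
    using G'x[of n] k n by (intro order_tendstoD) (auto simp: continuous_within norm_eq_1)
  then obtain \<rho>1 where \<rho>1: "\<rho>1 > 0" "\<And>z. dist z x < \<rho>1 \<Longrightarrow> G' z n > 0"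
    using G'x[of n] k n by (auto simp: eventually_at norm_eq_1) (metis mult.right_neutral)
  obtain \<rho>0 where \<rho>0: "\<rho>0 > 0" "ball x \<rho>0 \<subseteq> U" "\<And>z. z \<in> ball x \<rho>0 \<Longrightarrow> G' z n > 0"
    using \<rho>1 \<rho> by (intro that[of "min \<rho>1 \<rho>"]) (auto simp: U_def dist_commute)
  have "open (\<pi> -` V)" using c\<pi> V(1) by (simp add: continuous_on_open_vimage open_vimage)
  moreover have cP: "continuous_on (\<pi> -` V) P"
    unfolding P_def
    by (rule continuous_on_compose2[OF homeomorphism_cont2[OF hom] continuous_on_subset[OF c\<pi>]]) auto
  ultimately have "open (\<pi> -` V \<inter> P -` ball x \<rho>0)"
    using continuous_open_preimage open_ball by blast
  moreover have "x \<in> \<pi> -` V \<inter> P -` ball x \<rho>0"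
    using xV \<rho>0 by (simp add: \<pi>x P_def Sx)
  ultimately obtain \<rho>2 where \<rho>2: "\<rho>2 > 0" "ball x \<rho>2 \<subseteq> \<pi> -` V \<inter> P -` ball x \<rho>0"
    using open_contains_ball by blast
  \<comment> \<open>Both \<open>y\<close> and \<open>P y\<close> must lie in the ball on which
    \<open>G\<close> increases along \<open>n\<close>, because membership is decided by comparing
    them.\<close>
  define \<rho>' where "\<rho>' = min \<rho>0 \<rho>2"
  define B where "B = ball x \<rho>'"
  have \<rho>': "\<rho>' > 0" using \<rho>0 \<rho>2 by (simp add: \<rho>'_def)
  have B\<pi>: "\<pi> y \<in> V" and BP: "P y \<in> ball x \<rho>0" and B0: "y \<in> ball x \<rho>0" if "y \<in> B" for y
    using that \<rho>2 by (auto simp: B_def \<rho>'_def)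
  have BU: "P y \<in> U" and BG: "G' (P y) n > 0" if "y \<in> B" for y
    using BP[OF that] \<rho>0 by auto
  have incr: "G (b + u *\<^sub>R n) < G (b + v *\<^sub>R n)" if "u < v" "b + u *\<^sub>R n \<in> ball x \<rho>0" "b + v *\<^sub>R n \<in> ball x \<rho>0" for b u v
  proof (rule DERIV_pos_imp_increasing[OF that(1), of "\<lambda>t. G (b + t *\<^sub>R n)"])
    fix t assume t: "u \<le> t" "t \<le> v"
    define c where "c = (t - u) / (v - u)"
    have "c * (v - u) = t - u" using that(1) by (simp add: c_def)
    then have c3: "t = (1 - c) * u + c * v" by (simp add: algebra_simps)
    have c: "0 \<le> c" "c \<le> 1" using t that(1) by (simp_all add: c_def)
    have "(1 - c) *\<^sub>R (b + u *\<^sub>R n) + c *\<^sub>R (b + v *\<^sub>R n) \<in> ball x \<rho>0"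
      using c that by (intro convexD_alt[OF convex_ball]) auto
    then have bt: "b + t *\<^sub>R n \<in> ball x \<rho>0" unfolding c3 by (simp add: algebra_simps)
    then have "b + t *\<^sub>R n \<in> U" using \<rho>0 by auto
    then have "((\<lambda>t. G (b + t *\<^sub>R n)) has_derivative (\<lambda>h. G' (b + t *\<^sub>R n) (h *\<^sub>R n))) (at t)"
      by (intro has_derivative_compose[of "\<lambda>t. b + t *\<^sub>R n" "\<lambda>h. h *\<^sub>R n" t UNIV G, OF _ dG])
        (auto intro!: derivative_eq_intros)
    then have "((\<lambda>t. G (b + t *\<^sub>R n)) has_real_derivative G' (b + t *\<^sub>R n) n) (at t)"
      by (simp add: has_field_derivative_def blinfun.scaleR_right mult.commute[of _ "G' (b + t *\<^sub>R n) n"] fun_eq_iff)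
    then show "\<exists>y. ((\<lambda>t. G (b + t *\<^sub>R n)) has_real_derivative y) (at t) \<and> 0 < y"
      using \<rho>0(3)[OF bt] by blast
  qed
  have memF: "y \<in> E \<longleftrightarrow> (y - x) \<bullet> n \<le> F y" if y: "y \<in> B" for y
  proof -
    define b where "b = x + perp n (y - x)"
    define t where "t = (y - x) \<bullet> n"
    have yb: "y = b + t *\<^sub>R n" using perp_add_inner[of n "y - x"] by (simp add: b_def t_def algebra_simps)
    have Pb: "P y = b + F y *\<^sub>R n" using P[OF B\<pi>[OF y]] by (simp add: b_def)
    \<comment> \<open>As \<open>G (P y) = 0\<close>, membership compares \<open>G\<close> at two
      points of the same line parallel to \<open>n\<close>; monotonicity turns this into a
      comparison of their heights.\<close>
    have "y \<in> E \<longleftrightarrow> G y \<le> G (P y)"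
      using mem[of y] B0[OF y] \<rho>0(2) GP[OF B\<pi>[OF y]] by (auto simp: U_def G_def)
    also have "\<dots> \<longleftrightarrow> t \<le> F y"
      using incr[of t "F y" b] incr[of "F y" t b] B0[OF y] BP[OF y] Pb yb
      by (metis less_eq_real_def linorder_not_le)
    finally show ?thesis by (simp add: t_def)
  qed
  have constF: "F (y + t *\<^sub>R n) = F y" for y t
  proof -
    have "perp n (y + t *\<^sub>R n - x) = perp n (y - x)"
      using n by (simp add: perp_def algebra_simps inner_add_left inner_diff_left norm_eq_1)
    then show ?thesis by (simp add: F_def P_def \<pi>_def)
  qed
  have Fx: "F x = 0" by (simp add: F_def P_def \<pi>x Sx)
  define Q where "Q y = G' (P y)" for y
  \<comment> \<open>Implicit differentiation: minus the derivative of \<open>G\<close> along the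
    hyperplane divided by its derivative along \<open>n\<close>, both taken at
    \<open>P y\<close>.\<close>
  define F' where "F' y = (- inverse (Q y n)) *\<^sub>R (Q y o\<^sub>L W)" for y
  have Qn: "Q y n > 0" if "y \<in> B" for y using BG[OF that] by (simp add: Q_def)
  define P' where "P' y = W + (blinfun_scaleR_left n o\<^sub>L F' y)" for y
  have P'app: "P' y h = perp n h + F' y h *\<^sub>R n" for y h
    by (simp add: P'_def W blinfun.add_left)
  have oB: "open B" by (simp add: B_def)
  have dFP: "(F has_derivative blinfun_apply (F' y)) (at y) \<and> (P has_derivative blinfun_apply (P' y)) (at y)" if y: "y \<in> B" for y
  proof -
    \<comment> \<open>The inverse function theorem only says that \<open>S\<close> is
      differentiable. This suffices to differentiate the identity \<open>G (P y) = 0\<close>, which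
      then forces the derivative of \<open>F\<close> to be the explicit \<open>F'\<close>, and that
      can be differentiated again.\<close>
    have dP0: "(P has_derivative (\<lambda>h. S' (\<pi> y) (perp n h))) (at y)"
      unfolding P_def[abs_def]
      using has_derivative_compose[OF d\<pi> dS[OF B\<pi>[OF y]]] by simp
    define DF where "DF h = S' (\<pi> y) (perp n h) \<bullet> n" for h
    have dF: "(F has_derivative DF) (at y)"
      unfolding F_def[abs_def] DF_def by (auto intro!: derivative_eq_intros dP0)
    have "((\<lambda>y. \<pi> y + F y *\<^sub>R n) has_derivative (\<lambda>h. perp n h + DF h *\<^sub>R n)) (at y)"
      by (auto intro!: derivative_eq_intros d\<pi> dF)
    then have dP: "(P has_derivative (\<lambda>h. perp n h + DF h *\<^sub>R n)) (at y)"
      by (rule has_derivative_transform_within_open[OF _ oB y]) (subst P[OF B\<pi>], simp_all add: \<pi>_def)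
    have "((\<lambda>y. G (P y)) has_derivative (\<lambda>h. G' (P y) (perp n h + DF h *\<^sub>R n))) (at y)"
      by (rule has_derivative_compose[OF dP dG[OF BU[OF y]]])
    moreover have "((\<lambda>y. G (P y)) has_derivative (\<lambda>h. 0)) (at y)"
      by (rule has_derivative_transform_within_open[of "\<lambda>_. 0", OF _ oB y]) (auto simp: GP B\<pi>)
    ultimately have "(\<lambda>h. G' (P y) (perp n h + DF h *\<^sub>R n)) = (\<lambda>h. 0)" by (rule has_derivative_unique)
    then have "G' (P y) (perp n h + DF h *\<^sub>R n) = 0" for h by metis
    then have "Q y (perp n h) + DF h * Q y n = 0" for h
      by (simp add: Q_def blinfun.add_right blinfun.scaleR_right)
    then have "DF h = F' y h" for h
    proof -
      assume "Q y (perp n h) + DF h * Q y n = 0" for h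
      then have e: "Q y (perp n h) = - (DF h * Q y n)" by (simp add: eq_neg_iff_add_eq_0)
      show ?thesis using Qn[OF y] by (simp add: F'_def blinfun.minus_left blinfun.scaleR_left W e)
    qed
    then have DF: "DF = blinfun_apply (F' y)" by auto
    have "(\<lambda>h. perp n h + DF h *\<^sub>R n) = blinfun_apply (P' y)" by (auto simp: P'app DF)
    then show ?thesis using dF dP DF by simp
  qed
  define Q' where "Q' y = G'' (P y) o\<^sub>L P' y" for y
  have dQ: "(Q has_derivative blinfun_apply (Q' y)) (at y)" if y: "y \<in> B" for y
    unfolding Q_def[abs_def] Q'_def
    using has_derivative_compose[OF conjunct2[OF dFP[OF y]] dG'[OF BU[OF y]]]
    by (simp add: blinfun_compose.rep_eq o_def)
  define DF' where "DF' y h = (- inverse (Q y n)) *\<^sub>R (Q' y h o\<^sub>L W) +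
      (inverse (Q y n) * (Q' y h n) * inverse (Q y n)) *\<^sub>R (Q y o\<^sub>L W)" for y h
  have dF': "(F' has_derivative DF' y) (at y)" if y: "y \<in> B" for y
  proof -
    have 1: "((\<lambda>y. Q y o\<^sub>L W) has_derivative (\<lambda>h. Q' y h o\<^sub>L W)) (at y)"
      by (rule bounded_linear.has_derivative[OF bounded_bilinear.bounded_linear_left[OF bounded_bilinear_blinfun_compose] dQ[OF y]])
    have 2: "((\<lambda>y. Q y n) has_derivative (\<lambda>h. Q' y h n)) (at y)"
      by (rule bounded_linear.has_derivative[OF blinfun.bounded_linear_left dQ[OF y]])
    have 3: "((\<lambda>y. - inverse (Q y n)) has_derivative (\<lambda>h. inverse (Q y n) * (Q' y h n) * inverse (Q y n))) (at y)"
      using has_derivative_minus[OF Deriv.has_derivative_inverse[OF _ 2]] Qn[OF y] by simp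
    show ?thesis unfolding F'_def[abs_def] DF'_def
      by (rule has_derivative_scaleR[OF 3 1])
  qed
  define F'' where "F'' y = Blinfun (DF' y)" for y
  have F'': "blinfun_apply (F'' y) = DF' y" if "y \<in> B" for y
    unfolding F''_def by (rule bounded_linear_Blinfun_apply) (rule has_derivative_bounded_linear[OF dF'[OF that]])
  have cont_F'': "continuous_on B F''"
  proof (rule continuous_on_blinfun_componentwise)
    fix i :: 'a
    have cF': "continuous_on B F'" by (meson continuous_at_imp_continuous_on dF' has_derivative_continuous)
    have cP: "continuous_on B P" by (meson continuous_at_imp_continuous_on dFP has_derivative_continuous)
    have cQ: "continuous_on B Q" by (meson continuous_at_imp_continuous_on dQ has_derivative_continuous)
    have cG''P: "continuous_on B (\<lambda>y. G'' (P y))"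
      by (rule continuous_on_compose2[OF cG'' cP]) (use BU in auto)
    have cP': "continuous_on B P'" unfolding P'_def by (intro continuous_intros cF')
    have cQ': "continuous_on B Q'" unfolding Q'_def by (intro continuous_intros cG''P cP')
    have "continuous_on B (\<lambda>y. DF' y i)" unfolding DF'_def
      by (intro continuous_intros cQ cQ') (use Qn in force)+
    then show "continuous_on B (\<lambda>y. F'' y i)"
      by (rule continuous_on_eq) (simp add: F'')
  qed
  have F'x: "F' x = 0"
  proof -
    have "Q x (perp n h) = 0" for h using n by (simp add: Q_def P_def \<pi>x Sx G'x)
    then have "Q x o\<^sub>L W = 0" by (intro blinfun_eqI) (simp add: W)
    then show ?thesis by (simp add: F'_def)
  qed
  have "local_subgraph E x n \<rho>' F F' F''"
    unfolding local_subgraph_def C2_on_with_def B_def[symmetric]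
    using n \<rho>' dFP dF' F'' cont_F'' constF memF by auto
  then show ?thesis using Fx F'x by blast
qed

section \<open>The limit\<close>

lemma classC_closed: "E \<in> classC \<Longrightarrow> closed E"
  by (auto simp: classC_def)

lemma converges_C_const: "converges_C (\<lambda>_. E) E"
proof -
  have "C2_diffeo_with (\<lambda>y::'a. y) (\<lambda>_. id_blinfun) (\<lambda>_. 0)"
    by (auto simp: C2_diffeo_with_def bij_id[unfolded id_def] intro!: derivative_eq_intros)
  then show ?thesis
    unfolding converges_C_def
    by (intro exI[of _ "\<lambda>_ y. y"] exI[of _ "\<lambda>_ _. id_blinfun"] exI[of _ "\<lambda>_ _. 0"]) auto
qed

text \<open>The derivative of \<open>f'\<close> applied to \<nu>, which is identically zero. Thus
  the full trace of the Hessian is its trace on the hyperplane orthogonal to \<nu>, and the normal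
  entry for a nearby \<open>n\<close> is of the order of |n - \<nu>|.\<close>

lemma local_subgraph_hessian_normal:
  assumes loc: "local_subgraph E x \<nu> \<rho> f f' f''"
  shows "f'' x v \<nu> = 0"
proof -
  have x: "x \<in> ball x \<rho>" and df': "(f' has_derivative blinfun_apply (f'' x)) (at x)"
    using loc by (auto simp: local_subgraph_def C2_on_with_def)
  have "((\<lambda>y. f' y \<nu>) has_derivative (\<lambda>v. f'' x v \<nu>)) (at x)"
    by (rule bounded_linear.has_derivative[OF blinfun.bounded_linear_left df'])
  moreover have "((\<lambda>y. f' y \<nu>) has_derivative (\<lambda>v. 0)) (at x)"
    by (rule has_derivative_transform_within_open[of "\<lambda>_. 0", OF _ open_ball x]) (auto simp: local_subgraph_deriv_normal[OF loc])
  ultimately have "(\<lambda>v. f'' x v \<nu>) = (\<lambda>v. 0)" by (rule has_derivative_unique)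
  then show ?thesis by metis
qed

text \<open>Rescaling by \<open>t\<close> makes the local expansion an instance of
  \<open>signed_volume_quadratic\<close> with \<tau> = t. That estimate produces the trace on the
  hyperplane orthogonal to the tilted normal \<open>n\<close>, so half of \<epsilon> is spent on the
  entry \<open>A n n\<close>, small because \<open>A\<close> vanishes on \<nu>.\<close>

lemma sgvol_asymp:
  fixes E :: "'a::euclidean_space set" and Er :: "real \<Rightarrow> 'a set"
  assumes d: "DIM('a) \<ge> 2"
    and loc: "local_subgraph E x \<nu> \<rho> f f' f''" and f'x: "f' x = 0"
    and conv: "converges_C Er E"
    and closed: "\<And>r. r > 0 \<Longrightarrow> closed (Er r)"
    and front: "\<And>r. r > 0 \<Longrightarrow> x \<in> frontier (Er r)"
    and \<epsilon>: "\<epsilon> > 0"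
  defines "c \<equiv> unit_ball_vol (real (DIM('a) - 1)) / (real DIM('a) + 1) * - (\<Sum>b\<in>Basis. f'' x b b)"
  shows "\<exists>\<delta>>0. \<forall>\<^sub>F r in at_right 0. \<forall>t. 0 < t \<longrightarrow> t \<le> \<delta> \<longrightarrow>
       \<bar>sgvol (Er r) x t - c * t ^ (DIM('a) + 1)\<bar> \<le> \<epsilon> * t ^ (DIM('a) + 1)"
proof -
  define A where "A = - f'' x"
  define C where "C = norm A + 1"
  define \<omega> where "\<omega> = unit_ball_vol (real (DIM('a) - 1)) / (real DIM('a) + 1)"
  have C: "C > 0" "norm A \<le> C" using norm_ge_zero[of A] by (auto simp: C_def intro: add_nonneg_pos)
  have \<omega>: "\<omega> > 0" by (simp add: \<omega>_def)
  have \<nu>: "norm \<nu> = 1" using loc by (simp add: local_subgraph_def)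
  have A\<nu>: "A v \<nu> = 0" for v
    using local_subgraph_hessian_normal[OF loc, of v] by (simp add: A_def blinfun.minus_left)
  have c: "c = \<omega> * (\<Sum>b\<in>Basis. A b b)"
    by (simp add: c_def A_def \<omega>_def blinfun.minus_left sum_negf)
  show ?thesis
  proof (rule signed_volume_quadratic[OF d C(1) half_gt_zero[OF \<epsilon>], folded \<omega>_def])
    fix \<tau>0 \<eta>0 :: real
    assume \<tau>0: "\<tau>0 > 0" and \<eta>0: "\<eta>0 > 0" and core:
      "\<And>(n::'a) A q \<tau> F. norm n = 1 \<Longrightarrow> norm A \<le> C \<Longrightarrow> 0 < \<tau> \<Longrightarrow> \<tau> < \<tau>0 \<Longrightarrow> F \<in> sets borel \<Longrightarrow>
        (\<And>v. norm v \<le> 1 \<Longrightarrow> \<bar>q v - blinfun_apply (blinfun_apply A v) v / 2\<bar> \<le> \<eta>0) \<Longrightarrow>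
        (\<And>v. norm v \<le> 1 \<Longrightarrow> v \<in> F \<longleftrightarrow> v \<bullet> n + \<tau> * q v \<le> 0) \<Longrightarrow>
        \<bar>(measure lborel (cball 0 1 - F) - measure lborel (cball 0 1 \<inter> F)) -
          \<tau> * (\<omega> * ((\<Sum>i\<in>Basis. A i i) - A n n))\<bar> \<le> (\<epsilon> / 2) * \<tau>"
    \<comment> \<open>The first bound meets the tolerance on the rescaled quadratic term; the second
      makes \<omega> |A n n| \<le> \<omega> C \<eta> at most \<epsilon> / 2.\<close>
    define \<eta> where "\<eta> = min \<eta>0 (\<epsilon> / (2 * \<omega> * C))"
    have \<eta>: "\<eta> > 0" "\<eta> \<le> \<eta>0" "\<omega> * (C * \<eta>) \<le> \<epsilon> / 2"
    proof -
      have "\<eta> \<le> \<epsilon> / (2 * \<omega> * C)" by (simp add: \<eta>_def)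
      then show "\<omega> * (C * \<eta>) \<le> \<epsilon> / 2" using C \<omega> by (simp add: field_simps)
    qed (use \<eta>0 \<epsilon> C \<omega> in \<open>auto simp: \<eta>_def\<close>)
    obtain \<delta>0 where \<delta>0: "\<delta>0 > 0" and ev: "\<forall>\<^sub>F r in at_right 0. \<exists>n h. norm n = 1 \<and> norm (n - \<nu>) \<le> \<eta> \<and>
      (\<forall>z. norm z \<le> \<delta>0 \<longrightarrow> (x + z \<in> Er r \<longleftrightarrow> z \<bullet> n + h z \<le> 0) \<and> \<bar>h z + f'' x z z / 2\<bar> \<le> \<eta> * (norm z)\<^sup>2)"
      using local_quadratic_form[OF loc f'x conv closed front \<eta>(1)] by blast
    define \<delta> where "\<delta> = min \<delta>0 (\<tau>0 / 2)"
    have \<delta>: "\<delta> > 0" "\<delta> \<le> \<delta>0" "\<delta> < \<tau>0" using \<delta>0 \<tau>0 by (auto simp: \<delta>_def)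
    have ev0: "\<forall>\<^sub>F r in at_right (0::real). 0 < r"
      by (simp add: eventually_at_right_less)
    have "\<forall>\<^sub>F r in at_right 0. \<forall>t. 0 < t \<longrightarrow> t \<le> \<delta> \<longrightarrow>
         \<bar>sgvol (Er r) x t - c * t ^ (DIM('a) + 1)\<bar> \<le> \<epsilon> * t ^ (DIM('a) + 1)"
      using ev ev0
    proof eventually_elim
      case (elim r)
      then obtain n h where n: "norm n = 1" "norm (n - \<nu>) \<le> \<eta>"
        and Er: "\<And>z. norm z \<le> \<delta>0 \<Longrightarrow> x + z \<in> Er r \<longleftrightarrow> z \<bullet> n + h z \<le> 0"
        and h: "\<And>z. norm z \<le> \<delta>0 \<Longrightarrow> \<bar>h z + f'' x z z / 2\<bar> \<le> \<eta> * (norm z)\<^sup>2"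
        by blast
      have meas[measurable]: "Er r \<in> sets borel" using closed[of r] elim by auto
      show ?case
      proof (intro allI impI)
        fix t :: real assume t: "0 < t" "t \<le> \<delta>"
        define F where "F = (\<lambda>v. x + t *\<^sub>R v) -` Er r"
        \<comment> \<open>The remainder scales by t^2 and the hyperplane term by \<open>t\<close>;
          dividing the defining inequality by \<open>t\<close> leaves the factor \<tau> = t in front
          of \<open>q\<close>.\<close>
        define q where "q v = h (t *\<^sub>R v) / t\<^sup>2" for v
        have tv: "norm (t *\<^sub>R v) \<le> \<delta>0" if "norm v \<le> 1" for v
        proof -
          have "t * norm v \<le> \<delta> * 1" using t that by (intro mult_mono) auto
          then show ?thesis using t \<delta> by simp
        qed
        have "(\<lambda>v. x + t *\<^sub>R v) \<in> borel_measurable borel" by measurable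
        from measurable_sets[OF this meas] have Fm: "F \<in> sets borel" by (simp add: F_def)
        have qA: "\<bar>q v - A v v / 2\<bar> \<le> \<eta>0" if v: "norm v \<le> 1" for v
        proof -
          have "q v - A v v / 2 = (h (t *\<^sub>R v) + f'' x (t *\<^sub>R v) (t *\<^sub>R v) / 2) / t\<^sup>2"
            using t by (simp add: q_def A_def blinfun.minus_left blinfun.scaleR_left blinfun.scaleR_right field_simps power2_eq_square)
          then have "\<bar>q v - A v v / 2\<bar> = \<bar>h (t *\<^sub>R v) + f'' x (t *\<^sub>R v) (t *\<^sub>R v) / 2\<bar> / t\<^sup>2"
            by simp
          also have "\<dots> \<le> (\<eta> * (norm (t *\<^sub>R v))\<^sup>2) / t\<^sup>2"
            by (intro divide_right_mono h tv v) auto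
          also have "\<dots> = \<eta> * (norm v)\<^sup>2" using t by (simp add: power_mult_distrib)
          also have "\<dots> \<le> \<eta> * 1" using \<eta> v by (intro mult_left_mono) (auto simp: power_le_one)
          finally show ?thesis using \<eta> by simp
        qed
        have FF: "v \<in> F \<longleftrightarrow> v \<bullet> n + t * q v \<le> 0" if v: "norm v \<le> 1" for v
        proof -
          have "t *\<^sub>R v \<bullet> n + h (t *\<^sub>R v) = t * (v \<bullet> n + t * q v)"
            using t by (simp add: q_def power2_eq_square algebra_simps)
          then show ?thesis using Er[OF tv[OF v]] t by (simp add: F_def mult_le_0_iff)
        qed
        let ?tr = "\<Sum>i\<in>Basis. A i i"
        have main: "\<bar>sgvol F 0 1 - t * (\<omega> * (?tr - A n n))\<bar> \<le> (\<epsilon> / 2) * t"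
          unfolding sgvol_def by (rule core[OF n(1) C(2) t(1) _ Fm qA FF]) (use t \<delta> in auto)
        have "\<bar>A n n\<bar> \<le> C * \<eta>"
        proof -
          have "A n n = A n (n - \<nu>)" by (simp add: blinfun.diff_right A\<nu>)
          also have "\<bar>\<dots>\<bar> \<le> C * norm n * norm (n - \<nu>)" by (rule bilinear_bound[OF C(2)])
          also have "\<dots> \<le> C * \<eta>" using n C by simp
          finally show ?thesis .
        qed
        then have "\<omega> * \<bar>A n n\<bar> \<le> \<omega> * (C * \<eta>)" using \<omega> by (intro mult_left_mono) auto
        then have "\<omega> * \<bar>A n n\<bar> \<le> \<epsilon> / 2" using \<eta>(3) by linarith
        then have "t * (\<omega> * \<bar>A n n\<bar>) \<le> t * (\<epsilon> / 2)" using t by (intro mult_left_mono) auto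
        moreover have "\<bar>t * (\<omega> * A n n)\<bar> = t * (\<omega> * \<bar>A n n\<bar>)" using t \<omega> by (simp add: abs_mult)
        moreover have "t * (\<omega> * (?tr - A n n)) = t * c - t * (\<omega> * A n n)" by (simp add: c algebra_simps)
        ultimately have "\<bar>sgvol F 0 1 - t * c\<bar> \<le> t * (\<epsilon> / 2) + t * (\<epsilon> / 2)"
          using main unfolding mult.commute[of "\<epsilon> / 2"] by linarith
        then have "\<bar>sgvol F 0 1 - t * c\<bar> \<le> \<epsilon> * t" by (simp add: mult.commute)
        then have "t ^ DIM('a) * \<bar>sgvol F 0 1 - t * c\<bar> \<le> t ^ DIM('a) * (\<epsilon> * t)"
          using t by (intro mult_left_mono) auto
        moreover have "sgvol (Er r) x t - c * t ^ (DIM('a) + 1) = t ^ DIM('a) * (sgvol F 0 1 - t * c)"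
          unfolding sgvol_scale[OF meas t(1)] F_def[symmetric] by (simp add: algebra_simps)
        ultimately show "\<bar>sgvol (Er r) x t - c * t ^ (DIM('a) + 1)\<bar> \<le> \<epsilon> * t ^ (DIM('a) + 1)"
          using t by (simp add: abs_mult mult_ac)
      qed
    qed
    then show ?thesis using \<delta>(1) by blast
  qed
qed

lemma Ksr_limit_normal_graph:
  fixes E :: "'a::euclidean_space set" and Er :: "real \<Rightarrow> 'a set"
  assumes d: "DIM('a) \<ge> 2" and s: "s \<ge> 1"
    and loc: "local_subgraph E x \<nu> \<rho> f f' f''" and f'x: "f' x = 0"
    and conv: "converges_C Er E"
    and closed: "\<And>r. r > 0 \<Longrightarrow> closed (Er r)"
    and front: "\<And>r. r > 0 \<Longrightarrow> x \<in> frontier (Er r)"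
  shows "((\<lambda>r. Ksr s r x (Er r) / sigma DIM('a) s r) \<longlongrightarrow>
     unit_ball_vol (real (DIM('a) - 1)) * - (\<Sum>b\<in>Basis. f'' x b b)) (at_right 0)"
proof -
  have "((\<lambda>r. Ksr s r x (Er r) / sigma DIM('a) s r) \<longlongrightarrow>
     (unit_ball_vol (real (DIM('a) - 1)) / (real DIM('a) + 1) * - (\<Sum>b\<in>Basis. f'' x b b)) * (real DIM('a) + 1)) (at_right 0)"
    by (rule Ksr_asymp_of_sgvol[OF s]) (use closed sgvol_asymp[OF d loc f'x conv closed front] in auto)
  also have "(unit_ball_vol (real (DIM('a) - 1)) / (real DIM('a) + 1) * - (\<Sum>b\<in>Basis. f'' x b b)) * (real DIM('a) + 1) =
     unit_ball_vol (real (DIM('a) - 1)) * - (\<Sum>b\<in>Basis. f'' x b b)"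
    by (simp add: field_simps)
  finally show ?thesis .
qed

lemma meanK_eq:
  fixes E :: "'a::euclidean_space set"
  assumes d: "DIM('a) \<ge> 2" and closed: "closed E" and front: "x \<in> frontier E"
    and loc: "local_subgraph E x \<nu> \<rho> f f' f''" and fx: "f x = 0" and f'x: "f' x = 0"
  shows "meanK x E = - (\<Sum>b\<in>Basis. f'' x b b)"
  unfolding meanK_def
proof (rule the_equality)
  show "\<exists>\<nu> \<rho> f f' g''. local_subgraph E x \<nu> \<rho> f f' g'' \<and> f x = 0 \<and> f' x = 0 \<and>
      - (\<Sum>b\<in>Basis. f'' x b b) = - (\<Sum>b\<in>Basis. g'' x b b)"
    using loc fx f'x by blast
next
  fix k assume "\<exists>\<nu> \<rho> f f' f''. local_subgraph E x \<nu> \<rho> f f' f'' \<and> f x = 0 \<and> f' x = 0 \<and>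
      k = - (\<Sum>b\<in>Basis. f'' x b b)"
  then obtain \<nu>2 \<rho>2 f2 f2' f2'' where loc2: "local_subgraph E x \<nu>2 \<rho>2 f2 f2' f2''" "f2' x = 0"
    and k: "k = - (\<Sum>b\<in>Basis. f2'' x b b)" by blast
  \<comment> \<open>Any exponent s \<ge> 1 would do here: the quotient does not mention the chart,
    so two charts give two limits of one function.\<close>
  have "((\<lambda>r. Ksr 1 r x E / sigma DIM('a) 1 r) \<longlongrightarrow> unit_ball_vol (real (DIM('a) - 1)) * - (\<Sum>b\<in>Basis. f'' x b b)) (at_right 0)"
    by (rule Ksr_limit_normal_graph[OF d _ loc f'x converges_C_const]) (use closed front in auto)
  moreover have "((\<lambda>r. Ksr 1 r x E / sigma DIM('a) 1 r) \<longlongrightarrow> unit_ball_vol (real (DIM('a) - 1)) * k) (at_right 0)"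
    unfolding k by (rule Ksr_limit_normal_graph[OF d _ loc2 converges_C_const]) (use closed front in auto)
  ultimately have eq: "unit_ball_vol (real (DIM('a) - 1)) * - (\<Sum>b\<in>Basis. f'' x b b) = unit_ball_vol (real (DIM('a) - 1)) * k"
    by (rule tendsto_unique[OF trivial_limit_at_right_real])
  have "unit_ball_vol (real (DIM('a) - 1)) > 0" by (rule unit_ball_vol_pos) simp
  then have "unit_ball_vol (real (DIM('a) - 1)) \<noteq> 0" by (rule less_imp_neq[THEN not_sym])
  from mult_left_cancel[THEN iffD1, OF this eq] show "k = - (\<Sum>b\<in>Basis. f'' x b b)" ..
qed

theorem theorem4p6:
  fixes Er :: "real \<Rightarrow> 'a::euclidean_space set" and E :: "'a set"
    and s :: real and x :: 'a
  assumes "DIM('a) \<ge> 2"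
    and "s \<ge> 1"
    and "\<forall>r>0. Er r \<in> classC"
    and "E \<in> classC"
    and "converges_C Er E"
    and "x \<in> frontier E"
    and "\<forall>r>0. x \<in> frontier (Er r)"
  shows "((\<lambda>r. Ksr s r x (Er r) / sigma DIM('a) s r) \<longlongrightarrow>
            unit_ball_vol (real (DIM('a) - 1)) * meanK x E) (at_right 0)"
proof -
  have cl: "closed E" "\<And>r. r > 0 \<Longrightarrow> closed (Er r)"
    using assms(3,4) classC_closed by auto
  obtain \<nu>0 \<rho>0 g g' g'' where loc0: "local_subgraph E x \<nu>0 \<rho>0 g g' g''"
    using assms(4,6) unfolding classC_def by blast
  have "g x = 0"
  proof -
    have "x \<in> ball x \<rho>0" using loc0 by (simp add: local_subgraph_def)
    moreover have "x \<in> E" "x \<notin> interior E" using assms(6) cl(1) by (auto simp: frontier_def)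
    ultimately show ?thesis using local_subgraph_zero[OF loc0, of x] by simp
  qed
  from normal_graph_exists[OF loc0 this]
  obtain \<nu> \<rho> f f' f'' where loc: "local_subgraph E x \<nu> \<rho> f f' f''" and f: "f x = 0" "f' x = 0"
    by blast
  show ?thesis
    unfolding meanK_eq[OF assms(1) cl(1) assms(6) loc f]
    by (rule Ksr_limit_normal_graph[OF assms(1,2) loc f(2) assms(5) cl(2)]) (use assms(7) in auto)
qed

end
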